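(* Let $\mathcal C$ be a symmetric monoidal category equipped with a class $\mathcal Q$ of regular epimorphisms satisfying the standing assumptions in the context. Let $(A,t_1,t_2,e)$ be a multiplier Hopf monoid in $\mathcal C$ whose multiplication $m:=e1.t_1$ is non-degenerate and whose counit is dense ($e\in\mathcal Q$). Let $V$ be a module over the multiplier bimonoid $(A,t_1,t_2,e)$ whose underlying $(A,m)$-action $v\colon VA\to V$ is non-degenerate. Suppose that $V$ has a left dual $\overline V$ in $\mathcal C$ (with unit $\eta\colon I\to V\overline V$ and counit $\epsilon\colon\overline VV\to I$) and that the morphism $$\overline v:=\epsilon1.\,1(s^*v)1.\,1c^{-1}1.\,11\eta\;\colon\;\overline VA\to\overline VAV\overline V\to\overline VVA\overline V\to\overline VV\overline V\to\overline V$$ is in $\mathcal Q$. Then $\overline v$ makes $\overline V$ into an $(A,t_1,t_2,e)$-module which is left dual to $V$ (in the monoidal category of $(A,t_1,t_2,e)$-modules).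
   Context: Notation: $\mathcal C$ is written as if strict; the monoidal product (of objects and morphisms) is juxtaposition, the unit is $I$, the braiding is $c_{X,Y}\colon XY\to YX$ (here a symmetry). The composite of $f\colon A\to B$ and $g\colon B\to C$ is $g.f$ (juxtaposition binds more tightly than the dot); identity morphisms are written $1$; $A^n=A\cdots A$. Subscripts of $c$ are omitted; $c^{-1}\colon XY\to YX$ means $(c_{Y,X})^{-1}$. Standing assumptions: $\mathcal Q$ is a class of regular epimorphisms in $\mathcal C$, closed under composition and monoidal product, containing the isomorphisms, right-cancellative ($s\in\mathcal Q$ and $t.s\in\mathcal Q$ imply $t\in\mathcal Q$), and such that each $q\in \mathcal Q$ is the coequalizer of some pair of morphisms for which this coequalizer is preserved by taking the monoidal product with any fixed object. An associative $m\colon A^2\to A$ is non-degenerate if for all objects $X,Y$ the maps $\mathcal C(X,YA)\to\mathcal C(XA,YA)$, $f\mapsto 1m.f1$, and $\mathcal C(X,AY)\to\mathcal C(AX,AY)$, $g\mapsto m1.1g$, are injective. Multiplier bimonoid: $(A,t_1,t_2,e)$ with $t_1,t_2\colon A^2\to A^2$, $e\colon A\to I$ such that $t_11.c^{-1}1.1t_1.c1.1t_1=1t_1.t_11$ and $1e.t_1=1e$; $1t_2.1c^{-1}.t_21.1c.t_21=t_21.1t_2$ and $e1.t_2=e1$; $1t_1.t_21=t_21.1t_1$ and $e1.t_1=1e.t_2$. Its multiplication $m:=e1.t_1=1e.t_2$ is associative. It is a multiplier Hopf monoid if $t_1,t_2$ are isomorphisms. Its antipode $s$ has components $s_1=e1.t_1^{-1}$,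 $s_2=1e.t_2^{-1}\colon A^2\to A$. Modules: a module over the semigroup $(A,m)$ is an object $V$ with $v\colon VA\to V$ in $\mathcal Q$ satisfying $v.v1=v.1m$; it is non-degenerate if for all $X,Y$ the map $\mathcal C(X,YV)\to\mathcal C(XA,YV)$, $f\mapsto 1v.f1$, is injective. A module over $(A,t_1,t_2,e)$ is an object $V$ with $v_2\colon VA\to VA$ satisfying $1t_2.1c^{-1}.v_21.1c.v_21=v_21.1t_2\colon VA^2\to VA^2$ and $1e.v_2\in\mathcal Q$; its underlying $(A,m)$-action is $v:=1e.v_2$. Since $m$ is non-degenerate, $v\leftrightarrow v_2$ is a bijection between $(A,m)$-module structures and $(A,t_1,t_2,e)$-module structures on a given object; $v_2$ is determined by $v_2.v1=v1.1t_2\colon VA^2\to VA$. To say that $\overline v$ makes $\overline V$ an $(A,t_1,t_2,e)$-module means that $\overline v$ is an $(A,m)$-module structure, with the corresponding structure $\overline v_2$. Morphisms of modules are morphisms of $\mathcal C$ commuting with the actions. Monoidal structure: the product of modules $(V,v)$ and $(W,w)$ is $VW$ with action $v1.1c^{-1}.1w_2\colon VWA\to VWA\to VAW\to VW$; the unit is $I$ with action $e\colon IA=A\to I$; constraints are those of $\mathcal C$. (Under the hypotheses this is a monoidal category.) The morphism $s^*v\colon VA\to V$ is the unique morphism satisfying $(s^*v).v1=v.1s_2\colon VA^2\to V$. *)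

theory Defs
  imports Main
begin

section \<open>Symmetric monoidal categories\<close>

text \<open>
  A category is given by a set of objects and hom-sets indexed by pairs of objects. Hom-sets need
  not be disjoint: a morphism is always considered together with its source and target.
  The monoidal structure is not assumed to be strict, so the associativity and unit constraints
  which the usual notation suppresses are written out below.
\<close>

record ('o, 'm) moncat =
  Obj :: "'o set"
  Hom :: "'o \<Rightarrow> 'o \<Rightarrow> 'm set"
  Ident :: "'o \<Rightarrow> 'm"  ("\<one>\<index>")
  Comp :: "'m \<Rightarrow> 'm \<Rightarrow> 'm"  (infixr "\<cdot>\<index>" 60)
  TensO :: "'o \<Rightarrow> 'o \<Rightarrow> 'o"  (infixl "\<odot>\<index>" 75)
  TensA :: "'m \<Rightarrow> 'm \<Rightarrow> 'm"  (infixl "\<otimes>\<index>" 70)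
  UnitO :: "'o"  ("\<I>\<index>")
  Assoc :: "'o \<Rightarrow> 'o \<Rightarrow> 'o \<Rightarrow> 'm"  ("\<alpha>\<index>")
  LUnit :: "'o \<Rightarrow> 'm"  ("\<lambda>\<lambda>\<index>")
  RUnit :: "'o \<Rightarrow> 'm"  ("\<rho>\<index>")

record ('o, 'm) symmoncat = "('o, 'm) moncat" +
  Braid :: "'o \<Rightarrow> 'o \<Rightarrow> 'm"  ("\<c>\<index>")

definition inverse_arrows :: "('o, 'm, 'z) moncat_scheme \<Rightarrow> 'o \<Rightarrow> 'o \<Rightarrow> 'm \<Rightarrow> 'm \<Rightarrow> bool"
  where "inverse_arrows C X Y f g \<longleftrightarrow>
    f \<in> Hom C X Y \<and> g \<in> Hom C Y X \<and> g \<cdot>\<^bsub>C\<^esub> f = \<one>\<^bsub>C\<^esub> X \<and> f \<cdot>\<^bsub>C\<^esub> g = \<one>\<^bsub>C\<^esub> Y"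

definition iso_arrow :: "('o, 'm, 'z) moncat_scheme \<Rightarrow> 'o \<Rightarrow> 'o \<Rightarrow> 'm \<Rightarrow> bool"
  where "iso_arrow C X Y f \<longleftrightarrow> (\<exists>g. inverse_arrows C X Y f g)"

definition inv_arrow :: "('o, 'm, 'z) moncat_scheme \<Rightarrow> 'o \<Rightarrow> 'o \<Rightarrow> 'm \<Rightarrow> 'm"
  where "inv_arrow C X Y f = (THE g. inverse_arrows C X Y f g)"

locale monoidal_category =
  fixes C :: "('o, 'm, 'z) moncat_scheme" (structure)
  assumes ident_hom: "X \<in> Obj C \<Longrightarrow> \<one> X \<in> Hom C X X"
    and comp_hom: "\<lbrakk>X \<in> Obj C; Y \<in> Obj C; Z \<in> Obj C; f \<in> Hom C X Y; g \<in> Hom C Y Z\<rbrakk>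
      \<Longrightarrow> g \<cdot> f \<in> Hom C X Z"
    and comp_ident_right: "\<lbrakk>X \<in> Obj C; Y \<in> Obj C; f \<in> Hom C X Y\<rbrakk> \<Longrightarrow> f \<cdot> \<one> X = f"
    and comp_ident_left: "\<lbrakk>X \<in> Obj C; Y \<in> Obj C; f \<in> Hom C X Y\<rbrakk> \<Longrightarrow> \<one> Y \<cdot> f = f"
    and comp_assoc: "\<lbrakk>W \<in> Obj C; X \<in> Obj C; Y \<in> Obj C; Z \<in> Obj C;
      f \<in> Hom C W X; g \<in> Hom C X Y; h \<in> Hom C Y Z\<rbrakk> \<Longrightarrow> (h \<cdot> g) \<cdot> f = h \<cdot> (g \<cdot> f)"
    and unit_obj: "\<I> \<in> Obj C"
    and tensor_obj: "\<lbrakk>X \<in> Obj C; Y \<in> Obj C\<rbrakk> \<Longrightarrow> X \<odot> Y \<in> Obj C"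
    and tensor_hom: "\<lbrakk>X \<in> Obj C; Y \<in> Obj C; X' \<in> Obj C; Y' \<in> Obj C;
      f \<in> Hom C X Y; g \<in> Hom C X' Y'\<rbrakk> \<Longrightarrow> f \<otimes> g \<in> Hom C (X \<odot> X') (Y \<odot> Y')"
    and tensor_ident: "\<lbrakk>X \<in> Obj C; Y \<in> Obj C\<rbrakk> \<Longrightarrow> \<one> X \<otimes> \<one> Y = \<one> (X \<odot> Y)"
    and tensor_comp: "\<lbrakk>X \<in> Obj C; Y \<in> Obj C; Z \<in> Obj C; X' \<in> Obj C; Y' \<in> Obj C; Z' \<in> Obj C;
      f \<in> Hom C X Y; g \<in> Hom C Y Z; f' \<in> Hom C X' Y'; g' \<in> Hom C Y' Z'\<rbrakk>
      \<Longrightarrow> (g \<cdot> f) \<otimes> (g' \<cdot> f') = (g \<otimes> g') \<cdot> (f \<otimes> f')"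
    and assoc_iso: "\<lbrakk>X \<in> Obj C; Y \<in> Obj C; Z \<in> Obj C\<rbrakk>
      \<Longrightarrow> iso_arrow C (X \<odot> Y \<odot> Z) (X \<odot> (Y \<odot> Z)) (\<alpha> X Y Z)"
    and lunit_iso: "X \<in> Obj C \<Longrightarrow> iso_arrow C (\<I> \<odot> X) X (\<lambda>\<lambda> X)"
    and runit_iso: "X \<in> Obj C \<Longrightarrow> iso_arrow C (X \<odot> \<I>) X (\<rho> X)"
    and assoc_natural: "\<lbrakk>X \<in> Obj C; Y \<in> Obj C; Z \<in> Obj C; X' \<in> Obj C; Y' \<in> Obj C; Z' \<in> Obj C;
      f \<in> Hom C X X'; g \<in> Hom C Y Y'; h \<in> Hom C Z Z'\<rbrakk>
      \<Longrightarrow> \<alpha> X' Y' Z' \<cdot> ((f \<otimes> g) \<otimes> h) = (f \<otimes> (g \<otimes> h)) \<cdot> \<alpha> X Y Z"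
    and lunit_natural: "\<lbrakk>X \<in> Obj C; Y \<in> Obj C; f \<in> Hom C X Y\<rbrakk>
      \<Longrightarrow> \<lambda>\<lambda> Y \<cdot> (\<one> \<I> \<otimes> f) = f \<cdot> \<lambda>\<lambda> X"
    and runit_natural: "\<lbrakk>X \<in> Obj C; Y \<in> Obj C; f \<in> Hom C X Y\<rbrakk>
      \<Longrightarrow> \<rho> Y \<cdot> (f \<otimes> \<one> \<I>) = f \<cdot> \<rho> X"
    and pentagon: "\<lbrakk>W \<in> Obj C; X \<in> Obj C; Y \<in> Obj C; Z \<in> Obj C\<rbrakk>
      \<Longrightarrow> \<alpha> W X (Y \<odot> Z) \<cdot> \<alpha> (W \<odot> X) Y Z
        = (\<one> W \<otimes> \<alpha> X Y Z) \<cdot> \<alpha> W (X \<odot> Y) Z \<cdot> (\<alpha> W X Y \<otimes> \<one> Z)"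
    and triangle: "\<lbrakk>X \<in> Obj C; Y \<in> Obj C\<rbrakk>
      \<Longrightarrow> (\<one> X \<otimes> \<lambda>\<lambda> Y) \<cdot> \<alpha> X \<I> Y = \<rho> X \<otimes> \<one> Y"

locale symmetric_monoidal_category = monoidal_category C
  for C :: "('o, 'm, 'z) symmoncat_scheme" (structure) +
  assumes braid_hom: "\<lbrakk>X \<in> Obj C; Y \<in> Obj C\<rbrakk> \<Longrightarrow> \<c> X Y \<in> Hom C (X \<odot> Y) (Y \<odot> X)"
    and braid_natural: "\<lbrakk>X \<in> Obj C; Y \<in> Obj C; X' \<in> Obj C; Y' \<in> Obj C;
      f \<in> Hom C X X'; g \<in> Hom C Y Y'\<rbrakk> \<Longrightarrow> \<c> X' Y' \<cdot> (f \<otimes> g) = (g \<otimes> f) \<cdot> \<c> X Y"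
    and braid_symmetric: "\<lbrakk>X \<in> Obj C; Y \<in> Obj C\<rbrakk> \<Longrightarrow> \<c> Y X \<cdot> \<c> X Y = \<one> (X \<odot> Y)"
    and hexagon: "\<lbrakk>X \<in> Obj C; Y \<in> Obj C; Z \<in> Obj C\<rbrakk>
      \<Longrightarrow> \<alpha> Y Z X \<cdot> \<c> X (Y \<odot> Z) \<cdot> \<alpha> X Y Z
        = (\<one> Y \<otimes> \<c> X Z) \<cdot> \<alpha> Y X Z \<cdot> (\<c> X Y \<otimes> \<one> Z)"

context
  fixes C :: "('o, 'm, 'z) moncat_scheme" (structure)
begin

text \<open>
  Here \<open>V'\<close> is the left dual: the unit goes from the unit object to \<open>V V'\<close> and the counit from
  \<open>V' V\<close> to the unit object.
\<close>

definition left_dual :: "'o \<Rightarrow> 'o \<Rightarrow> 'm \<Rightarrow> 'm \<Rightarrow> bool"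
  where "left_dual V' V \<eta> \<epsilon> \<longleftrightarrow>
    V' \<in> Obj C \<and> V \<in> Obj C \<and> \<eta> \<in> Hom C \<I> (V \<odot> V') \<and> \<epsilon> \<in> Hom C (V' \<odot> V) \<I> \<and>
    \<rho> V \<cdot> (\<one> V \<otimes> \<epsilon>) \<cdot> \<alpha> V V' V \<cdot> (\<eta> \<otimes> \<one> V) = \<lambda>\<lambda> V \<and>
    \<lambda>\<lambda> V' \<cdot> (\<epsilon> \<otimes> \<one> V') \<cdot> inv_arrow C (V' \<odot> V \<odot> V') (V' \<odot> (V \<odot> V')) (\<alpha> V' V V')
      \<cdot> (\<one> V' \<otimes> \<eta>) = \<rho> V'"

end


section \<open>Regular epimorphisms\<close>

context
  fixes C :: "('o, 'm, 'z) moncat_scheme" (structure)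
begin

definition coequalizer :: "'o \<Rightarrow> 'o \<Rightarrow> 'o \<Rightarrow> 'm \<Rightarrow> 'm \<Rightarrow> 'm \<Rightarrow> bool"
  where "coequalizer W X Y f g q \<longleftrightarrow>
    f \<in> Hom C W X \<and> g \<in> Hom C W X \<and> q \<in> Hom C X Y \<and> q \<cdot> f = q \<cdot> g \<and>
    (\<forall>Z \<in> Obj C. \<forall>h \<in> Hom C X Z. h \<cdot> f = h \<cdot> g \<longrightarrow> (\<exists>!k. k \<in> Hom C Y Z \<and> k \<cdot> q = h))"

definition regular_epi :: "'o \<Rightarrow> 'o \<Rightarrow> 'm \<Rightarrow> bool"
  where "regular_epi X Y q \<longleftrightarrow> (\<exists>W \<in> Obj C. \<exists>f g. coequalizer W X Y f g q)"

end

text \<open>\<open>Q X Y\<close> is the set of those morphisms from \<open>X\<close> to \<open>Y\<close> which belong to the class.\<close>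

locale epi_class =
  fixes C :: "('o, 'm, 'z) moncat_scheme" (structure)
    and Q :: "'o \<Rightarrow> 'o \<Rightarrow> 'm set"
  assumes regular: "\<lbrakk>X \<in> Obj C; Y \<in> Obj C; q \<in> Q X Y\<rbrakk> \<Longrightarrow> regular_epi C X Y q"
    and comp_closed: "\<lbrakk>X \<in> Obj C; Y \<in> Obj C; Z \<in> Obj C; s \<in> Q X Y; t \<in> Q Y Z\<rbrakk>
      \<Longrightarrow> t \<cdot> s \<in> Q X Z"
    and tensor_closed: "\<lbrakk>X \<in> Obj C; Y \<in> Obj C; X' \<in> Obj C; Y' \<in> Obj C; s \<in> Q X Y; t \<in> Q X' Y'\<rbrakk>
      \<Longrightarrow> s \<otimes> t \<in> Q (X \<odot> X') (Y \<odot> Y')"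
    and contains_isos: "\<lbrakk>X \<in> Obj C; Y \<in> Obj C; iso_arrow C X Y f\<rbrakk> \<Longrightarrow> f \<in> Q X Y"
    and right_cancel: "\<lbrakk>X \<in> Obj C; Y \<in> Obj C; Z \<in> Obj C; s \<in> Q X Y; t \<in> Hom C Y Z; t \<cdot> s \<in> Q X Z\<rbrakk>
      \<Longrightarrow> t \<in> Q Y Z"
    and preserved_coequalizer: "\<lbrakk>X \<in> Obj C; Y \<in> Obj C; q \<in> Q X Y\<rbrakk>
      \<Longrightarrow> \<exists>W \<in> Obj C. \<exists>f g. coequalizer C W X Y f g q \<and>
        (\<forall>Z \<in> Obj C.
          coequalizer C (Z \<odot> W) (Z \<odot> X) (Z \<odot> Y) (\<one> Z \<otimes> f) (\<one> Z \<otimes> g) (\<one> Z \<otimes> q) \<and>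
          coequalizer C (W \<odot> Z) (X \<odot> Z) (Y \<odot> Z) (f \<otimes> \<one> Z) (g \<otimes> \<one> Z) (q \<otimes> \<one> Z))"


section \<open>Multiplier bimonoids and multiplier Hopf monoids\<close>

record ('o, 'm) multiplier_data =
  Carr :: 'o
  T1 :: 'm
  T2 :: 'm
  Counit :: 'm

context
  fixes C :: "('o, 'm, 'z) symmoncat_scheme" (structure)
begin

definition assoc_inv :: "'o \<Rightarrow> 'o \<Rightarrow> 'o \<Rightarrow> 'm"
  where "assoc_inv X Y Z = inv_arrow C (X \<odot> Y \<odot> Z) (X \<odot> (Y \<odot> Z)) (\<alpha> X Y Z)"

text \<open>The inverse braiding, as a morphism from \<open>X Y\<close> to \<open>Y X\<close>, is the inverse of \<open>\<c> Y X\<close>.\<close>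

definition braid_inv :: "'o \<Rightarrow> 'o \<Rightarrow> 'm"
  where "braid_inv X Y = inv_arrow C (Y \<odot> X) (X \<odot> Y) (\<c> Y X)"

text \<open>
  Products of three objects are bracketed to the left. For \<open>f\<close> from \<open>Y Z\<close> to \<open>Y' Z'\<close> the following is the
  morphism usually written \<open>1f\<close>, from \<open>X Y Z\<close> to \<open>X Y' Z'\<close>; the morphism \<open>f1\<close> is simply \<open>f \<otimes> \<one> Z\<close>.
\<close>

definition last_two :: "'o \<Rightarrow> 'o \<Rightarrow> 'o \<Rightarrow> 'o \<Rightarrow> 'o \<Rightarrow> 'm \<Rightarrow> 'm"
  where "last_two X Y Z Y' Z' f = assoc_inv X Y' Z' \<cdot> (\<one> X \<otimes> f) \<cdot> \<alpha> X Y Z"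

definition nondegenerate_mult :: "'o \<Rightarrow> 'm \<Rightarrow> bool"
  where "nondegenerate_mult A m \<longleftrightarrow>
    (\<forall>X \<in> Obj C. \<forall>Y \<in> Obj C.
      inj_on (\<lambda>f. (\<one> Y \<otimes> m) \<cdot> \<alpha> Y A A \<cdot> (f \<otimes> \<one> A)) (Hom C X (Y \<odot> A)) \<and>
      inj_on (\<lambda>g. (m \<otimes> \<one> Y) \<cdot> assoc_inv A A Y \<cdot> (\<one> A \<otimes> g)) (Hom C X (A \<odot> Y)))"

definition multiplier_bimonoid :: "('o, 'm) multiplier_data \<Rightarrow> bool"
  where "multiplier_bimonoid H \<longleftrightarrow>
    (let A = Carr H; t1 = T1 H; t2 = T2 H; e = Counit H; on23 = last_two A A A A A in
      A \<in> Obj C \<and>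
      t1 \<in> Hom C (A \<odot> A) (A \<odot> A) \<and> t2 \<in> Hom C (A \<odot> A) (A \<odot> A) \<and> e \<in> Hom C A \<I> \<and>
      (t1 \<otimes> \<one> A) \<cdot> (braid_inv A A \<otimes> \<one> A) \<cdot> on23 t1 \<cdot> (\<c> A A \<otimes> \<one> A) \<cdot> on23 t1
        = on23 t1 \<cdot> (t1 \<otimes> \<one> A) \<and>
      \<rho> A \<cdot> (\<one> A \<otimes> e) \<cdot> t1 = \<rho> A \<cdot> (\<one> A \<otimes> e) \<and>
      on23 t2 \<cdot> on23 (braid_inv A A) \<cdot> (t2 \<otimes> \<one> A) \<cdot> on23 (\<c> A A) \<cdot> (t2 \<otimes> \<one> A)
        = (t2 \<otimes> \<one> A) \<cdot> on23 t2 \<and>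
      \<lambda>\<lambda> A \<cdot> (e \<otimes> \<one> A) \<cdot> t2 = \<lambda>\<lambda> A \<cdot> (e \<otimes> \<one> A) \<and>
      on23 t1 \<cdot> (t2 \<otimes> \<one> A) = (t2 \<otimes> \<one> A) \<cdot> on23 t1 \<and>
      \<lambda>\<lambda> A \<cdot> (e \<otimes> \<one> A) \<cdot> t1 = \<rho> A \<cdot> (\<one> A \<otimes> e) \<cdot> t2)"

definition mult :: "('o, 'm) multiplier_data \<Rightarrow> 'm"
  where "mult H = \<lambda>\<lambda> (Carr H) \<cdot> (Counit H \<otimes> \<one> (Carr H)) \<cdot> T1 H"

definition multiplier_Hopf_monoid :: "('o, 'm) multiplier_data \<Rightarrow> bool"
  where "multiplier_Hopf_monoid H \<longleftrightarrow> multiplier_bimonoid H \<and>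
    iso_arrow C (Carr H \<odot> Carr H) (Carr H \<odot> Carr H) (T1 H) \<and>
    iso_arrow C (Carr H \<odot> Carr H) (Carr H \<odot> Carr H) (T2 H)"

definition antipode2 :: "('o, 'm) multiplier_data \<Rightarrow> 'm"
  where "antipode2 H = (let A = Carr H in
    \<rho> A \<cdot> (\<one> A \<otimes> Counit H) \<cdot> inv_arrow C (A \<odot> A) (A \<odot> A) (T2 H))"


section \<open>Modules\<close>

definition semigroup_module :: "('o \<Rightarrow> 'o \<Rightarrow> 'm set) \<Rightarrow> 'o \<Rightarrow> 'm \<Rightarrow> 'o \<Rightarrow> 'm \<Rightarrow> bool"
  where "semigroup_module Q A m V v \<longleftrightarrow>
    V \<in> Obj C \<and> v \<in> Hom C (V \<odot> A) V \<and> v \<in> Q (V \<odot> A) V \<and>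
    v \<cdot> (v \<otimes> \<one> A) = v \<cdot> (\<one> V \<otimes> m) \<cdot> \<alpha> V A A"

definition nondegenerate_action :: "'o \<Rightarrow> 'o \<Rightarrow> 'm \<Rightarrow> bool"
  where "nondegenerate_action A V v \<longleftrightarrow>
    (\<forall>X \<in> Obj C. \<forall>Y \<in> Obj C.
      inj_on (\<lambda>f. (\<one> Y \<otimes> v) \<cdot> \<alpha> Y V A \<cdot> (f \<otimes> \<one> A)) (Hom C X (Y \<odot> V)))"

definition action :: "('o, 'm) multiplier_data \<Rightarrow> 'o \<Rightarrow> 'm \<Rightarrow> 'm"
  where "action H V v2 = \<rho> V \<cdot> (\<one> V \<otimes> Counit H) \<cdot> v2"

definition multiplier_module ::
    "('o \<Rightarrow> 'o \<Rightarrow> 'm set) \<Rightarrow> ('o, 'm) multiplier_data \<Rightarrow> 'o \<Rightarrow> 'm \<Rightarrow> bool"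
  where "multiplier_module Q H V v2 \<longleftrightarrow>
    (let A = Carr H; t2 = T2 H; on23 = last_two V A A A A in
      V \<in> Obj C \<and> v2 \<in> Hom C (V \<odot> A) (V \<odot> A) \<and>
      on23 t2 \<cdot> on23 (braid_inv A A) \<cdot> (v2 \<otimes> \<one> A) \<cdot> on23 (\<c> A A) \<cdot> (v2 \<otimes> \<one> A)
        = (v2 \<otimes> \<one> A) \<cdot> on23 t2 \<and>
      action H V v2 \<in> Q (V \<odot> A) V)"

text \<open>
  A module structure \<open>v2\<close> is uniquely determined by its underlying action \<open>v\<close>. Objects of the
  category of modules are pairs \<open>(V, v2)\<close>, while products, the unit and morphisms are given in terms
  of actions.
\<close>

definition structure_of ::
    "('o \<Rightarrow> 'o \<Rightarrow> 'm set) \<Rightarrow> ('o, 'm) multiplier_data \<Rightarrow> 'o \<Rightarrow> 'm \<Rightarrow> 'm"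
  where "structure_of Q H V v = (THE v2. multiplier_module Q H V v2 \<and> action H V v2 = v)"

definition product_action ::
    "('o, 'm) multiplier_data \<Rightarrow> 'o \<Rightarrow> 'm \<Rightarrow> 'o \<Rightarrow> 'm \<Rightarrow> 'm"
  where "product_action H V v W w2 = (let A = Carr H in
    (v \<otimes> \<one> W) \<cdot> assoc_inv V A W \<cdot> (\<one> V \<otimes> braid_inv W A) \<cdot> (\<one> V \<otimes> w2) \<cdot> \<alpha> V W A)"

definition module_hom ::
    "('o \<Rightarrow> 'o \<Rightarrow> 'm set) \<Rightarrow> ('o, 'm) multiplier_data \<Rightarrow> 'o \<times> 'm \<Rightarrow> 'o \<times> 'm \<Rightarrow> 'm set"
  where "module_hom Q H M N =
    {f. multiplier_module Q H (fst M) (snd M) \<and> multiplier_module Q H (fst N) (snd N) \<and>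
        f \<in> Hom C (fst M) (fst N) \<and>
        f \<cdot> action H (fst M) (snd M) = action H (fst N) (snd N) \<cdot> (f \<otimes> \<one> (Carr H))}"

definition module_category ::
    "('o \<Rightarrow> 'o \<Rightarrow> 'm set) \<Rightarrow> ('o, 'm) multiplier_data \<Rightarrow> ('o \<times> 'm, 'm) moncat"
  where "module_category Q H = \<lparr>
    Obj = {(V, v2). multiplier_module Q H V v2},
    Hom = module_hom Q H,
    Ident = (\<lambda>M. \<one> (fst M)),
    Comp = (\<cdot>),
    TensO = (\<lambda>(V, v2) (W, w2). (V \<odot> W,
      structure_of Q H (V \<odot> W) (product_action H V (action H V v2) W w2))),
    TensA = (\<otimes>),
    UnitO = (\<I>, structure_of Q H \<I> (Counit H \<cdot> \<lambda>\<lambda> (Carr H))),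
    Assoc = (\<lambda>L M N. \<alpha> (fst L) (fst M) (fst N)),
    LUnit = (\<lambda>M. \<lambda>\<lambda> (fst M)),
    RUnit = (\<lambda>M. \<rho> (fst M)) \<rparr>"

text \<open>The morphism usually written \<open>s\<^sup>*v\<close>.\<close>

definition antipode_pullback :: "('o, 'm) multiplier_data \<Rightarrow> 'o \<Rightarrow> 'm \<Rightarrow> 'm"
  where "antipode_pullback H V v = (let A = Carr H in
    THE f. f \<in> Hom C (V \<odot> A) V \<and> f \<cdot> (v \<otimes> \<one> A) = v \<cdot> (\<one> V \<otimes> antipode2 H) \<cdot> \<alpha> V A A)"

text \<open>
  The action on the left dual \<open>V'\<close>, as a composite
  \<open>V' A \<rightarrow> V' A V V' \<rightarrow> V' V A V' \<rightarrow> V' V V' \<rightarrow> V'\<close> in which \<open>A\<close> is moved past \<open>V\<close> and then acts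
  on \<open>V\<close> through the antipode.
\<close>

definition dual_action ::
    "('o, 'm) multiplier_data \<Rightarrow> 'o \<Rightarrow> 'm \<Rightarrow> 'o \<Rightarrow> 'm \<Rightarrow> 'm \<Rightarrow> 'm"
  where "dual_action H V v V' \<eta> \<epsilon> = (let A = Carr H in
    \<lambda>\<lambda> V' \<cdot> (\<epsilon> \<otimes> \<one> V')
    \<cdot> ((\<one> V' \<otimes> antipode_pullback H V v) \<otimes> \<one> V') \<cdot> (\<alpha> V' V A \<otimes> \<one> V')
    \<cdot> (last_two V' A V V A (braid_inv A V) \<otimes> \<one> V')
    \<cdot> assoc_inv (V' \<odot> A) V V' \<cdot> (\<one> (V' \<odot> A) \<otimes> \<eta>)
    \<cdot> inv_arrow C (V' \<odot> A \<odot> \<I>) (V' \<odot> A) (\<rho> (V' \<odot> A)))"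

end

end

theory Submission
  imports Defs
begin

text \<open>In Sweedler notation \<open>t\<^sub>2\<close> sends \<open>x y\<close> to \<open>x y\<^sub>1\<close> and \<open>y\<^sub>2\<close>, its inverse gives \<open>x s(y\<^sub>1)\<close> and \<open>y\<^sub>2\<close>, and the
  action on the dual is determined by \<open>\<epsilon>(f x, w) = \<epsilon>(f, w s(x))\<close>. It is an action since the antipode reverses
  products, which is the fusion equation of the inverse of \<open>t\<^sub>2\<close>. The counit \<open>\<epsilon>\<close> is a module morphism since
  \<open>w x\<^sub>1 s(x\<^sub>2) = w e(x)\<close>. As the dual action is an epimorphism, the structure on the dual corresponding to it
  is transposed to \<open>w x \<mapsto> w s(x\<^sub>1), x\<^sub>2\<close>, and so the unit \<open>\<eta>\<close> is a module morphism since \<open>w s(x\<^sub>1) x\<^sub>2 = w e(x)\<close>.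
  These computations are done with operations on named strands, where the constraints of the category,
  including the braiding, are invisible by coherence for symmetric monoidal categories.\<close>

section \<open>Coherence\<close>

text \<open>Two kinds of maps have to be constructed by division: the structure belonging to an
  action, and \<open>s^*v\<close>. Each is prescribed only on elements w x of a module, that is,
  after composition with an epimorphism of \<open>Q\<close>. One shows that the prescription,
  multiplied by a further z, depends on w x alone; non-degeneracy then removes z. For the structure,
  the test is against the multiplication of \<open>A\<close>, and \<open>t1\<close> appears. For
  \<open>s^*v\<close>, the test is against \<open>v\<close>, and x s(y) z has to be read both as (x
  s(y)) z and as x (s(y) z), which brings in the first component of the antipode. A second obstacle
  is that the unit and products of modules are specified by their actions through a definite
  description. Explicit structures must be found, and their actions shown to be in \<open>Q\<close>,
  before the duality of modules can be stated in terms of known morphisms. Coherence is needed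
  because neither brackets nor braidings are strict. Distinct names remove the need to track
  permutations: a canonical permutation is determined by its source and target lists, and a
  composite of such is again canonical.\<close>

text \<open>Arrows carry their source and target, so that these can be computed by simplification.\<close>

type_synonym ('o, 'm) arrow = "'o \<times> 'm \<times> 'o"

definition dm :: "('o, 'm) arrow \<Rightarrow> 'o" where "dm f = fst f"
definition mo :: "('o, 'm) arrow \<Rightarrow> 'm" where "mo f = fst (snd f)"
definition cd :: "('o, 'm) arrow \<Rightarrow> 'o" where "cd f = snd (snd f)"

lemma arrow_sel [simp]: "dm (X, f, Y) = X" "mo (X, f, Y) = f" "cd (X, f, Y) = Y"
  by (simp_all add: dm_def mo_def cd_def)

lemma arrow_eqI: "dm f = dm g \<Longrightarrow> cd f = cd g \<Longrightarrow> mo f = mo g \<Longrightarrow> f = g"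
  by (simp add: dm_def mo_def cd_def prod_eq_iff)

lemma inv_arrow_inverse:
  assumes "monoidal_category C" "X \<in> Obj C" "Y \<in> Obj C" "iso_arrow C X Y f"
  shows "inverse_arrows C X Y f (inv_arrow C X Y f)"
proof -
  interpret monoidal_category C by fact
  obtain g where g: "inverse_arrows C X Y f g" using assms(4) by (auto simp: iso_arrow_def)
  have "h = g" if h: "inverse_arrows C X Y f h" for h
  proof -
    have hm: "f \<in> Hom C X Y" "g \<in> Hom C Y X" "h \<in> Hom C Y X"
      using g h by (auto simp: inverse_arrows_def)
    have "h = h \<cdot>\<^bsub>C\<^esub> (f \<cdot>\<^bsub>C\<^esub> g)"
      using g hm assms comp_ident_right by (simp add: inverse_arrows_def)
    also have "\<dots> = (h \<cdot>\<^bsub>C\<^esub> f) \<cdot>\<^bsub>C\<^esub> g"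
      using hm assms comp_assoc[of Y X Y X g f h] by simp
    also have "\<dots> = g"
      using h hm assms comp_ident_left by (simp add: inverse_arrows_def)
    finally show ?thesis .
  qed
  with g show ?thesis unfolding inv_arrow_def by (metis theI)
qed

lemma inv_arrow_unique:
  assumes "monoidal_category C" "X \<in> Obj C" "Y \<in> Obj C" "inverse_arrows C X Y f g"
  shows "inv_arrow C X Y f = g"
proof -
  interpret monoidal_category C by fact
  have h: "inverse_arrows C X Y f (inv_arrow C X Y f)"
    using assms by (intro inv_arrow_inverse) (auto simp: iso_arrow_def)
  let ?h = "inv_arrow C X Y f"
  have hm: "f \<in> Hom C X Y" "g \<in> Hom C Y X" "?h \<in> Hom C Y X"
    using assms(4) h by (auto simp: inverse_arrows_def)
  have "?h = ?h \<cdot>\<^bsub>C\<^esub> (f \<cdot>\<^bsub>C\<^esub> g)"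
    using assms hm comp_ident_right by (simp add: inverse_arrows_def)
  also have "\<dots> = (?h \<cdot>\<^bsub>C\<^esub> f) \<cdot>\<^bsub>C\<^esub> g"
    using hm assms comp_assoc[of Y X Y X g f ?h] by simp
  also have "\<dots> = g"
    using h hm assms comp_ident_left by (simp add: inverse_arrows_def)
  finally show ?thesis .
qed

context symmetric_monoidal_category
begin

definition arr :: "('o, 'm) arrow \<Rightarrow> bool"
  where "arr f \<longleftrightarrow> dm f \<in> Obj C \<and> cd f \<in> Obj C \<and> mo f \<in> Hom C (dm f) (cd f)"

text \<open>The ends are read off from the factors without checking that the inner ends match; laws
  that need this assume it through \<open>dm\<close> and \<open>cd\<close>.\<close>

definition cmp :: "('o, 'm) arrow \<Rightarrow> ('o, 'm) arrow \<Rightarrow> ('o, 'm) arrow" (infixr "oo" 60)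
  where "g oo f = (dm f, mo g \<cdot> mo f, cd g)"

definition ten :: "('o, 'm) arrow \<Rightarrow> ('o, 'm) arrow \<Rightarrow> ('o, 'm) arrow" (infixl "**" 70)
  where "f ** g = (dm f \<odot> dm g, mo f \<otimes> mo g, cd f \<odot> cd g)"

definition idn :: "'o \<Rightarrow> ('o, 'm) arrow" where "idn X = (X, \<one> X, X)"

definition al :: "'o \<Rightarrow> 'o \<Rightarrow> 'o \<Rightarrow> ('o, 'm) arrow"
  where "al X Y Z = (X \<odot> Y \<odot> Z, \<alpha> X Y Z, X \<odot> (Y \<odot> Z))"
definition al' :: "'o \<Rightarrow> 'o \<Rightarrow> 'o \<Rightarrow> ('o, 'm) arrow"
  where "al' X Y Z = (X \<odot> (Y \<odot> Z), assoc_inv C X Y Z, X \<odot> Y \<odot> Z)"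
definition la :: "'o \<Rightarrow> ('o, 'm) arrow" where "la X = (\<I> \<odot> X, \<lambda>\<lambda> X, X)"
definition la' :: "'o \<Rightarrow> ('o, 'm) arrow"
  where "la' X = (X, inv_arrow C (\<I> \<odot> X) X (\<lambda>\<lambda> X), \<I> \<odot> X)"
definition rh :: "'o \<Rightarrow> ('o, 'm) arrow" where "rh X = (X \<odot> \<I>, \<rho> X, X)"
definition rh' :: "'o \<Rightarrow> ('o, 'm) arrow"
  where "rh' X = (X, inv_arrow C (X \<odot> \<I>) X (\<rho> X), X \<odot> \<I>)"
definition br :: "'o \<Rightarrow> 'o \<Rightarrow> ('o, 'm) arrow" where "br X Y = (X \<odot> Y, \<c> X Y, Y \<odot> X)"

lemma mcat: "monoidal_category C" by unfold_locales

lemmas [simp] = unit_obj tensor_obj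

lemma inverse_assoc:
  "X \<in> Obj C \<Longrightarrow> Y \<in> Obj C \<Longrightarrow> Z \<in> Obj C \<Longrightarrow>
    inverse_arrows C (X \<odot> Y \<odot> Z) (X \<odot> (Y \<odot> Z)) (\<alpha> X Y Z) (assoc_inv C X Y Z)"
  unfolding assoc_inv_def by (intro inv_arrow_inverse mcat assoc_iso tensor_obj)

lemma inverse_lunit:
  "X \<in> Obj C \<Longrightarrow> inverse_arrows C (\<I> \<odot> X) X (\<lambda>\<lambda> X) (inv_arrow C (\<I> \<odot> X) X (\<lambda>\<lambda> X))"
  by (intro inv_arrow_inverse mcat lunit_iso tensor_obj unit_obj)

lemma inverse_runit:
  "X \<in> Obj C \<Longrightarrow> inverse_arrows C (X \<odot> \<I>) X (\<rho> X) (inv_arrow C (X \<odot> \<I>) X (\<rho> X))"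
  by (intro inv_arrow_inverse mcat runit_iso tensor_obj unit_obj)

lemma braid_inv_eq: "X \<in> Obj C \<Longrightarrow> Y \<in> Obj C \<Longrightarrow> braid_inv C X Y = \<c> X Y"
  unfolding braid_inv_def
  by (intro inv_arrow_unique mcat) (auto simp: inverse_arrows_def braid_hom braid_symmetric)

lemma arrow_dm_cd [simp]:
  "dm (g oo f) = dm f" "cd (g oo f) = cd g"
  "dm (f ** g) = dm f \<odot> dm g" "cd (f ** g) = cd f \<odot> cd g"
  "dm (idn X) = X" "cd (idn X) = X"
  "dm (al X Y Z) = X \<odot> Y \<odot> Z" "cd (al X Y Z) = X \<odot> (Y \<odot> Z)"
  "dm (al' X Y Z) = X \<odot> (Y \<odot> Z)" "cd (al' X Y Z) = X \<odot> Y \<odot> Z"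
  "dm (la X) = \<I> \<odot> X" "cd (la X) = X" "dm (la' X) = X" "cd (la' X) = \<I> \<odot> X"
  "dm (rh X) = X \<odot> \<I>" "cd (rh X) = X" "dm (rh' X) = X" "cd (rh' X) = X \<odot> \<I>"
  "dm (br X Y) = X \<odot> Y" "cd (br X Y) = Y \<odot> X"
  by (simp_all add: cmp_def ten_def idn_def al_def al'_def la_def la'_def rh_def rh'_def br_def)

lemma arr_cmp [simp]: "arr f \<Longrightarrow> arr g \<Longrightarrow> cd f = dm g \<Longrightarrow> arr (g oo f)"
  by (auto simp: arr_def cmp_def intro: comp_hom[of _ "dm g"])

lemma arr_ten [simp]: "arr f \<Longrightarrow> arr g \<Longrightarrow> arr (f ** g)"
  by (simp add: arr_def ten_def tensor_hom)

lemma arr_idn [simp]: "X \<in> Obj C \<Longrightarrow> arr (idn X)"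
  by (simp add: arr_def idn_def ident_hom)

lemma arr_structural [simp]:
  "X \<in> Obj C \<Longrightarrow> Y \<in> Obj C \<Longrightarrow> Z \<in> Obj C \<Longrightarrow> arr (al X Y Z)"
  "X \<in> Obj C \<Longrightarrow> Y \<in> Obj C \<Longrightarrow> Z \<in> Obj C \<Longrightarrow> arr (al' X Y Z)"
  "X \<in> Obj C \<Longrightarrow> arr (la X)" "X \<in> Obj C \<Longrightarrow> arr (la' X)"
  "X \<in> Obj C \<Longrightarrow> arr (rh X)" "X \<in> Obj C \<Longrightarrow> arr (rh' X)"
  "X \<in> Obj C \<Longrightarrow> Y \<in> Obj C \<Longrightarrow> arr (br X Y)"
  using inverse_assoc inverse_lunit inverse_runit braid_hom
  by (auto simp: arr_def al_def al'_def la_def la'_def rh_def rh'_def br_def inverse_arrows_def)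

lemma cmp_assoc:
  "arr f \<Longrightarrow> arr g \<Longrightarrow> arr h \<Longrightarrow> cd f = dm g \<Longrightarrow> cd g = dm h \<Longrightarrow> (h oo g) oo f = h oo g oo f"
  unfolding arr_def cmp_def by (simp add: comp_assoc[of "dm f" "dm g" "dm h" "cd h"])

lemma cmp_idn [simp]:
  "arr f \<Longrightarrow> dm f = X \<Longrightarrow> f oo idn X = f" "arr f \<Longrightarrow> cd f = X \<Longrightarrow> idn X oo f = f"
  by (auto intro!: arrow_eqI simp: cmp_def idn_def arr_def comp_ident_left comp_ident_right)

lemma ten_idn [simp]: "X \<in> Obj C \<Longrightarrow> Y \<in> Obj C \<Longrightarrow> idn X ** idn Y = idn (X \<odot> Y)"
  by (simp add: ten_def idn_def tensor_ident)

lemma interchange: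
  "arr f \<Longrightarrow> arr g \<Longrightarrow> arr f' \<Longrightarrow> arr g' \<Longrightarrow> cd f = dm g \<Longrightarrow> cd f' = dm g' \<Longrightarrow>
    (g ** g') oo (f ** f') = (g oo f) ** (g' oo f')"
  unfolding arr_def cmp_def ten_def
  by (simp add: tensor_comp[of "dm f" "dm g" "cd g" "dm f'" "dm g'" "cd g'"])

text \<open>Composites are normalized to the right, so a pair of parallel composites is usually
  followed by a tail \<open>k\<close>; in this form rewriting can find it.\<close>

lemma interchange':
  "arr f \<Longrightarrow> arr g \<Longrightarrow> arr f' \<Longrightarrow> arr g' \<Longrightarrow> cd f = dm g \<Longrightarrow> cd f' = dm g' \<Longrightarrow>
    arr k \<Longrightarrow> cd k = dm f \<odot> dm f' \<Longrightarrow>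
    (g ** g') oo (f ** f') oo k = ((g oo f) ** (g' oo f')) oo k"
  by (simp add: interchange flip: cmp_assoc)

lemma arr_obj [simp]: "arr f \<Longrightarrow> dm f \<in> Obj C" "arr f \<Longrightarrow> cd f \<in> Obj C"
  by (simp_all add: arr_def)

lemma al_cancel [simp]:
  assumes "X \<in> Obj C" "Y \<in> Obj C" "Z \<in> Obj C"
  shows "al X Y Z oo al' X Y Z = idn (X \<odot> (Y \<odot> Z))" "al' X Y Z oo al X Y Z = idn (X \<odot> Y \<odot> Z)"
  using inverse_assoc[OF assms] by (auto simp: al_def al'_def cmp_def idn_def inverse_arrows_def)

lemma la_cancel [simp]:
  assumes "X \<in> Obj C"
  shows "la X oo la' X = idn X" "la' X oo la X = idn (\<I> \<odot> X)"
  using inverse_lunit[OF assms] by (auto simp: la_def la'_def cmp_def idn_def inverse_arrows_def)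

lemma rh_cancel [simp]:
  assumes "X \<in> Obj C"
  shows "rh X oo rh' X = idn X" "rh' X oo rh X = idn (X \<odot> \<I>)"
  using inverse_runit[OF assms] by (auto simp: rh_def rh'_def cmp_def idn_def inverse_arrows_def)

lemma br_cancel [simp]:
  "X \<in> Obj C \<Longrightarrow> Y \<in> Obj C \<Longrightarrow> br Y X oo br X Y = idn (X \<odot> Y)"
  by (simp add: br_def cmp_def idn_def braid_symmetric)

lemma cancel_left:
  "h oo g = idn (dm g) \<Longrightarrow> arr f \<Longrightarrow> arr g \<Longrightarrow> arr h \<Longrightarrow> cd f = dm g \<Longrightarrow> cd g = dm h \<Longrightarrow> h oo g oo f = f"
  by (simp flip: cmp_assoc)

lemma al_nat:
  "arr f \<Longrightarrow> arr g \<Longrightarrow> arr h \<Longrightarrow>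
    al (cd f) (cd g) (cd h) oo ((f ** g) ** h) = (f ** (g ** h)) oo al (dm f) (dm g) (dm h)"
  unfolding arr_def cmp_def ten_def al_def by (simp, rule assoc_natural) auto

lemma la_nat: "arr f \<Longrightarrow> la (cd f) oo (idn \<I> ** f) = f oo la (dm f)"
  unfolding arr_def cmp_def ten_def la_def idn_def by (simp, rule lunit_natural) auto

lemma rh_nat: "arr f \<Longrightarrow> rh (cd f) oo (f ** idn \<I>) = f oo rh (dm f)"
  unfolding arr_def cmp_def ten_def rh_def idn_def by (simp, rule runit_natural) auto

lemma br_nat: "arr f \<Longrightarrow> arr g \<Longrightarrow> br (cd f) (cd g) oo (f ** g) = (g ** f) oo br (dm f) (dm g)"
  unfolding arr_def cmp_def ten_def br_def by (simp, rule braid_natural) auto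

lemma al_pentagon:
  "W \<in> Obj C \<Longrightarrow> X \<in> Obj C \<Longrightarrow> Y \<in> Obj C \<Longrightarrow> Z \<in> Obj C \<Longrightarrow>
    al W X (Y \<odot> Z) oo al (W \<odot> X) Y Z
      = (idn W ** al X Y Z) oo al W (X \<odot> Y) Z oo (al W X Y ** idn Z)"
  unfolding cmp_def ten_def al_def idn_def by (simp add: pentagon)

lemma al_triangle:
  "X \<in> Obj C \<Longrightarrow> Y \<in> Obj C \<Longrightarrow> (idn X ** la Y) oo al X \<I> Y = rh X ** idn Y"
  unfolding cmp_def ten_def al_def idn_def la_def rh_def by (simp add: triangle)

lemma br_hexagon:
  "X \<in> Obj C \<Longrightarrow> Y \<in> Obj C \<Longrightarrow> Z \<in> Obj C \<Longrightarrow>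
    al Y Z X oo br X (Y \<odot> Z) oo al X Y Z = (idn Y ** br X Z) oo al Y X Z oo (br X Y ** idn Z)"
  unfolding cmp_def ten_def al_def idn_def br_def by (simp add: hexagon)

lemma epi_split:
  "p oo q = idn (cd p) \<Longrightarrow> arr p \<Longrightarrow> arr q \<Longrightarrow> arr f \<Longrightarrow> arr g \<Longrightarrow> dm f = cd p \<Longrightarrow> dm g = cd p
    \<Longrightarrow> cd q = dm p \<Longrightarrow> f oo p = g oo p \<Longrightarrow> f = g"
  by (metis cmp_assoc cmp_idn(1))

lemma mono_split:
  "q oo p = idn (dm p) \<Longrightarrow> arr p \<Longrightarrow> arr q \<Longrightarrow> arr f \<Longrightarrow> arr g \<Longrightarrow> cd f = dm p \<Longrightarrow> cd g = dm p
    \<Longrightarrow> dm q = cd p \<Longrightarrow> p oo f = p oo g \<Longrightarrow> f = g"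
  by (metis cmp_assoc cmp_idn(2))

lemma ten_idn_cmp:
  "arr f \<Longrightarrow> arr g \<Longrightarrow> cd f = dm g \<Longrightarrow> X \<in> Obj C \<Longrightarrow> (g oo f) ** idn X = (g ** idn X) oo (f ** idn X)"
  "arr f \<Longrightarrow> arr g \<Longrightarrow> cd f = dm g \<Longrightarrow> X \<in> Obj C \<Longrightarrow> idn X ** (g oo f) = (idn X ** g) oo (idn X ** f)"
  by (simp_all add: interchange)

text \<open>Naturality of the invertible unit constraint recovers \<open>f\<close> from
  \<open>idn \<I> ** f\<close>. Equations can thus be proved after adding a unit factor, where the
  triangle axiom applies.\<close>

lemma la_faithful:
  assumes "arr f" "arr g" "dm f = dm g" "cd f = cd g" "idn \<I> ** f = idn \<I> ** g"
  shows "f = g"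
proof -
  have "f oo la (dm f) = g oo la (dm f)" by (metis la_nat assms)
  then show ?thesis
    by (rule epi_split[of "la (dm f)" "la' (dm f)", rotated -1]) (simp_all add: assms(1,2) assms(3,4)[symmetric])
qed

lemma rh_faithful:
  assumes "arr f" "arr g" "dm f = dm g" "cd f = cd g" "f ** idn \<I> = g ** idn \<I>"
  shows "f = g"
proof -
  have "f oo rh (dm f) = g oo rh (dm f)" by (metis rh_nat assms)
  then show ?thesis
    by (rule epi_split[of "rh (dm f)" "rh' (dm f)", rotated -1]) (simp_all add: assms(1,2) assms(3,4)[symmetric])
qed

text \<open>Kelly's consequence of pentagon and triangle. After tensoring with another unit, the
  pentagon and two instances of the triangle give the equation, and invertible associators are
  cancelled.\<close>

lemma la_ten:
  assumes [simp]: "X \<in> Obj C" "Y \<in> Obj C"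
  shows "la (X \<odot> Y) oo al \<I> X Y = la X ** idn Y"
proof (rule la_faithful)
  let ?a = "al \<I> \<I> X ** idn Y" and ?a' = "al' \<I> \<I> X ** idn Y"
  have "((idn \<I> ** (la (X \<odot> Y) oo al \<I> X Y)) oo al \<I> (\<I> \<odot> X) Y) oo ?a
      = (idn \<I> ** la (X \<odot> Y)) oo (al \<I> \<I> (X \<odot> Y) oo al (\<I> \<odot> \<I>) X Y)"
    by (simp add: al_pentagon cmp_assoc interchange')
  also have "\<dots> = (rh \<I> ** idn (X \<odot> Y)) oo al (\<I> \<odot> \<I>) X Y"
    by (simp add: al_triangle flip: cmp_assoc)
  also have "\<dots> = al \<I> X Y oo ((rh \<I> ** idn X) ** idn Y)"
    using al_nat[of "rh \<I>" "idn X" "idn Y"] by simp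
  also have "\<dots> = (al \<I> X Y oo ((idn \<I> ** la X) ** idn Y)) oo ?a"
    by (simp add: cmp_assoc interchange al_triangle)
  also have "\<dots> = ((idn \<I> ** (la X ** idn Y)) oo al \<I> (\<I> \<odot> X) Y) oo ?a"
    using al_nat[of "idn \<I>" "la X" "idn Y"] by simp
  finally have "(idn \<I> ** (la (X \<odot> Y) oo al \<I> X Y)) oo al \<I> (\<I> \<odot> X) Y
      = (idn \<I> ** (la X ** idn Y)) oo al \<I> (\<I> \<odot> X) Y"
    by (rule epi_split[of ?a ?a', rotated -1]) (auto simp: interchange)
  then show "idn \<I> ** (la (X \<odot> Y) oo al \<I> X Y) = idn \<I> ** (la X ** idn Y)"
    by (rule epi_split[of "al \<I> (\<I> \<odot> X) Y" "al' \<I> (\<I> \<odot> X) Y", rotated -1]) auto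
qed auto

text \<open>Compatibility of braiding and unit is not among the axioms. It follows from the hexagon
  with two unit factors, after tensoring with a unit and cancelling the invertible braiding.\<close>

lemma la_br:
  assumes [simp]: "X \<in> Obj C"
  shows "la X oo br X \<I> = rh X"
proof (rule rh_faithful)
  have "br X \<I> oo (rh X ** idn \<I>) = br X \<I> oo (idn X ** la \<I>) oo al X \<I> \<I>"
    by (simp add: al_triangle)
  also have "\<dots> = (la \<I> ** idn X) oo br X (\<I> \<odot> \<I>) oo al X \<I> \<I>"
    using br_nat[of "idn X" "la \<I>"] by (simp flip: cmp_assoc)
  also have "\<dots> = la (\<I> \<odot> X) oo al \<I> \<I> X oo br X (\<I> \<odot> \<I>) oo al X \<I> \<I>"
    by (simp add: cmp_assoc flip: la_ten)
  also have "\<dots> = la (\<I> \<odot> X) oo (idn \<I> ** br X \<I>) oo al \<I> X \<I> oo (br X \<I> ** idn \<I>)"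
    by (simp add: br_hexagon)
  also have "\<dots> = br X \<I> oo la (X \<odot> \<I>) oo al \<I> X \<I> oo (br X \<I> ** idn \<I>)"
    using la_nat[of "br X \<I>"] by (simp flip: cmp_assoc)
  also have "\<dots> = br X \<I> oo ((la X oo br X \<I>) ** idn \<I>)"
    by (simp add: la_ten ten_idn_cmp flip: cmp_assoc)
  finally have "rh X ** idn \<I> = (la X oo br X \<I>) ** idn \<I>"
    by (rule mono_split[of "br \<I> X" "br X \<I>", rotated -1]) auto
  then show "(la X oo br X \<I>) ** idn \<I> = rh X ** idn \<I>" ..
qed auto

section \<open>Adjacent transpositions in right-nested products\<close>

definition swap :: "'o \<Rightarrow> 'o \<Rightarrow> 'o \<Rightarrow> ('o, 'm) arrow"
  where "swap X Y R = al Y X R oo (br X Y ** idn R) oo al' X Y R"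

lemma swap_arr [simp]:
  "dm (swap X Y R) = X \<odot> (Y \<odot> R)" "cd (swap X Y R) = Y \<odot> (X \<odot> R)"
  "X \<in> Obj C \<Longrightarrow> Y \<in> Obj C \<Longrightarrow> R \<in> Obj C \<Longrightarrow> arr (swap X Y R)"
  by (simp_all add: swap_def)

lemma swap_al:
  "X \<in> Obj C \<Longrightarrow> Y \<in> Obj C \<Longrightarrow> R \<in> Obj C \<Longrightarrow> swap X Y R oo al X Y R = al Y X R oo (br X Y ** idn R)"
  by (simp add: swap_def cmp_assoc)

lemma swap_sw [simp]:
  assumes [simp]: "X \<in> Obj C" "Y \<in> Obj C" "R \<in> Obj C"
  shows "swap Y X R oo swap X Y R = idn (X \<odot> (Y \<odot> R))"
proof -
  have "swap Y X R oo swap X Y R = (swap Y X R oo al Y X R) oo (br X Y ** idn R) oo al' X Y R"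
    by (simp add: swap_def[of X Y] cmp_assoc)
  then show ?thesis by (simp add: swap_al cmp_assoc interchange')
qed

lemma swap_nat:
  assumes [simp]: "arr f" "arr g" "arr h"
  shows "swap (cd f) (cd g) (cd h) oo (f ** (g ** h)) = (g ** (f ** h)) oo swap (dm f) (dm g) (dm h)"
proof (rule epi_split[of "al (dm f) (dm g) (dm h)" "al' (dm f) (dm g) (dm h)"])
  have "(swap (cd f) (cd g) (cd h) oo (f ** (g ** h))) oo al (dm f) (dm g) (dm h)
      = (swap (cd f) (cd g) (cd h) oo al (cd f) (cd g) (cd h)) oo ((f ** g) ** h)"
    using al_nat[of f g h] by (simp add: cmp_assoc)
  also have "\<dots> = al (cd g) (cd f) (cd h) oo ((g ** f) ** h) oo (br (dm f) (dm g) ** idn (dm h))"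
    by (simp add: swap_al cmp_assoc interchange br_nat)
  also have "\<dots> = (al (cd g) (cd f) (cd h) oo ((g ** f) ** h)) oo (br (dm f) (dm g) ** idn (dm h))"
    by (simp add: cmp_assoc)
  also have "\<dots> = (g ** (f ** h)) oo swap (dm f) (dm g) (dm h) oo al (dm f) (dm g) (dm h)"
    by (simp add: al_nat swap_al cmp_assoc)
  finally show "(swap (cd f) (cd g) (cd h) oo (f ** (g ** h))) oo al (dm f) (dm g) (dm h)
      = ((g ** (f ** h)) oo swap (dm f) (dm g) (dm h)) oo al (dm f) (dm g) (dm h)"
    by (simp add: cmp_assoc)
qed auto

lemma swap_unit:
  assumes [simp]: "X \<in> Obj C" "R \<in> Obj C"
  shows "la (X \<odot> R) oo swap X \<I> R = idn X ** la R"
proof (rule epi_split[of "al X \<I> R" "al' X \<I> R"])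
  have "(la (X \<odot> R) oo swap X \<I> R) oo al X \<I> R = la (X \<odot> R) oo al \<I> X R oo (br X \<I> ** idn R)"
    by (simp add: cmp_assoc swap_al)
  also have "\<dots> = (la X ** idn R) oo (br X \<I> ** idn R)"
    by (simp add: la_ten flip: cmp_assoc)
  also have "\<dots> = (idn X ** la R) oo al X \<I> R"
    by (simp add: interchange la_br al_triangle)
  finally show "(la (X \<odot> R) oo swap X \<I> R) oo al X \<I> R = (idn X ** la R) oo al X \<I> R" .
qed auto

text \<open>The hexagon axiom in the presence of a further factor \<open>R\<close>; the pentagon
  moves the brackets around \<open>R\<close> out of the way.\<close>

lemma swap_ten:
  assumes [simp]: "X \<in> Obj C" "Y \<in> Obj C" "Z \<in> Obj C" "R \<in> Obj C"
  shows "al Y Z (X \<odot> R) oo swap X (Y \<odot> Z) R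
    = (idn Y ** swap X Z R) oo swap X Y (Z \<odot> R) oo (idn X ** al Y Z R)" (is "?l = ?r")
proof -
  let ?p = "al X (Y \<odot> Z) R oo (al X Y Z ** idn R)"
  let ?q = "(al' X Y Z ** idn R) oo al' X (Y \<odot> Z) R"
  have "swap X Y (Z \<odot> R) oo (idn X ** al Y Z R) oo ?p
      = (swap X Y (Z \<odot> R) oo al X Y (Z \<odot> R)) oo al (X \<odot> Y) Z R"
    by (simp add: cmp_assoc al_pentagon)
  also have "\<dots> = al Y X (Z \<odot> R) oo (br X Y ** (idn Z ** idn R)) oo al (X \<odot> Y) Z R"
    by (simp add: swap_al cmp_assoc)
  also have "\<dots> = al Y X (Z \<odot> R) oo al (Y \<odot> X) Z R oo ((br X Y ** idn Z) ** idn R)"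
    using al_nat[of "br X Y" "idn Z" "idn R"] by simp
  also have "\<dots> = (al Y X (Z \<odot> R) oo al (Y \<odot> X) Z R) oo ((br X Y ** idn Z) ** idn R)"
    by (simp add: cmp_assoc)
  also have "\<dots> = (idn Y ** al X Z R) oo al Y (X \<odot> Z) R oo ((al Y X Z oo (br X Y ** idn Z)) ** idn R)"
    by (simp add: al_pentagon cmp_assoc interchange)
  finally have 1: "swap X Y (Z \<odot> R) oo (idn X ** al Y Z R) oo ?p = \<dots>" .
  have "?r oo ?p = (idn Y ** swap X Z R) oo (swap X Y (Z \<odot> R) oo (idn X ** al Y Z R) oo ?p)"
    by (simp add: cmp_assoc)
  also have "\<dots> = (idn Y ** (swap X Z R oo al X Z R)) oo al Y (X \<odot> Z) R
      oo ((al Y X Z oo (br X Y ** idn Z)) ** idn R)"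
    unfolding 1 by (simp add: interchange')
  also have "\<dots> = (idn Y ** al Z X R) oo ((idn Y ** (br X Z ** idn R)) oo al Y (X \<odot> Z) R)
      oo ((al Y X Z oo (br X Y ** idn Z)) ** idn R)"
    by (simp add: swap_al cmp_assoc interchange')
  also have "(idn Y ** (br X Z ** idn R)) oo al Y (X \<odot> Z) R
      = al Y (Z \<odot> X) R oo ((idn Y ** br X Z) ** idn R)"
    using al_nat[of "idn Y" "br X Z" "idn R"] by simp
  also have "(idn Y ** al Z X R) oo (al Y (Z \<odot> X) R oo ((idn Y ** br X Z) ** idn R))
      oo ((al Y X Z oo (br X Y ** idn Z)) ** idn R)
    = (idn Y ** al Z X R) oo al Y (Z \<odot> X) R
      oo ((al Y Z X oo br X (Y \<odot> Z) oo al X Y Z) ** idn R)"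
    by (simp add: cmp_assoc interchange br_hexagon)
  also have "\<dots> = (al Y Z (X \<odot> R) oo al (Y \<odot> Z) X R) oo ((br X (Y \<odot> Z) oo al X Y Z) ** idn R)"
    by (simp add: cmp_assoc interchange al_pentagon)
  also have "\<dots> = al Y Z (X \<odot> R) oo (al (Y \<odot> Z) X R oo (br X (Y \<odot> Z) ** idn R)) oo (al X Y Z ** idn R)"
    by (simp add: cmp_assoc interchange)
  also have "\<dots> = ?l oo ?p"
    by (simp add: cmp_assoc flip: swap_al)
  finally have "?l oo ?p = ?r oo ?p" ..
  then show ?thesis
    by (rule epi_split[of ?p ?q, rotated -1])
      (auto simp: cmp_assoc interchange' cancel_left)
qed

end

text \<open>A strand is named by a pair of its object and a tag, and \<open>T\<close> is the product of a list of strands,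
  nested to the right and ending with the unit object. Words are bracketed products of strands.\<close>

type_synonym 'o name = "'o \<times> nat"

datatype 'n word = Leaf 'n | One | Pair "'n word" "'n word" (infixr "##" 65)

primrec lv :: "'n word \<Rightarrow> 'n list" where
  "lv (Leaf x) = [x]" | "lv One = []" | "lv (u ## v) = lv u @ lv v"

context symmetric_monoidal_category
begin

text \<open>The Yang-Baxter equation. By \<open>swap_ten\<close>, two of the three transpositions
  combine into carrying \<open>X\<close> past a product, and naturality lets this pass the braiding
  of \<open>Y\<close> and \<open>Z\<close>.\<close>

lemma swap_YB:
  assumes [simp]: "X \<in> Obj C" "Y \<in> Obj C" "Z \<in> Obj C" "R \<in> Obj C"
  shows "swap Y Z (X \<odot> R) oo (idn Y ** swap X Z R) oo swap X Y (Z \<odot> R)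
    = (idn Z ** swap X Y R) oo swap X Z (Y \<odot> R) oo (idn X ** swap Y Z R)" (is "?l = ?r")
proof -
  let ?p = "idn X ** al Y Z R" and ?q = "idn X ** al' Y Z R"
  have "?l oo ?p = swap Y Z (X \<odot> R) oo (idn Y ** swap X Z R) oo swap X Y (Z \<odot> R) oo ?p"
    by (simp add: cmp_assoc)
  also have "\<dots> = (swap Y Z (X \<odot> R) oo al Y Z (X \<odot> R)) oo swap X (Y \<odot> Z) R"
    by (simp add: swap_ten cmp_assoc)
  also have "\<dots> = al Z Y (X \<odot> R) oo (br Y Z ** (idn X ** idn R)) oo swap X (Y \<odot> Z) R"
    by (simp add: swap_al cmp_assoc)
  also have "\<dots> = (al Z Y (X \<odot> R) oo swap X (Z \<odot> Y) R) oo (idn X ** (br Y Z ** idn R))"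
    using swap_nat[of "idn X" "br Y Z" "idn R"] by (simp add: cmp_assoc)
  also have "\<dots> = (idn Z ** swap X Y R) oo swap X Z (Y \<odot> R) oo (idn X ** (swap Y Z R oo al Y Z R))"
    by (simp add: swap_ten cmp_assoc interchange swap_al)
  also have "\<dots> = ?r oo ?p"
    by (simp add: cmp_assoc interchange)
  finally show ?thesis
    by (rule epi_split[of ?p ?q, rotated -1]) (simp_all add: interchange)
qed

text \<open>The other hexagon, obtained by inverting \<open>swap_ten\<close>; this uses the symmetry
  of the braiding, through \<open>swap_sw\<close>.\<close>

lemma swap_ten':
  assumes [simp]: "X \<in> Obj C" "Y \<in> Obj C" "Z \<in> Obj C" "R \<in> Obj C"
  shows "swap X Z (Y \<odot> R) oo (idn X ** swap Y Z R) oo al X Y (Z \<odot> R)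
    = (idn Z ** al X Y R) oo swap (X \<odot> Y) Z R" (is "?l = ?r")
proof -
  have "?l = swap X Z (Y \<odot> R) oo (idn X ** swap Y Z R) oo (al X Y (Z \<odot> R) oo swap Z (X \<odot> Y) R) oo swap (X \<odot> Y) Z R"
    by (simp add: cmp_assoc)
  also have "\<dots> = swap X Z (Y \<odot> R) oo (idn X ** swap Y Z R) oo (idn X ** swap Z Y R) oo swap Z X (Y \<odot> R) oo ?r"
    by (simp add: swap_ten cmp_assoc)
  also have "\<dots> = ?r"
    by (simp add: cancel_left interchange')
  finally show ?thesis .
qed

section \<open>Lists of strands and their canonical permutations\<close>

primrec T :: "'o name list \<Rightarrow> 'o" where
  "T [] = \<I>" | "T (x # xs) = fst x \<odot> T xs"

primrec whisk :: "'o name list \<Rightarrow> ('o, 'm) arrow \<Rightarrow> ('o, 'm) arrow" where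
  "whisk [] f = f" | "whisk (x # xs) f = idn (fst x) ** whisk xs f"

definition val :: "'o name set \<Rightarrow> bool" where "val S \<longleftrightarrow> (\<forall>x \<in> S. fst x \<in> Obj C)"

lemma val_simps [simp]:
  "val {}" "val (insert x S) \<longleftrightarrow> fst x \<in> Obj C \<and> val S" "val (S \<union> S') \<longleftrightarrow> val S \<and> val S'"
  by (auto simp: val_def)

lemma val_mono: "val S \<Longrightarrow> S' \<subseteq> S \<Longrightarrow> val S'"
  by (auto simp: val_def)

lemma val_mem: "val S \<Longrightarrow> x \<in> S \<Longrightarrow> fst x \<in> Obj C"
  by (auto simp: val_def)

lemma val_diff [simp]: "val S \<Longrightarrow> val (S - S')"
  by (auto simp: val_def)

lemma val_remove1 [simp]: "val (set xs) \<Longrightarrow> val (set (remove1 x xs))"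
  by (rule val_mono[OF _ set_remove1_subset])

lemma T_obj [simp]: "val (set xs) \<Longrightarrow> T xs \<in> Obj C"
  by (induction xs) auto

lemma whisk_dm_cd [simp]: "dm (whisk xs f) = foldr (\<lambda>x Y. fst x \<odot> Y) xs (dm f)"
  "cd (whisk xs f) = foldr (\<lambda>x Y. fst x \<odot> Y) xs (cd f)"
  by (induction xs) auto

lemma foldr_T [simp]: "foldr (\<lambda>x Y. fst x \<odot> Y) xs (T ys) = T (xs @ ys)"
  by (induction xs) auto

lemma foldr_T_Cons [simp]: "foldr (\<lambda>x Y. fst x \<odot> Y) xs (fst y \<odot> T ys) = T (xs @ y # ys)"
  using foldr_T[of xs "y # ys"] by simp

lemma whisk_arr [simp]: "val (set xs) \<Longrightarrow> arr f \<Longrightarrow> arr (whisk xs f)"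
  by (induction xs) auto

lemma whisk_idn [simp]: "val (set xs) \<Longrightarrow> val (set ys) \<Longrightarrow> whisk xs (idn (T ys)) = idn (T (xs @ ys))"
  by (induction xs) auto

lemma whisk_append: "whisk (xs @ ys) f = whisk xs (whisk ys f)"
  by (induction xs) auto

primrec pull :: "'o name \<Rightarrow> 'o name list \<Rightarrow> ('o, 'm) arrow" where
  "pull y [] = idn \<I>"
| "pull y (x # xs) = (if x = y then idn (T (x # xs))
    else swap (fst x) (fst y) (T (remove1 y xs)) oo (idn (fst x) ** pull y xs))"

lemma pull_arr [simp]:
  assumes "val (set xs)" "y \<in> set xs"
  shows "dm (pull y xs) = T xs" "cd (pull y xs) = fst y \<odot> T (remove1 y xs)" "arr (pull y xs)"
  using assms by (induction xs) (auto simp: val_mem)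

text \<open>Induction on the list: a head equal to \<open>y\<close> is immediate, a head equal to
  \<open>z\<close> needs that the braiding is an involution, and any other head is carried through
  by the Yang-Baxter equation.\<close>

lemma pull_pull:
  assumes "val (set xs)" "distinct xs" "y \<in> set xs" "z \<in> set xs" "y \<noteq> z"
  shows "swap (fst y) (fst z) (T (remove1 z (remove1 y xs))) oo (idn (fst y) ** pull z (remove1 y xs)) oo pull y xs
    = (idn (fst z) ** pull y (remove1 z xs)) oo pull z xs"
  using assms
proof (induction xs)
  case (Cons w ws)
  have [simp]: "val (set ws)" "fst w \<in> Obj C" "fst y \<in> Obj C" "fst z \<in> Obj C"
    using Cons.prems val_mem[of "set (w # ws)"] by auto
  consider "w = y" | "w = z" "w \<noteq> y" | "w \<noteq> y" "w \<noteq> z" by blast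
  then show ?case
  proof cases
    case 1
    with Cons.prems show ?thesis by (auto simp: cmp_assoc)
  next
    case 2
    with Cons.prems show ?thesis by (auto simp: cancel_left)
  next
    case 3
    define P where "P = remove1 y ws"
    define Q where "Q = remove1 z ws"
    define R where "R = remove1 z P"
    have R: "R = remove1 y Q" by (simp add: R_def P_def Q_def remove1_commute)
    have mem: "y \<in> set ws" "z \<in> set ws" "z \<in> set P" "y \<in> set Q"
      using Cons.prems 3 by (auto simp: P_def Q_def)
    have V [simp]: "val (set P)" "val (set Q)" "val (set R)"
      by (auto simp: P_def Q_def R_def)
    have A: "dm (pull y ws) = T ws" "cd (pull y ws) = fst y \<odot> T P" "arr (pull y ws)"
      "dm (pull z ws) = T ws" "cd (pull z ws) = fst z \<odot> T Q" "arr (pull z ws)"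
      "dm (pull z P) = T P" "cd (pull z P) = fst z \<odot> T R" "arr (pull z P)"
      "dm (pull y Q) = T Q" "cd (pull y Q) = fst y \<odot> T R" "arr (pull y Q)"
      using mem by (auto simp: P_def Q_def, auto simp: R_def P_def remove1_commute)
    have IH: "swap (fst y) (fst z) (T R) oo (idn (fst y) ** pull z P) oo pull y ws
        = (idn (fst z) ** pull y Q) oo pull z ws"
      using Cons.IH Cons.prems 3 by (simp add: P_def Q_def R_def)
    let ?w = "fst w" and ?y = "fst y" and ?z = "fst z"
    have "swap ?y ?z (?w \<odot> T R) oo (idn ?y ** (swap ?w ?z (T R) oo (idn ?w ** pull z P)))
          oo swap ?w ?y (T P) oo (idn ?w ** pull y ws)
        = swap ?y ?z (?w \<odot> T R) oo (idn ?y ** swap ?w ?z (T R)) oo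
          ((idn ?y ** (idn ?w ** pull z P)) oo swap ?w ?y (T P)) oo (idn ?w ** pull y ws)"
      by (simp add: cmp_assoc A interchange')
    also have "(idn ?y ** (idn ?w ** pull z P)) oo swap ?w ?y (T P)
        = swap ?w ?y (?z \<odot> T R) oo (idn ?w ** (idn ?y ** pull z P))"
      using swap_nat[of "idn ?w" "idn ?y" "pull z P"] by (simp add: A)
    also have "swap ?y ?z (?w \<odot> T R) oo (idn ?y ** swap ?w ?z (T R)) oo
          (swap ?w ?y (?z \<odot> T R) oo (idn ?w ** (idn ?y ** pull z P))) oo (idn ?w ** pull y ws)
        = (swap ?y ?z (?w \<odot> T R) oo (idn ?y ** swap ?w ?z (T R)) oo swap ?w ?y (?z \<odot> T R))
          oo (idn ?w ** ((idn ?y ** pull z P) oo pull y ws))"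
      by (simp add: cmp_assoc A interchange)
    also have "\<dots> = (idn ?z ** swap ?w ?y (T R)) oo swap ?w ?z (?y \<odot> T R)
          oo (idn ?w ** (swap ?y ?z (T R) oo (idn ?y ** pull z P) oo pull y ws))"
      by (simp add: swap_YB cmp_assoc A interchange)
    also have "\<dots> = (idn ?z ** swap ?w ?y (T R)) oo (swap ?w ?z (?y \<odot> T R)
          oo (idn ?w ** (idn ?z ** pull y Q))) oo (idn ?w ** pull z ws)"
      unfolding IH by (simp add: cmp_assoc A interchange)
    also have "swap ?w ?z (?y \<odot> T R) oo (idn ?w ** (idn ?z ** pull y Q))
        = (idn ?z ** (idn ?w ** pull y Q)) oo swap ?w ?z (T Q)"
      using swap_nat[of "idn ?w" "idn ?z" "pull y Q"] by (simp add: A)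
    also have "(idn ?z ** swap ?w ?y (T R)) oo ((idn ?z ** (idn ?w ** pull y Q)) oo swap ?w ?z (T Q))
          oo (idn ?w ** pull z ws)
        = (idn ?z ** (swap ?w ?y (T R) oo (idn ?w ** pull y Q))) oo swap ?w ?z (T Q) oo (idn ?w ** pull z ws)"
      by (simp add: cmp_assoc A interchange')
    finally show ?thesis using 3 by (simp add: R[symmetric] R_def[symmetric] flip: P_def Q_def)
  qed
qed simp

text \<open>Selection sort: strands are pulled to the front in the order of the target list. As
  names are distinct, the two lists alone determine the permutation.\<close>

primrec perm :: "'o name list \<Rightarrow> 'o name list \<Rightarrow> ('o, 'm) arrow" where
  "perm xs [] = idn \<I>"
| "perm xs (y # ys) = (idn (fst y) ** perm (remove1 y xs) ys) oo pull y xs"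

definition same :: "'o name list \<Rightarrow> 'o name list \<Rightarrow> bool"
  where "same xs ys \<longleftrightarrow> distinct xs \<and> distinct ys \<and> set xs = set ys \<and> val (set xs)"

lemma same_remove1: "same xs ys \<Longrightarrow> same (remove1 z xs) (remove1 z ys)"
  by (auto simp: same_def set_remove1_eq distinct_remove1)

lemma perm_arr [simp]:
  assumes "same xs ys"
  shows "dm (perm xs ys) = T xs" "cd (perm xs ys) = T ys" "arr (perm xs ys)"
proof -
  have "dm (perm xs ys) = T xs \<and> cd (perm xs ys) = T ys \<and> arr (perm xs ys)"
    using assms
  proof (induction ys arbitrary: xs)
    case (Cons y ys)
    then have "same (remove1 y xs) ys" using same_remove1[of xs "y # ys" y] by simp
    from Cons.IH[OF this] Cons.prems show ?case by (auto simp: same_def)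
  qed (auto simp: same_def)
  then show "dm (perm xs ys) = T xs" "cd (perm xs ys) = T ys" "arr (perm xs ys)" by auto
qed

lemma perm_append: "val (set ks) \<Longrightarrow> same xs ys \<Longrightarrow> set ks \<inter> set xs = {} \<Longrightarrow> distinct ks \<Longrightarrow>
    perm (ks @ xs) (ks @ ys) = whisk ks (perm xs ys)"
proof (induction ks)
  case (Cons k ks)
  then have "same (ks @ xs) (ks @ ys)" by (auto simp: same_def)
  with Cons show ?case by (auto simp: same_def)
qed simp

lemma perm_self: "val (set xs) \<Longrightarrow> distinct xs \<Longrightarrow> perm xs xs = idn (T xs)"
  by (induction xs) auto

lemma pull_perm:
  assumes "same xs ys" "z \<in> set ys"
  shows "pull z ys oo perm xs ys = (idn (fst z) ** perm (remove1 z xs) (remove1 z ys)) oo pull z xs"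
  using assms
proof (induction ys arbitrary: xs)
  case (Cons y ys)
  show ?case
  proof (cases "z = y")
    case True
    then show ?thesis
      using Cons.prems same_remove1[of xs "y # ys" y] by (auto simp: same_def)
  next
    case False
    define xy where "xy = remove1 y xs"
    define xz where "xz = remove1 z xs"
    define xyz where "xyz = remove1 z xy"
    define yz where "yz = remove1 z ys"
    have xyz': "xyz = remove1 y xz" by (simp add: xyz_def xy_def xz_def remove1_commute)
    have mem: "y \<in> set xs" "z \<in> set xs" "z \<in> set xy" "y \<in> set xz" "z \<in> set ys"
      using Cons.prems False by (auto simp: xy_def xz_def same_def)
    have s: "same xy ys" "same xyz yz"
      using Cons.prems same_remove1[of xs "y # ys" y] same_remove1[of xy ys z]
      by (auto simp: xy_def xyz_def yz_def)
    have V [simp]: "val (set xs)" "val (set ys)" "val (set xy)" "val (set xz)" "val (set xyz)" "val (set yz)"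
      using Cons.prems by (auto simp: same_def xy_def xyz_def xz_def yz_def)
    have O [simp]: "fst y \<in> Obj C" "fst z \<in> Obj C" using mem by (auto intro: val_mem[OF V(1)])
    have A: "dm (pull y xs) = T xs" "cd (pull y xs) = fst y \<odot> T xy" "arr (pull y xs)"
      "dm (pull z xs) = T xs" "cd (pull z xs) = fst z \<odot> T xz" "arr (pull z xs)"
      "dm (pull z xy) = T xy" "cd (pull z xy) = fst z \<odot> T xyz" "arr (pull z xy)"
      "dm (pull y xz) = T xz" "cd (pull y xz) = fst y \<odot> T xyz" "arr (pull y xz)"
      "dm (pull z ys) = T ys" "cd (pull z ys) = fst z \<odot> T yz" "arr (pull z ys)"
      using mem by (simp_all flip: xy_def xz_def xyz_def yz_def xyz')
    let ?y = "fst y" and ?z = "fst z"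
    have "(swap ?y ?z (T yz) oo (idn ?y ** pull z ys)) oo (idn ?y ** perm xy ys) oo pull y xs
        = swap ?y ?z (T yz) oo (idn ?y ** (pull z ys oo perm xy ys)) oo pull y xs"
      by (simp add: cmp_assoc A s interchange')
    also have "pull z ys oo perm xy ys = (idn ?z ** perm xyz yz) oo pull z xy"
      using Cons.IH[OF s(1) mem(5)] by (simp add: xyz_def yz_def)
    also have "swap ?y ?z (T yz) oo (idn ?y ** ((idn ?z ** perm xyz yz) oo pull z xy)) oo pull y xs
        = (swap ?y ?z (T yz) oo (idn ?y ** (idn ?z ** perm xyz yz))) oo (idn ?y ** pull z xy) oo pull y xs"
      by (simp add: cmp_assoc A s interchange')
    also have "swap ?y ?z (T yz) oo (idn ?y ** (idn ?z ** perm xyz yz))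
        = (idn ?z ** (idn ?y ** perm xyz yz)) oo swap ?y ?z (T xyz)"
      using swap_nat[of "idn ?y" "idn ?z" "perm xyz yz"] by (simp add: s)
    also have "((idn ?z ** (idn ?y ** perm xyz yz)) oo swap ?y ?z (T xyz)) oo (idn ?y ** pull z xy) oo pull y xs
        = (idn ?z ** (idn ?y ** perm xyz yz)) oo (swap ?y ?z (T xyz) oo (idn ?y ** pull z xy) oo pull y xs)"
      by (simp add: cmp_assoc A s)
    also have "swap ?y ?z (T xyz) oo (idn ?y ** pull z xy) oo pull y xs = (idn ?z ** pull y xz) oo pull z xs"
      using pull_pull[of xs y z] mem False Cons.prems by (auto simp: same_def xy_def xz_def xyz_def)
    also have "(idn ?z ** (idn ?y ** perm xyz yz)) oo (idn ?z ** pull y xz) oo pull z xs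
        = (idn ?z ** ((idn ?y ** perm xyz yz) oo pull y xz)) oo pull z xs"
      by (simp add: A s interchange')
    finally show ?thesis using False by (simp add: flip: xy_def xz_def xyz' yz_def)
  qed
qed simp

text \<open>Coherence for the symmetry: composites of canonical permutations are canonical. The
  inductive step is \<open>pull_perm\<close>, which lets an extraction pass through a
  permutation.\<close>

lemma perm_trans:
  assumes "same xs ys" "same ys zs"
  shows "perm ys zs oo perm xs ys = perm xs zs"
  using assms
proof (induction zs arbitrary: xs ys)
  case Nil
  then show ?case by (simp add: same_def)
next
  case (Cons z zs)
  have s: "same (remove1 z xs) (remove1 z ys)" "same (remove1 z ys) zs"
    using Cons.prems same_remove1[of xs ys z] same_remove1[of ys "z # zs" z] by auto
  have m [simp]: "z \<in> set ys" "z \<in> set xs" "val (set xs)" "val (set ys)" "fst z \<in> Obj C"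
    using Cons.prems by (auto simp: same_def)
  have "perm ys (z # zs) oo perm xs ys = (idn (fst z) ** perm (remove1 z ys) zs) oo pull z ys oo perm xs ys"
    using Cons.prems s by (simp add: cmp_assoc)
  also have "\<dots> = (idn (fst z) ** (perm (remove1 z ys) zs oo perm (remove1 z xs) (remove1 z ys))) oo pull z xs"
    using Cons.prems s by (simp add: pull_perm interchange')
  finally show ?case using Cons.IH[OF s] by simp
qed

lemma perm_inv [simp]: "same xs ys \<Longrightarrow> perm ys xs oo perm xs ys = idn (T xs)"
  using perm_trans[of xs ys xs] perm_self[of xs] by (auto simp: same_def)

section \<open>Flattening of bracketed words\<close>

primrec ob :: "'o name word \<Rightarrow> 'o" where
  "ob (Leaf x) = fst x" | "ob One = \<I>" | "ob (u ## v) = ob u \<odot> ob v"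

text \<open>The tail \<open>zs\<close> is an accumulator. Without it, an isomorphism from
  \<open>T xs \<odot> T ys\<close> to \<open>T (xs @ ys)\<close> would be needed at every
  pair.\<close>

primrec flat :: "'o name word \<Rightarrow> 'o name list \<Rightarrow> ('o, 'm) arrow" where
  "flat (Leaf x) zs = idn (fst x \<odot> T zs)"
| "flat One zs = la (T zs)"
| "flat (u ## v) zs = flat u (lv v @ zs) oo (idn (ob u) ** flat v zs) oo al (ob u) (ob v) (T zs)"

primrec flat' :: "'o name word \<Rightarrow> 'o name list \<Rightarrow> ('o, 'm) arrow" where
  "flat' (Leaf x) zs = idn (fst x \<odot> T zs)"
| "flat' One zs = la' (T zs)"
| "flat' (u ## v) zs = al' (ob u) (ob v) (T zs) oo (idn (ob u) ** flat' v zs) oo flat' u (lv v @ zs)"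

lemma ob_obj [simp]: "val (set (lv w)) \<Longrightarrow> ob w \<in> Obj C"
  by (induction w) auto

lemma flat_arr [simp]:
  assumes "val (set (lv w))" "val (set zs)"
  shows "dm (flat w zs) = ob w \<odot> T zs" "cd (flat w zs) = T (lv w @ zs)" "arr (flat w zs)"
    "dm (flat' w zs) = T (lv w @ zs)" "cd (flat' w zs) = ob w \<odot> T zs" "arr (flat' w zs)"
  using assms by (induction w arbitrary: zs) simp_all

lemma flat_inv [simp]:
  assumes "val (set (lv w))" "val (set zs)"
  shows "flat w zs oo flat' w zs = idn (T (lv w @ zs)) \<and> flat' w zs oo flat w zs = idn (ob w \<odot> T zs)"
  using assms
  by (induction w arbitrary: zs) (simp_all add: cmp_assoc cancel_left interchange')

lemma flat_nat:
  assumes "val (set (lv w))" "val (set zs)" "val (set zs')" "arr f" "dm f = T zs" "cd f = T zs'"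
  shows "flat w zs' oo (idn (ob w) ** f) = whisk (lv w) f oo flat w zs"
  using assms
proof (induction w arbitrary: zs zs' f)
  case One
  then show ?case using la_nat[of f] by simp
next
  case (Pair u v)
  have [simp]: "val (set (lv u))" "val (set (lv v))" "val (set zs)" "val (set zs')" "arr f" "dm f = T zs" "cd f = T zs'"
    using Pair.prems by auto
  have "flat (u ## v) zs' oo (idn (ob (u ## v)) ** f)
      = flat u (lv v @ zs') oo (idn (ob u) ** flat v zs') oo (al (ob u) (ob v) (T zs')
        oo ((idn (ob u) ** idn (ob v)) ** f))"
    by (simp add: cmp_assoc)
  also have "\<dots> = flat u (lv v @ zs') oo (idn (ob u) ** (flat v zs' oo (idn (ob v) ** f)))
      oo al (ob u) (ob v) (T zs)"
    using al_nat[of "idn (ob u)" "idn (ob v)" f] by (simp add: interchange' del: ten_idn)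
  also have "\<dots> = (flat u (lv v @ zs') oo (idn (ob u) ** whisk (lv v) f)) oo (idn (ob u) ** flat v zs)
      oo al (ob u) (ob v) (T zs)"
    by (simp add: Pair.IH(2)[of zs zs' f] cmp_assoc interchange')
  also have "\<dots> = whisk (lv u) (whisk (lv v) f) oo flat u (lv v @ zs) oo (idn (ob u) ** flat v zs)
      oo al (ob u) (ob v) (T zs)"
    by (simp add: Pair.IH(1)[of "lv v @ zs" "lv v @ zs'" "whisk (lv v) f"] cmp_assoc)
  finally show ?case by (simp add: whisk_append)
qed simp

lemma flat_past_name:
  assumes "distinct (x # lv w @ zs)" "val (set (x # lv w @ zs))"
  shows "perm (x # lv w @ zs) (lv w @ x # zs) oo (idn (fst x) ** flat w zs)
    = flat w (x # zs) oo swap (fst x) (ob w) (T zs)"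
  using assms
proof (induction w arbitrary: zs)
  case (Leaf y)
  then show ?case by (simp add: perm_self)
next
  case One
  then show ?case by (simp add: perm_self swap_unit)
next
  case (Pair u v)
  let ?x = "fst x" and ?u = "ob u" and ?v = "ob v"
  have [simp]: "val (set (lv u))" "val (set (lv v))" "val (set zs)" "?x \<in> Obj C"
    using Pair.prems by auto
  let ?P1 = "perm (x # lv u @ lv v @ zs) (lv u @ x # lv v @ zs)"
  let ?P2 = "perm (x # lv v @ zs) (lv v @ x # zs)"
  have s: "same (x # lv u @ lv v @ zs) (lv u @ x # lv v @ zs)" "same (x # lv v @ zs) (lv v @ x # zs)"
    "same (lv u @ x # lv v @ zs) (lv u @ lv v @ x # zs)"
    using Pair.prems by (auto simp: same_def)
  have P: "perm (x # lv u @ lv v @ zs) (lv u @ lv v @ x # zs) = whisk (lv u) ?P2 oo ?P1"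
    using perm_append[OF _ s(2), of "lv u"] Pair.prems perm_trans[OF s(1,3)] by auto
  have IH1: "?P1 oo (idn ?x ** flat u (lv v @ zs)) = flat u (x # lv v @ zs) oo swap ?x ?u (T (lv v @ zs))"
    using Pair.IH(1)[of "lv v @ zs"] Pair.prems by simp
  have IH2: "?P2 oo (idn ?x ** flat v zs) = flat v (x # zs) oo swap ?x ?v (T zs)"
    using Pair.IH(2)[of zs] Pair.prems by simp
  note [simp] = s perm_arr[OF s(1)] perm_arr[OF s(2)]
  note [simp del] = perm.simps
  have "(whisk (lv u) ?P2 oo ?P1) oo (idn ?x ** (flat u (lv v @ zs) oo (idn ?u ** flat v zs) oo al ?u ?v (T zs)))
     = whisk (lv u) ?P2 oo (?P1 oo (idn ?x ** flat u (lv v @ zs))) oo (idn ?x ** (idn ?u ** flat v zs))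
       oo (idn ?x ** al ?u ?v (T zs))"
    by (simp add: cmp_assoc interchange interchange')
  also have "\<dots> = (whisk (lv u) ?P2 oo flat u (x # lv v @ zs)) oo (swap ?x ?u (T (lv v @ zs))
       oo (idn ?x ** (idn ?u ** flat v zs))) oo (idn ?x ** al ?u ?v (T zs))"
    unfolding IH1 by (simp add: cmp_assoc)
  also have "swap ?x ?u (T (lv v @ zs)) oo (idn ?x ** (idn ?u ** flat v zs))
      = (idn ?u ** (idn ?x ** flat v zs)) oo swap ?x ?u (?v \<odot> T zs)"
    using swap_nat[of "idn ?x" "idn ?u" "flat v zs"] by simp
  also have "whisk (lv u) ?P2 oo flat u (x # lv v @ zs) = flat u (lv v @ x # zs) oo (idn ?u ** ?P2)"
    by (subst flat_nat[of _ "x # lv v @ zs"]) auto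
  also have "(flat u (lv v @ x # zs) oo (idn ?u ** ?P2)) oo
      ((idn ?u ** (idn ?x ** flat v zs)) oo swap ?x ?u (?v \<odot> T zs)) oo (idn ?x ** al ?u ?v (T zs))
    = flat u (lv v @ x # zs) oo (idn ?u ** (?P2 oo (idn ?x ** flat v zs)))
      oo swap ?x ?u (?v \<odot> T zs) oo (idn ?x ** al ?u ?v (T zs))"
    by (simp add: cmp_assoc interchange')
  also have "\<dots> = flat u (lv v @ x # zs) oo (idn ?u ** flat v (x # zs)) oo
      ((idn ?u ** swap ?x ?v (T zs)) oo swap ?x ?u (?v \<odot> T zs) oo (idn ?x ** al ?u ?v (T zs)))"
    unfolding IH2 by (simp add: cmp_assoc interchange')
  also have "\<dots> = flat (u ## v) (x # zs) oo swap ?x (ob (u ## v)) (T zs)"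
    by (simp add: cmp_assoc flip: swap_ten)
  finally show ?case by (simp add: P)
qed

text \<open>Links the braiding of bracketed objects with the permutation of their strands. The
  induction splits the word that moves, by \<open>swap_ten'\<close>; the word that is passed was
  split in \<open>flat_past_name\<close>, by \<open>swap_ten\<close>.\<close>

lemma flat_past_word:
  assumes "distinct (lv u @ lv v @ zs)" "val (set (lv u @ lv v @ zs))"
  shows "perm (lv u @ lv v @ zs) (lv v @ lv u @ zs) oo flat u (lv v @ zs) oo (idn (ob u) ** flat v zs)
    = flat v (lv u @ zs) oo (idn (ob v) ** flat u zs) oo swap (ob u) (ob v) (T zs)"
  using assms
proof (induction u arbitrary: zs)
  case (Leaf x)
  then show ?case using flat_past_name[of x v zs] by simp
next
  case One
  then have [simp]: "val (set (lv v))" "val (set zs)" by auto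
  have "(idn (ob v) ** la (T zs)) oo swap \<I> (ob v) (T zs) = la (ob v \<odot> T zs)"
    by (simp add: cmp_assoc flip: swap_unit)
  then show ?case using One la_nat[of "flat v zs"] by (simp add: perm_self)
next
  case (Pair a b)
  let ?a = "ob a" and ?b = "ob b" and ?v = "ob v"
  have [simp]: "val (set (lv a))" "val (set (lv b))" "val (set (lv v))" "val (set zs)"
    using Pair.prems by auto
  let ?Pa = "perm (lv a @ lv v @ lv b @ zs) (lv v @ lv a @ lv b @ zs)"
  let ?Pb = "perm (lv b @ lv v @ zs) (lv v @ lv b @ zs)"
  have s: "same (lv a @ lv v @ lv b @ zs) (lv v @ lv a @ lv b @ zs)"
    "same (lv b @ lv v @ zs) (lv v @ lv b @ zs)"
    "same (lv a @ lv b @ lv v @ zs) (lv a @ lv v @ lv b @ zs)"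
    using Pair.prems by (auto simp: same_def)
  have P: "perm (lv a @ lv b @ lv v @ zs) (lv v @ lv a @ lv b @ zs) = ?Pa oo whisk (lv a) ?Pb"
    using perm_append[OF _ s(2), of "lv a"] Pair.prems perm_trans[OF s(3,1)] by auto
  have IHa: "?Pa oo flat a (lv v @ lv b @ zs) oo (idn ?a ** flat v (lv b @ zs))
     = flat v (lv a @ lv b @ zs) oo (idn ?v ** flat a (lv b @ zs)) oo swap ?a ?v (T (lv b @ zs))"
    using Pair.IH(1)[of "lv b @ zs"] Pair.prems by auto
  have IHb: "?Pb oo flat b (lv v @ zs) oo (idn ?b ** flat v zs)
     = flat v (lv b @ zs) oo (idn ?v ** flat b zs) oo swap ?b ?v (T zs)"
    using Pair.IH(2)[of zs] Pair.prems by auto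
  note [simp] = s perm_arr[OF s(1)] perm_arr[OF s(2)]
  have "(?Pa oo whisk (lv a) ?Pb) oo (flat a (lv b @ lv v @ zs) oo (idn ?a ** flat b (lv v @ zs))
        oo al ?a ?b (T (lv v @ zs))) oo (idn (?a \<odot> ?b) ** flat v zs)
     = ?Pa oo (whisk (lv a) ?Pb oo flat a (lv b @ lv v @ zs)) oo (idn ?a ** flat b (lv v @ zs))
        oo (al ?a ?b (T (lv v @ zs)) oo ((idn ?a ** idn ?b) ** flat v zs))"
    by (simp add: cmp_assoc)
  also have "al ?a ?b (T (lv v @ zs)) oo ((idn ?a ** idn ?b) ** flat v zs)
      = (idn ?a ** (idn ?b ** flat v zs)) oo al ?a ?b (?v \<odot> T zs)"
    using al_nat[of "idn ?a" "idn ?b" "flat v zs"] by simp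
  also have "whisk (lv a) ?Pb oo flat a (lv b @ lv v @ zs) = flat a (lv v @ lv b @ zs) oo (idn ?a ** ?Pb)"
    by (subst flat_nat[of _ "lv b @ lv v @ zs"]) auto
  also have "?Pa oo (flat a (lv v @ lv b @ zs) oo (idn ?a ** ?Pb)) oo (idn ?a ** flat b (lv v @ zs))
        oo (idn ?a ** (idn ?b ** flat v zs)) oo al ?a ?b (?v \<odot> T zs)
     = ?Pa oo flat a (lv v @ lv b @ zs) oo (idn ?a ** (?Pb oo flat b (lv v @ zs) oo (idn ?b ** flat v zs)))
        oo al ?a ?b (?v \<odot> T zs)"
    by (simp add: cmp_assoc interchange')
  also have "\<dots> = (?Pa oo flat a (lv v @ lv b @ zs) oo (idn ?a ** flat v (lv b @ zs)))
        oo (idn ?a ** (idn ?v ** flat b zs)) oo (idn ?a ** swap ?b ?v (T zs)) oo al ?a ?b (?v \<odot> T zs)"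
    unfolding IHb by (simp add: cmp_assoc interchange')
  also have "\<dots> = flat v (lv a @ lv b @ zs) oo (idn ?v ** flat a (lv b @ zs)) oo (swap ?a ?v (T (lv b @ zs))
        oo (idn ?a ** (idn ?v ** flat b zs))) oo (idn ?a ** swap ?b ?v (T zs)) oo al ?a ?b (?v \<odot> T zs)"
    unfolding IHa by (simp add: cmp_assoc)
  also have "swap ?a ?v (T (lv b @ zs)) oo (idn ?a ** (idn ?v ** flat b zs))
      = (idn ?v ** (idn ?a ** flat b zs)) oo swap ?a ?v (?b \<odot> T zs)"
    using swap_nat[of "idn ?a" "idn ?v" "flat b zs"] by simp
  also have "flat v (lv a @ lv b @ zs) oo (idn ?v ** flat a (lv b @ zs)) oo
      ((idn ?v ** (idn ?a ** flat b zs)) oo swap ?a ?v (?b \<odot> T zs)) oo (idn ?a ** swap ?b ?v (T zs)) oo al ?a ?b (?v \<odot> T zs)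
    = flat v (lv a @ lv b @ zs) oo (idn ?v ** flat a (lv b @ zs)) oo (idn ?v ** (idn ?a ** flat b zs))
      oo (swap ?a ?v (?b \<odot> T zs) oo (idn ?a ** swap ?b ?v (T zs)) oo al ?a ?b (?v \<odot> T zs))"
    by (simp add: cmp_assoc)
  also have "\<dots> = flat v (lv (a ## b) @ zs) oo (idn ?v ** flat (a ## b) zs) oo swap (ob (a ## b)) ?v (T zs)"
    by (simp add: swap_ten' interchange')
  finally show ?case by (simp add: P)
qed

section \<open>Morphisms applied to the first strands of a list\<close>

definition front :: "'o name word \<Rightarrow> ('o, 'm) arrow \<Rightarrow> 'o name word \<Rightarrow> 'o name list \<Rightarrow> ('o, 'm) arrow"
  where "front w f w' zs = flat w' zs oo (f ** idn (T zs)) oo flat' w zs"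

definition typed :: "'o name word \<Rightarrow> ('o, 'm) arrow \<Rightarrow> 'o name word \<Rightarrow> bool"
  where "typed w f w' \<longleftrightarrow> arr f \<and> dm f = ob w \<and> cd f = ob w' \<and> val (set (lv w)) \<and> val (set (lv w'))"

lemma front_arr [simp]:
  assumes "typed w f w'" "val (set zs)"
  shows "dm (front w f w' zs) = T (lv w @ zs)" "cd (front w f w' zs) = T (lv w' @ zs)" "arr (front w f w' zs)"
  using assms by (auto simp: typed_def front_def)

lemma front_cmp:
  assumes "typed w f w'" "typed w' g w''" "val (set zs)"
  shows "front w' g w'' zs oo front w f w' zs = front w (g oo f) w'' zs"
  using assms by (simp add: typed_def front_def cmp_assoc cancel_left interchange')

lemma front_idn: "val (set (lv w)) \<Longrightarrow> val (set zs) \<Longrightarrow> front w (idn (ob w)) w zs = idn (T (lv w @ zs))"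
  by (simp add: front_def)

lemma flat'_nat:
  assumes "val (set (lv w))" "val (set zs)" "val (set zs')" "arr f" "dm f = T zs" "cd f = T zs'"
  shows "(idn (ob w) ** f) oo flat' w zs = flat' w zs' oo whisk (lv w) f"
proof -
  have "(idn (ob w) ** f) oo flat' w zs = flat' w zs' oo (flat w zs' oo (idn (ob w) ** f)) oo flat' w zs"
    using assms by (simp add: cmp_assoc cancel_left)
  then show ?thesis using assms by (simp add: flat_nat cmp_assoc)
qed

lemma front_nat:
  assumes "typed w f w'" "val (set zs)" "val (set zs')" "arr h" "dm h = T zs" "cd h = T zs'"
  shows "whisk (lv w') h oo front w f w' zs = front w f w' zs' oo whisk (lv w) h"
proof -
  have "whisk (lv w') h oo front w f w' zs = (whisk (lv w') h oo flat w' zs) oo (f ** idn (T zs)) oo flat' w zs"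
    using assms by (simp add: typed_def front_def cmp_assoc)
  also have "\<dots> = flat w' zs' oo (f ** idn (T zs')) oo (idn (ob w) ** h) oo flat' w zs"
    using assms by (subst flat_nat[symmetric, of w' zs zs']) (simp_all add: typed_def cmp_assoc interchange')
  also have "\<dots> = front w f w' zs' oo whisk (lv w) h"
    using assms by (simp add: flat'_nat typed_def front_def cmp_assoc)
  finally show ?thesis .
qed

lemma front_left:
  assumes "typed w f w'" "val (set (lv u))" "val (set zs)"
  shows "front (w ## u) (f ** idn (ob u)) (w' ## u) zs = front w f w' (lv u @ zs)"
proof -
  let ?u = "ob u"
  note [simp] = assms(2,3) assms(1)[unfolded typed_def]
  have "front (w ## u) (f ** idn ?u) (w' ## u) zs
      = flat w' (lv u @ zs) oo (idn (ob w') ** flat u zs) oo (al (ob w') ?u (T zs) oo ((f ** idn ?u) ** idn (T zs)))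
      oo al' (ob w) ?u (T zs) oo (idn (ob w) ** flat' u zs) oo flat' w (lv u @ zs)"
    by (simp add: front_def cmp_assoc)
  also have "al (ob w') ?u (T zs) oo ((f ** idn ?u) ** idn (T zs)) = (f ** idn (?u \<odot> T zs)) oo al (ob w) ?u (T zs)"
    using al_nat[of f "idn ?u" "idn (T zs)"] by simp
  also have "flat w' (lv u @ zs) oo (idn (ob w') ** flat u zs) oo ((f ** idn (?u \<odot> T zs)) oo al (ob w) ?u (T zs))
      oo al' (ob w) ?u (T zs) oo (idn (ob w) ** flat' u zs) oo flat' w (lv u @ zs)
    = flat w' (lv u @ zs) oo (f ** (flat u zs oo flat' u zs)) oo flat' w (lv u @ zs)"
    by (simp add: cmp_assoc cancel_left interchange' del: flat_inv)
  finally show ?thesis by (simp add: front_def)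
qed

lemma front_right:
  assumes "typed w f w'" "val (set (lv u))" "val (set zs)"
  shows "front (u ## w) (idn (ob u) ** f) (u ## w') zs = whisk (lv u) (front w f w' zs)"
proof -
  let ?u = "ob u"
  note [simp] = assms(2,3) assms(1)[unfolded typed_def]
  have "front (u ## w) (idn ?u ** f) (u ## w') zs
      = flat u (lv w' @ zs) oo (idn ?u ** flat w' zs) oo (al ?u (ob w') (T zs) oo ((idn ?u ** f) ** idn (T zs)))
      oo al' ?u (ob w) (T zs) oo (idn ?u ** flat' w zs) oo flat' u (lv w @ zs)"
    by (simp add: front_def cmp_assoc)
  also have "al ?u (ob w') (T zs) oo ((idn ?u ** f) ** idn (T zs))
      = (idn ?u ** (f ** idn (T zs))) oo al ?u (ob w) (T zs)"
    using al_nat[of "idn ?u" f "idn (T zs)"] by simp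
  also have "flat u (lv w' @ zs) oo (idn ?u ** flat w' zs) oo ((idn ?u ** (f ** idn (T zs))) oo al ?u (ob w) (T zs))
      oo al' ?u (ob w) (T zs) oo (idn ?u ** flat' w zs) oo flat' u (lv w @ zs)
    = (flat u (lv w' @ zs) oo (idn ?u ** front w f w' zs)) oo flat' u (lv w @ zs)"
    by (simp add: front_def cmp_assoc cancel_left interchange')
  also have "\<dots> = whisk (lv u) (front w f w' zs)"
    using assms by (subst flat_nat[of _ "lv w @ zs"]) (simp_all add: cmp_assoc)
  finally show ?thesis .
qed

lemma front_past_name:
  assumes f: "typed w f w'" and d: "distinct (x # lv w @ zs)" "distinct (x # lv w' @ zs)"
    and v: "val (set (x # zs))"
  shows "perm (x # lv w' @ zs) (lv w' @ x # zs) oo (idn (fst x) ** front w f w' zs)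
    = front w f w' (x # zs) oo perm (x # lv w @ zs) (lv w @ x # zs)"
proof -
  let ?x = "fst x"
  let ?P = "perm (x # lv w @ zs) (lv w @ x # zs)" and ?P' = "perm (x # lv w' @ zs) (lv w' @ x # zs)"
  note [simp] = f[unfolded typed_def]
  have [simp]: "?x \<in> Obj C" "val (set zs)" using v by auto
  have s: "same (x # lv w @ zs) (lv w @ x # zs)" "same (x # lv w' @ zs) (lv w' @ x # zs)"
    using d by (auto simp: same_def)
  note [simp] = perm_arr[OF s(1)] perm_arr[OF s(2)] 
  note [simp del] = perm.simps
  let ?p = "idn ?x ** flat w zs" and ?q = "idn ?x ** flat' w zs"
  have A: "?P oo ?p = flat w (x # zs) oo swap ?x (ob w) (T zs)" "?P' oo (idn ?x ** flat w' zs) = flat w' (x # zs) oo swap ?x (ob w') (T zs)"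
    using flat_past_name[of x w zs] flat_past_name[of x w' zs] d by auto
  have "(?P' oo (idn ?x ** front w f w' zs)) oo ?p
      = (?P' oo (idn ?x ** flat w' zs)) oo (idn ?x ** (f ** idn (T zs)))"
    by (simp add: front_def cmp_assoc interchange)
  also have "\<dots> = flat w' (x # zs) oo (f ** idn (?x \<odot> T zs)) oo swap ?x (ob w) (T zs)"
    using swap_nat[of "idn ?x" f "idn (T zs)"] by (simp add: A cmp_assoc)
  also have "\<dots> = front w f w' (x # zs) oo flat w (x # zs) oo swap ?x (ob w) (T zs)"
    by (simp add: front_def cmp_assoc cancel_left)
  also have "\<dots> = (front w f w' (x # zs) oo ?P) oo ?p"
    using f by (simp add: A cmp_assoc)
  finally show ?thesis
    by (rule epi_split[of ?p ?q, rotated -1]) (simp_all add: f interchange)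
qed

text \<open>Compares a morphism applied at the front with the same morphism applied behind
  \<open>ks\<close>; the strands of \<open>ks\<close> are carried past it one at a time, by
  naturality of \<open>swap\<close>.\<close>

lemma front_past_list:
  assumes f: "typed w f w'" and d: "distinct (ks @ lv w @ zs)" "distinct (ks @ lv w' @ zs)"
    and v: "val (set (ks @ zs))"
  shows "perm (ks @ lv w' @ zs) (lv w' @ ks @ zs) oo whisk ks (front w f w' zs)
    = front w f w' (ks @ zs) oo perm (ks @ lv w @ zs) (lv w @ ks @ zs)"
  using d v
proof (induction ks)
  case Nil
  then show ?case using f by (simp add: perm_self typed_def)
next
  case (Cons k ks)
  note [simp] = f f[unfolded typed_def]
  have [simp]: "fst k \<in> Obj C" "val (set ks)" "val (set zs)" using Cons.prems by auto
  have s: "same (ks @ lv w @ zs) (lv w @ ks @ zs)" "same (ks @ lv w' @ zs) (lv w' @ ks @ zs)"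
    "same (k # lv w @ ks @ zs) (lv w @ k # ks @ zs)" "same (k # lv w' @ ks @ zs) (lv w' @ k # ks @ zs)"
    "same (k # ks @ lv w @ zs) (k # lv w @ ks @ zs)" "same (k # ks @ lv w' @ zs) (k # lv w' @ ks @ zs)"
    using Cons.prems by (auto simp: same_def)
  note [simp] = s(1-4)[THEN perm_arr(1)] s(1-4)[THEN perm_arr(2)] s(1-4)[THEN perm_arr(3)]
  have P: "perm (k # ks @ lv w @ zs) (lv w @ k # ks @ zs)
        = perm (k # lv w @ ks @ zs) (lv w @ k # ks @ zs) oo (idn (fst k) ** perm (ks @ lv w @ zs) (lv w @ ks @ zs))"
      "perm (k # ks @ lv w' @ zs) (lv w' @ k # ks @ zs)
        = perm (k # lv w' @ ks @ zs) (lv w' @ k # ks @ zs) oo (idn (fst k) ** perm (ks @ lv w' @ zs) (lv w' @ ks @ zs))"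
    using perm_trans[OF s(5) s(3)] perm_trans[OF s(6) s(4)] s(1,2) by simp_all
  note [simp del] = perm.simps
  let ?Q = "perm (k # lv w @ ks @ zs) (lv w @ k # ks @ zs)" and ?Q' = "perm (k # lv w' @ ks @ zs) (lv w' @ k # ks @ zs)"
  have IH: "perm (ks @ lv w' @ zs) (lv w' @ ks @ zs) oo whisk ks (front w f w' zs)
      = front w f w' (ks @ zs) oo perm (ks @ lv w @ zs) (lv w @ ks @ zs)"
    using Cons by auto
  have "perm (k # ks @ lv w' @ zs) (lv w' @ k # ks @ zs) oo (idn (fst k) ** whisk ks (front w f w' zs))
      = ?Q' oo (idn (fst k) ** (perm (ks @ lv w' @ zs) (lv w' @ ks @ zs) oo whisk ks (front w f w' zs)))"
    unfolding P by (simp add: cmp_assoc interchange)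
  also have "\<dots> = (?Q' oo (idn (fst k) ** front w f w' (ks @ zs))) oo (idn (fst k) ** perm (ks @ lv w @ zs) (lv w @ ks @ zs))"
    unfolding IH by (simp add: cmp_assoc interchange)
  also have "?Q' oo (idn (fst k) ** front w f w' (ks @ zs)) = front w f w' (k # ks @ zs) oo ?Q"
    using Cons.prems by (intro front_past_name) auto
  finally show ?case by (simp add: P cmp_assoc)
qed

text \<open>What the pentagon says after flattening: rebracketing is invisible. The unit constraints
  then disappear by \<open>la_ten\<close> and the triangle, and the braiding becomes a permutation
  by \<open>flat_past_word\<close>.\<close>

lemma front_al:
  assumes "val (set (lv (u ## v ## w)))" "val (set zs)"
  shows "front ((u ## v) ## w) (al (ob u) (ob v) (ob w)) (u ## v ## w) zs = idn (T (lv u @ lv v @ lv w @ zs))"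
proof -
  let ?u = "ob u" and ?v = "ob v" and ?w = "ob w" and ?Z = "T zs"
  have [simp]: "val (set (lv u))" "val (set (lv v))" "val (set (lv w))" "val (set zs)" using assms by auto
  have "flat (u ## v ## w) zs oo (al ?u ?v ?w ** idn ?Z)
     = flat u (lv v @ lv w @ zs) oo (idn ?u ** (flat v (lv w @ zs) oo (idn ?v ** flat w zs)))
       oo ((idn ?u ** al ?v ?w ?Z) oo al ?u (?v \<odot> ?w) ?Z oo (al ?u ?v ?w ** idn ?Z))"
    by (simp add: cmp_assoc interchange')
  also have "\<dots> = flat u (lv v @ lv w @ zs) oo (idn ?u ** flat v (lv w @ zs)) oo
      ((idn ?u ** (idn ?v ** flat w zs)) oo al ?u ?v (?w \<odot> ?Z)) oo al (?u \<odot> ?v) ?w ?Z"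
    by (simp add: cmp_assoc interchange' flip: al_pentagon)
  also have "(idn ?u ** (idn ?v ** flat w zs)) oo al ?u ?v (?w \<odot> ?Z)
      = al ?u ?v (T (lv w @ zs)) oo (idn (?u \<odot> ?v) ** flat w zs)"
    using al_nat[of "idn ?u" "idn ?v" "flat w zs"] by simp
  also have "flat u (lv v @ lv w @ zs) oo (idn ?u ** flat v (lv w @ zs)) oo
      (al ?u ?v (T (lv w @ zs)) oo (idn (?u \<odot> ?v) ** flat w zs)) oo al (?u \<odot> ?v) ?w ?Z
    = flat ((u ## v) ## w) zs"
    by (simp add: cmp_assoc)
  finally show ?thesis
    by (simp add: front_def flip: cmp_assoc del: flat.simps flat'.simps)
qed

lemma front_la:
  assumes [simp]: "val (set (lv w))" "val (set zs)"
  shows "front (One ## w) (la (ob w)) w zs = idn (T (lv w @ zs))"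
proof -
  have "flat w zs oo (la (ob w) ** idn (T zs)) = flat (One ## w) zs"
    using la_nat[of "flat w zs"] by (simp flip: la_ten cmp_assoc)
  then show ?thesis
    using flat_inv[of "One ## w" zs]
    by (simp add: front_def flip: cmp_assoc del: flat.simps flat'.simps flat_inv)
qed

lemma front_rh:
  assumes [simp]: "val (set (lv w))" "val (set zs)"
  shows "front (w ## One) (rh (ob w)) w zs = idn (T (lv w @ zs))"
proof -
  have "flat w zs oo (rh (ob w) ** idn (T zs)) = flat (w ## One) zs"
    by (simp add: al_triangle)
  then show ?thesis
    using flat_inv[of "w ## One" zs]
    by (simp add: front_def flip: cmp_assoc del: flat.simps flat'.simps flat_inv)
qed

lemma front_br:
  assumes "val (set (lv u @ lv v @ zs))" "distinct (lv u @ lv v @ zs)"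
  shows "front (u ## v) (br (ob u) (ob v)) (v ## u) zs = perm (lv u @ lv v @ zs) (lv v @ lv u @ zs)"
proof -
  let ?u = "ob u" and ?v = "ob v" and ?Z = "T zs" and ?P = "perm (lv u @ lv v @ zs) (lv v @ lv u @ zs)"
  have [simp]: "val (set (lv u))" "val (set (lv v))" "val (set zs)" using assms by auto
  have s: "same (lv u @ lv v @ zs) (lv v @ lv u @ zs)" using assms by (auto simp: same_def)
  note [simp] = perm_arr[OF s]
  have "flat (v ## u) zs oo (br ?u ?v ** idn ?Z)
      = (flat v (lv u @ zs) oo (idn ?v ** flat u zs) oo swap ?u ?v ?Z) oo al ?u ?v ?Z"
    by (simp add: cmp_assoc swap_al)
  also have "\<dots> = ?P oo flat (u ## v) zs"
    using flat_past_word[of u v zs] assms by (simp add: cmp_assoc flip: flat_past_word)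
  finally show ?thesis
    using flat_inv[of "u ## v" zs]
    by (simp add: front_def flip: cmp_assoc del: flat.simps flat'.simps flat_inv)
      (simp add: cmp_assoc del: flat.simps flat'.simps flat_inv)
qed

end

section \<open>Operations on named strands\<close>

text \<open>A state is a generalized element: a morphism from any object to the product of a finite set of strands,
  which is listed in the arbitrary order \<open>listing\<close>; \<open>op w f w'\<close> applies \<open>f\<close> to the strands in \<open>w\<close>, naming
  the results as in \<open>w'\<close>. States for which an operation makes no sense are sent to \<open>None\<close>. Whether the
  other strands are present does not matter, so an equation between operations may be used under any others.\<close>

type_synonym ('o, 'm) state = "('o name set \<times> ('o, 'm) arrow) option"

definition listing :: "'a set \<Rightarrow> 'a list" where "listing S = (SOME xs. distinct xs \<and> set xs = S)"

lemma listing: "finite S \<Longrightarrow> distinct (listing S) \<and> set (listing S) = S"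
  unfolding listing_def by (rule someI_ex) (metis finite_distinct_list)

definition names :: "('o, 'm) state \<Rightarrow> 'o name set"
  where "names st = (case st of None \<Rightarrow> {} | Some (S, \<xi>) \<Rightarrow> S)"

context symmetric_monoidal_category
begin

definition wf_state :: "('o, 'm) state \<Rightarrow> bool"
  where "wf_state st \<longleftrightarrow> (case st of None \<Rightarrow> False
    | Some (S, \<xi>) \<Rightarrow> finite S \<and> val S \<and> arr \<xi> \<and> cd \<xi> = T (listing S))"

text \<open>Names in \<open>w'\<close> may repeat names consumed from \<open>w\<close>, so that
  results can keep the names of inputs; only clashes with untouched strands are excluded.\<close>

definition ok :: "'o name word \<Rightarrow> 'm \<Rightarrow> 'o name word \<Rightarrow> 'o name set \<Rightarrow> bool"
  where "ok w f w' S \<longleftrightarrow> set (lv w) \<subseteq> S \<and> distinct (lv w) \<and> distinct (lv w') \<and> val (set (lv w'))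
    \<and> (S - set (lv w)) \<inter> set (lv w') = {} \<and> f \<in> Hom C (ob w) (ob w')"

definition op :: "'o name word \<Rightarrow> 'm \<Rightarrow> 'o name word \<Rightarrow> ('o, 'm) state \<Rightarrow> ('o, 'm) state"
  where "op w f w' st = (case st of None \<Rightarrow> None | Some (S, \<xi>) \<Rightarrow>
    if wf_state st \<and> ok w f w' S
    then let R = listing (S - set (lv w)); S' = S - set (lv w) \<union> set (lv w')
      in Some (S', perm (lv w' @ R) (listing S') oo front w (ob w, f, ob w') w' R oo perm (listing S) (lv w @ R) oo \<xi>)
    else None)"

text \<open>Identities on present strands become \<open>guard\<close>, which fails if one of the strands is missing.\<close>

definition guard :: "'o name set \<Rightarrow> ('o, 'm) state \<Rightarrow> ('o, 'm) state"
  where "guard N st = (if wf_state st \<and> N \<subseteq> names st then st else None)"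

lemma wf_state_Some: "wf_state (Some (S, \<xi>)) \<longleftrightarrow> finite S \<and> val S \<and> arr \<xi> \<and> cd \<xi> = T (listing S)"
  by (simp add: wf_state_def)

lemma op_None [simp]: "op w f w' None = None"
  by (simp add: op_def)

lemma op_not_ok: "\<not> ok w f w' S \<or> \<not> wf_state (Some (S, \<xi>)) \<Longrightarrow> op w f w' (Some (S, \<xi>)) = None"
  by (auto simp: op_def)

lemma ok_typed: "val S \<Longrightarrow> ok w f w' S \<Longrightarrow> typed w (ob w, f, ob w') w'"
  by (auto simp: ok_def typed_def arr_def dest: val_mono)

text \<open>\<open>op\<close> orders the untouched strands by \<open>listing\<close>; naturality of
  \<open>front\<close> in the tail shows that every other order \<open>R\<close> gives the same
  result.\<close>

lemma op_list:
  assumes st: "wf_state (Some (S, \<xi>))" and ok: "ok w f w' S" and R: "distinct R" "set R = S - set (lv w)"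
  shows "op w f w' (Some (S, \<xi>)) = Some (S - set (lv w) \<union> set (lv w'),
    perm (lv w' @ R) (listing (S - set (lv w) \<union> set (lv w'))) oo front w (ob w, f, ob w') w' R
      oo perm (listing S) (lv w @ R) oo \<xi>)"
proof -
  define S' where "S' = S - set (lv w) \<union> set (lv w')"
  define R0 where "R0 = listing (S - set (lv w))"
  let ?F = "(ob w, f, ob w')"
  have fin: "finite S" "val S" "arr \<xi>" "cd \<xi> = T (listing S)" "finite S'"
    using st by (auto simp: wf_state_Some S'_def)
  have c: "distinct (listing S)" "set (listing S) = S" "distinct (listing S')" "set (listing S') = S'"
    "distinct R0" "set R0 = S - set (lv w)"
    using listing[of S] listing[of S'] listing[of "S - set (lv w)"] fin by (auto simp: R0_def)
  have t: "typed w ?F w'" using ok fin by (intro ok_typed)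
  have v: "val (set (lv w))" "val (set (lv w'))" "val (set R)" "val (set R0)" "val S'"
    using ok fin R c t by (auto simp: S'_def typed_def)
  have s: "same R0 R" "same (lv w @ R0) (lv w @ R)" "same (lv w' @ R0) (lv w' @ R)"
    "same (lv w' @ R) (listing S')" "same (listing S) (lv w @ R0)" "same (lv w' @ R0) (listing S')"
    "same (listing S) (lv w @ R)"
    using R c v fin ok by (auto simp: same_def S'_def ok_def val_mono)
  note [simp] = perm_arr[OF s(1)] perm_arr[OF s(2)] perm_arr[OF s(3)] perm_arr[OF s(4)] perm_arr[OF s(5)]
    perm_arr[OF s(6)] perm_arr[OF s(7)] fin v t
  have w1: "perm (lv w @ R0) (lv w @ R) = whisk (lv w) (perm R0 R)"
    "perm (lv w' @ R0) (lv w' @ R) = whisk (lv w') (perm R0 R)"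
    using ok c by (intro perm_append s; auto simp: ok_def)+
  have p1: "perm (lv w' @ R0) (listing S') = perm (lv w' @ R) (listing S') oo whisk (lv w') (perm R0 R)"
    "perm (listing S) (lv w @ R) = whisk (lv w) (perm R0 R) oo perm (listing S) (lv w @ R0)"
    using perm_trans[OF s(3,4)] perm_trans[OF s(5,2)] by (simp_all add: w1)
  have "perm (lv w' @ R0) (listing S') oo front w ?F w' R0 oo perm (listing S) (lv w @ R0) oo \<xi>
      = perm (lv w' @ R) (listing S') oo (whisk (lv w') (perm R0 R) oo front w ?F w' R0) oo perm (listing S) (lv w @ R0) oo \<xi>"
    by (simp add: p1 cmp_assoc)
  also have "whisk (lv w') (perm R0 R) oo front w ?F w' R0 = front w ?F w' R oo whisk (lv w) (perm R0 R)"
    by (rule front_nat) simp_all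
  finally show ?thesis
    using st ok by (simp add: op_def R0_def[symmetric] S'_def[symmetric] p1 cmp_assoc)
qed

lemma op_wf_state:
  assumes st: "wf_state (Some (S, \<xi>))" and ok: "ok w f w' S"
  obtains \<xi>' where "op w f w' (Some (S, \<xi>)) = Some (S - set (lv w) \<union> set (lv w'), \<xi>')"
    "wf_state (Some (S - set (lv w) \<union> set (lv w'), \<xi>'))"
proof -
  define S' where "S' = S - set (lv w) \<union> set (lv w')"
  define R where "R = listing (S - set (lv w))"
  have fin: "finite S" "val S" "arr \<xi>" "cd \<xi> = T (listing S)" "finite S'"
    using st by (auto simp: wf_state_Some S'_def)
  have c: "distinct (listing S)" "set (listing S) = S" "distinct (listing S')" "set (listing S') = S'"
    "distinct R" "set R = S - set (lv w)"
    using listing[of S] listing[of S'] listing[of "S - set (lv w)"] fin by (auto simp: R_def)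
  have t: "typed w (ob w, f, ob w') w'" using ok fin by (intro ok_typed)
  have v: "val (set (lv w))" "val (set (lv w'))" "val (set R)" "val S'"
    using ok fin c t by (auto simp: S'_def typed_def)
  have s: "same (lv w' @ R) (listing S')" "same (listing S) (lv w @ R)"
    using c v fin ok by (auto simp: same_def S'_def ok_def)
  show thesis
    by (rule that[OF op_list[OF st ok c(5,6)]], unfold wf_state_Some S'_def[symmetric])
      (use fin v t s in simp)
qed

lemma op_mid:
  assumes st: "wf_state (Some (S, \<xi>))" and ok: "ok w f w' S"
    and R: "distinct (ks @ R)" "set (ks @ R) = S - set (lv w)"
  shows "op w f w' (Some (S, \<xi>)) = Some (S - set (lv w) \<union> set (lv w'),
    perm (ks @ lv w' @ R) (listing (S - set (lv w) \<union> set (lv w'))) oo whisk ks (front w (ob w, f, ob w') w' R)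
      oo perm (listing S) (ks @ lv w @ R) oo \<xi>)"
proof -
  define S' where "S' = S - set (lv w) \<union> set (lv w')"
  let ?F = "(ob w, f, ob w')"
  have fin: "finite S" "val S" "arr \<xi>" "cd \<xi> = T (listing S)" "finite S'"
    using st by (auto simp: wf_state_Some S'_def)
  have c: "distinct (listing S)" "set (listing S) = S" "distinct (listing S')" "set (listing S') = S'"
    using listing[of S] listing[of S'] fin by auto
  have t: "typed w ?F w'" using ok fin by (intro ok_typed)
  have "val (set (ks @ R))" using R fin by auto
  then have v: "val (set (lv w))" "val (set (lv w'))" "val (set R)" "val (set ks)" "val S'"
    using fin t by (auto simp: S'_def typed_def)
  have s: "same (listing S) (lv w @ ks @ R)" "same (listing S) (ks @ lv w @ R)" "same (lv w @ ks @ R) (ks @ lv w @ R)"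
    "same (ks @ lv w @ R) (lv w @ ks @ R)"
    "same (lv w' @ ks @ R) (listing S')" "same (ks @ lv w' @ R) (listing S')" "same (ks @ lv w' @ R) (lv w' @ ks @ R)"
    using R c v fin ok by (auto simp: same_def S'_def ok_def)
  note [simp] = s[THEN perm_arr(1)] s[THEN perm_arr(2)] s[THEN perm_arr(3)] fin v t
  have "front w ?F w' (ks @ R) oo perm (listing S) (lv w @ ks @ R)
      = (front w ?F w' (ks @ R) oo perm (ks @ lv w @ R) (lv w @ ks @ R)) oo perm (listing S) (ks @ lv w @ R)"
    using perm_trans[OF s(2,4)] by (simp add: cmp_assoc)
  also have "front w ?F w' (ks @ R) oo perm (ks @ lv w @ R) (lv w @ ks @ R)
      = perm (ks @ lv w' @ R) (lv w' @ ks @ R) oo whisk ks (front w ?F w' R)"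
    using s by (intro front_past_list[symmetric]) (auto simp: same_def)
  finally have e: "front w ?F w' (ks @ R) oo perm (listing S) (lv w @ ks @ R)
      = perm (ks @ lv w' @ R) (lv w' @ ks @ R) oo whisk ks (front w ?F w' R) oo perm (listing S) (ks @ lv w @ R)"
    by (simp add: cmp_assoc)
  have "perm (lv w' @ ks @ R) (listing S') oo front w ?F w' (ks @ R) oo perm (listing S) (lv w @ ks @ R) oo \<xi>
     = perm (lv w' @ ks @ R) (listing S') oo (front w ?F w' (ks @ R) oo perm (listing S) (lv w @ ks @ R)) oo \<xi>"
    by (simp add: cmp_assoc)
  also have "\<dots> = (perm (lv w' @ ks @ R) (listing S') oo perm (ks @ lv w' @ R) (lv w' @ ks @ R))
      oo whisk ks (front w ?F w' R) oo perm (listing S) (ks @ lv w @ R) oo \<xi>"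
    unfolding e by (simp add: cmp_assoc)
  also have "perm (lv w' @ ks @ R) (listing S') oo perm (ks @ lv w' @ R) (lv w' @ ks @ R) = perm (ks @ lv w' @ R) (listing S')"
    by (rule perm_trans[OF s(7,5)])
  finally show ?thesis
    using op_list[OF st ok R] by (simp add: S'_def)
qed

text \<open>An intermediate name that is also an untouched strand makes the left side fail. The last
  condition either excludes this or forces the name into \<open>w''\<close>, so that the right side
  fails too.\<close>

lemma op_comp_fresh:
  assumes f: "f \<in> Hom C (ob w) (ob w')" and g: "g \<in> Hom C (ob w') (ob w'')"
    and d0: "distinct (lv w')" "val (set (lv w'))" "set (lv w') \<subseteq> set (lv w) \<union> set (lv w'')
      \<or> (names st - set (lv w)) \<inter> set (lv w') = {}"
  shows "op w' g w'' (op w f w' st) = op w (g \<cdot> f) w'' st"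
proof (cases st)
  case (Some p)
  obtain S \<xi> where p: "p = (S, \<xi>)" by (cases p)
  have d: "distinct (lv w')" "val (set (lv w'))"
    "set (lv w') \<subseteq> set (lv w) \<union> set (lv w'') \<or> (S - set (lv w)) \<inter> set (lv w') = {}"
    using d0 by (simp_all add: Some p names_def)
  show ?thesis
  proof (cases "wf_state st \<and> ok w f w' S")
    case True
    then have st: "wf_state (Some (S, \<xi>))" and okf: "ok w f w' S" by (auto simp: Some p)
    define S' where "S' = S - set (lv w) \<union> set (lv w')"
    define S'' where "S'' = S' - set (lv w') \<union> set (lv w'')"
    define R where "R = listing (S - set (lv w))"
    let ?F = "(ob w, f, ob w')" and ?G = "(ob w', g, ob w'')"
    have fin: "finite S" "val S" "arr \<xi>" "cd \<xi> = T (listing S)" "finite S'" "finite S''"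
      using st by (auto simp: wf_state_Some S'_def S''_def)
    have c: "distinct (listing S)" "set (listing S) = S" "distinct (listing S')" "set (listing S') = S'"
      "distinct (listing S'')" "set (listing S'') = S''" "distinct R" "set R = S - set (lv w)"
      using listing[of S] listing[of S'] listing[of S''] listing[of "S - set (lv w)"] fin by (auto simp: R_def)
    obtain \<xi>' where \<xi>': "op w f w' (Some (S, \<xi>)) = Some (S', \<xi>')" and st': "wf_state (Some (S', \<xi>'))"
      using op_wf_state[OF st okf] by (auto simp: S'_def)
    show ?thesis
    proof (cases "ok w' g w'' S'")
      case okg: True
      have tf: "typed w ?F w'" and tg: "typed w' ?G w''"
        using ok_typed[OF fin(2) okf] ok_typed[OF _ okg] st' by (auto simp: wf_state_Some)
      have vw: "val (set (lv w))" "val (set (lv w''))" using tf tg by (auto simp: typed_def)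
      have gf: "g \<cdot> f \<in> Hom C (ob w) (ob w'')"
        using f g d vw by (intro comp_hom[of _ "ob w'"]) auto
      have S'': "S'' = S - set (lv w) \<union> set (lv w'')" using okf by (auto simp: S''_def S'_def ok_def)
      have okgf: "ok w (g \<cdot> f) w'' S"
        using okf okg gf d by (auto simp: ok_def S'_def)
      have R': "set R = S' - set (lv w')" using c okf by (auto simp: S'_def ok_def)
      have \<xi>'_eq: "\<xi>' = perm (lv w' @ R) (listing S') oo front w ?F w' R oo perm (listing S) (lv w @ R) oo \<xi>"
        using op_list[OF st okf c(7,8)] \<xi>' by (simp add: S'_def)
      have v: "val (set R)" "val S'" "val S''" using fin c tf vw by (auto simp: S'' S'_def typed_def)
      have s: "same (listing S) (lv w @ R)" "same (lv w' @ R) (listing S')" "same (listing S') (lv w' @ R)"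
        "same (lv w'' @ R) (listing S'')"
        using c v okf okg fin by (auto simp: same_def ok_def S'_def S'')
      note [simp] = s[THEN perm_arr(1)] s[THEN perm_arr(2)] s[THEN perm_arr(3)] fin v tf tg
      have "op w' g w'' (op w f w' st) = Some (S'', perm (lv w'' @ R) (listing S'') oo front w' ?G w'' R
          oo perm (listing S') (lv w' @ R) oo \<xi>')"
        using op_list[OF st' okg c(7) R'] \<xi>' by (simp add: Some p S''_def)
      also have "perm (listing S') (lv w' @ R) oo \<xi>' = front w ?F w' R oo perm (listing S) (lv w @ R) oo \<xi>"
        unfolding \<xi>'_eq by (rule cancel_left) (use s in simp_all)
      also have "front w' ?G w'' R oo front w ?F w' R oo perm (listing S) (lv w @ R) oo \<xi>
          = (front w' ?G w'' R oo front w ?F w' R) oo perm (listing S) (lv w @ R) oo \<xi>"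
        by (simp add: cmp_assoc)
      also have "front w' ?G w'' R oo front w ?F w' R = front w (ob w, g \<cdot> f, ob w'') w'' R"
        by (subst front_cmp[OF tf tg v(1)]) (simp add: cmp_def)
      finally show ?thesis
        using op_list[OF st okgf c(7,8)] by (simp add: Some p S'')
    next
      case False
      then have "\<not> ok w (g \<cdot> f) w'' S"
        using okf g d by (auto simp: ok_def S'_def)
      with False show ?thesis by (simp add: \<xi>' Some p op_not_ok)
    qed
  next
    case False
    then have "op w f w' st = None" by (auto simp: Some p op_not_ok)
    moreover have "op w (g \<cdot> f) w'' st = None"
    proof (cases "wf_state st")
      case True
      with False have "\<not> ok w f w' S" by simp
      then have "\<not> ok w (g \<cdot> f) w'' S" using f d by (auto simp: ok_def)
      then show ?thesis by (simp add: Some p op_not_ok)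
    qed (simp add: Some p op_not_ok)
    ultimately show ?thesis by simp
  qed
qed simp

lemma op_comp:
  assumes "f \<in> Hom C (ob w) (ob w')" "g \<in> Hom C (ob w') (ob w'')"
    and "distinct (lv w')" "val (set (lv w'))" "set (lv w') \<subseteq> set (lv w) \<union> set (lv w'')"
  shows "op w' g w'' (op w f w' st) = op w (g \<cdot> f) w'' st"
  using assms by (intro op_comp_fresh) auto

text \<open>With both inputs listed at the front, \<open>w\<close> before \<open>u\<close>, the two
  orders of application agree by naturality of \<open>front\<close>, which is the interchange
  law.\<close>

lemma op_two:
  assumes st: "wf_state (Some (S, \<xi>))" and okf: "ok w f w' S" and okg: "ok u g u' S"
    and d: "(set (lv w) \<union> set (lv w')) \<inter> (set (lv u) \<union> set (lv u')) = {}"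
    and R: "distinct R" "set R = S - set (lv w) - set (lv u)"
    and S'': "S'' = S - set (lv w) - set (lv u) \<union> set (lv w') \<union> set (lv u')"
  shows "op w f w' (op u g u' (Some (S, \<xi>))) = Some (S'', perm (lv w' @ lv u' @ R) (listing S'')
      oo front w (ob w, f, ob w') w' (lv u' @ R) oo whisk (lv w) (front u (ob u, g, ob u') u' R)
      oo perm (listing S) (lv w @ lv u @ R) oo \<xi>)" (is ?A)
    and "op u g u' (op w f w' (Some (S, \<xi>))) = op w f w' (op u g u' (Some (S, \<xi>)))" (is ?B)
proof -
  let ?F = "(ob w, f, ob w')" and ?G = "(ob u, g, ob u')"
  define S1 where "S1 = S - set (lv w) \<union> set (lv w')"
  define S2 where "S2 = S - set (lv u) \<union> set (lv u')"
  have fin: "finite S" "val S" "arr \<xi>" "cd \<xi> = T (listing S)" "finite S1" "finite S2" "finite S''"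
    using st by (auto simp: wf_state_Some S1_def S2_def S'')
  have c: "distinct (listing S)" "set (listing S) = S" "distinct (listing S1)" "set (listing S1) = S1"
    "distinct (listing S'')" "set (listing S'') = S''" "distinct (listing S2)" "set (listing S2) = S2"
    using listing[of S] listing[of S1] listing[of S2] listing[of S''] fin by auto
  have t: "typed w ?F w'" "typed u ?G u'"
    using ok_typed[OF fin(2) okf] ok_typed[OF fin(2) okg] by auto
  have v: "val (set R)" "val (set (lv w))" "val (set (lv w'))" "val (set (lv u))" "val (set (lv u'))"
    "val S1" "val S2" "val S''"
    using fin R t by (auto simp: S'' S1_def S2_def typed_def)
  obtain \<xi>1 where \<xi>1: "op w f w' (Some (S, \<xi>)) = Some (S1, \<xi>1)" and st1: "wf_state (Some (S1, \<xi>1))"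
    using op_wf_state[OF st okf] by (auto simp: S1_def)
  obtain \<xi>2 where \<xi>2: "op u g u' (Some (S, \<xi>)) = Some (S2, \<xi>2)" and st2: "wf_state (Some (S2, \<xi>2))"
    using op_wf_state[OF st okg] by (auto simp: S2_def)
  have ok1: "ok u g u' S1" and ok2: "ok w f w' S2"
    using okf okg d by (auto simp: ok_def S1_def S2_def)
  have SS: "S1 - set (lv u) \<union> set (lv u') = S''" "S2 - set (lv w) \<union> set (lv w') = S''"
    using d by (auto simp: S1_def S2_def S'')
  have s: "same (listing S) (lv w @ lv u @ R)" "same (lv w @ lv u' @ R) (listing S2)" "same (listing S2) (lv w @ lv u' @ R)"
    "same (lv w' @ lv u @ R) (listing S1)" "same (listing S1) (lv w' @ lv u @ R)" "same (lv w' @ lv u' @ R) (listing S'')"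
    using c v okf okg fin d R by (auto simp: same_def ok_def S1_def S2_def S'')
  note [simp] = s[THEN perm_arr(1)] s[THEN perm_arr(2)] s[THEN perm_arr(3)] fin v t
  have r2: "\<xi>2 = perm (lv w @ lv u' @ R) (listing S2) oo whisk (lv w) (front u ?G u' R) oo perm (listing S) (lv w @ lv u @ R) oo \<xi>"
    using op_mid[OF st okg, of "lv w" R] \<xi>2 R okf d by (force simp: S2_def ok_def)
  have r1: "\<xi>1 = perm (lv w' @ lv u @ R) (listing S1) oo front w ?F w' (lv u @ R) oo perm (listing S) (lv w @ lv u @ R) oo \<xi>"
    using op_list[OF st okf, of "lv u @ R"] \<xi>1 R okg d by (force simp: S1_def ok_def)
  have k2: "perm (listing S2) (lv w @ lv u' @ R) oo \<xi>2 = whisk (lv w) (front u ?G u' R) oo perm (listing S) (lv w @ lv u @ R) oo \<xi>"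
    unfolding r2 by (rule cancel_left) (use s in simp_all)
  have k1: "perm (listing S1) (lv w' @ lv u @ R) oo \<xi>1 = front w ?F w' (lv u @ R) oo perm (listing S) (lv w @ lv u @ R) oo \<xi>"
    unfolding r1 by (rule cancel_left) (use s in simp_all)
  have RR: "distinct (lv u' @ R)" "set (lv u' @ R) = S2 - set (lv w)"
    "distinct (lv w' @ R)" "set (lv w' @ R) = S1 - set (lv u)"
    using R okf okg d by (auto simp: S1_def S2_def ok_def)
  show ?A
    unfolding \<xi>2 op_list[OF st2 ok2 RR(1,2)] SS by (simp add: k2)
  have "op u g u' (op w f w' (Some (S, \<xi>))) = Some (S'', perm (lv w' @ lv u' @ R) (listing S'')
      oo whisk (lv w') (front u ?G u' R) oo front w ?F w' (lv u @ R)
      oo perm (listing S) (lv w @ lv u @ R) oo \<xi>)"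
    unfolding \<xi>1 op_mid[OF st1 ok1 RR(3,4)] SS by (simp add: k1)
  also have "whisk (lv w') (front u ?G u' R) oo front w ?F w' (lv u @ R) oo perm (listing S) (lv w @ lv u @ R) oo \<xi>
     = (whisk (lv w') (front u ?G u' R) oo front w ?F w' (lv u @ R)) oo perm (listing S) (lv w @ lv u @ R) oo \<xi>"
    by (simp add: cmp_assoc)
  also have "whisk (lv w') (front u ?G u' R) oo front w ?F w' (lv u @ R)
      = front w ?F w' (lv u' @ R) oo whisk (lv w) (front u ?G u' R)"
    by (rule front_nat) simp_all
  finally show ?B
    using \<open>?A\<close> by (simp add: cmp_assoc)
qed

text \<open>As the names involved are disjoint, neither operation affects whether the other makes
  sense, so the two orders also fail together.\<close>

lemma op_commute:
  assumes d: "(set (lv w) \<union> set (lv w')) \<inter> (set (lv u) \<union> set (lv u')) = {}"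
  shows "op w f w' (op u g u' st) = op u g u' (op w f w' st)"
proof (cases st)
  case (Some p)
  obtain S \<xi> where p: "p = (S, \<xi>)" by (cases p)
  show ?thesis
  proof (cases "wf_state (Some (S, \<xi>))")
    case st: True
    show ?thesis
    proof (cases "ok w f w' S \<and> ok u g u' S")
      case True
      have "finite (S - set (lv w) - set (lv u))" using st by (simp add: wf_state_Some)
      from listing[OF this] op_two(2)[OF st _ _ d, of f g "listing (S - set (lv w) - set (lv u))", OF _ _ _ _ refl] True
      show ?thesis by (simp add: Some p)
    next
      case False
      have ok1: "ok u g u' (S - set (lv w) \<union> set (lv w')) \<longleftrightarrow> ok u g u' S" if "ok w f w' S"
        using that d by (auto simp: ok_def)
      have ok2: "ok w f w' (S - set (lv u) \<union> set (lv u')) \<longleftrightarrow> ok w f w' S" if "ok u g u' S"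
        using that d by (auto simp: ok_def)
      from False consider "\<not> ok w f w' S" "ok u g u' S" | "ok w f w' S" "\<not> ok u g u' S" | "\<not> ok w f w' S" "\<not> ok u g u' S"
        by blast
      then show ?thesis
      proof cases
        case 1
        then show ?thesis using op_wf_state[OF st, of u g u'] ok2 by (metis Some p op_None op_not_ok)
      next
        case 2
        then show ?thesis using op_wf_state[OF st, of w f w'] ok1 by (metis Some p op_None op_not_ok)
      qed (simp add: Some p op_not_ok)
    qed
  qed (simp add: Some p op_not_ok)
qed simp

lemma op_pair:
  assumes d: "(set (lv w) \<union> set (lv w')) \<inter> (set (lv u) \<union> set (lv u')) = {}"
    and f: "f \<in> Hom C (ob w) (ob w')" and g: "g \<in> Hom C (ob u) (ob u')"
    and v: "val (set (lv w))" "val (set (lv w'))" "val (set (lv u))" "val (set (lv u'))"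
  shows "op (w ## u) (f \<otimes> g) (w' ## u') st = op w f w' (op u g u' st)"
proof (cases st)
  case (Some p)
  obtain S \<xi> where p: "p = (S, \<xi>)" by (cases p)
  have fg: "f \<otimes> g \<in> Hom C (ob w \<odot> ob u) (ob w' \<odot> ob u')"
    using f g v by (intro tensor_hom) auto
  show ?thesis
  proof (cases "wf_state (Some (S, \<xi>))")
    case st: True
    show ?thesis
    proof (cases "ok w f w' S \<and> ok u g u' S")
      case True
      define R where "R = listing (S - set (lv w) - set (lv u))"
      define S'' where "S'' = S - set (lv w) - set (lv u) \<union> set (lv w') \<union> set (lv u')"
      have "finite (S - set (lv w) - set (lv u))" using st by (simp add: wf_state_Some)
      from listing[OF this] have R: "distinct R" "set R = S - set (lv w) - set (lv u)" by (auto simp: R_def)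
      have [simp]: "val (set R)" using st R by (simp add: wf_state_Some)
      let ?F = "(ob w, f, ob w')" and ?G = "(ob u, g, ob u')"
      have t: "typed w ?F w'" "typed u ?G u'" using f g v by (auto simp: typed_def arr_def)
      have t1: "typed (w ## u) (idn (ob w) ** ?G) (w ## u')" "typed (w ## u') (?F ** idn (ob u')) (w' ## u')"
        using t by (auto simp: typed_def)
      have okp: "ok (w ## u) (f \<otimes> g) (w' ## u') S"
        using True d fg by (auto simp: ok_def)
      have "front w ?F w' (lv u' @ R) oo whisk (lv w) (front u ?G u' R)
          = front (w ## u) ((?F ** idn (ob u')) oo (idn (ob w) ** ?G)) (w' ## u') R"
        using front_cmp[OF t1, of R] front_left[OF t(1), of u' R] front_right[OF t(2), of w R] v by simp
      also have "(?F ** idn (ob u')) oo (idn (ob w) ** ?G) = ?F ** ?G"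
        using t by (simp add: interchange typed_def)
      also have "\<dots> = (ob (w ## u), f \<otimes> g, ob (w' ## u'))" by (simp add: ten_def)
      finally have e: "front w ?F w' (lv u' @ R) oo whisk (lv w) (front u ?G u' R)
          = front (w ## u) (ob (w ## u), f \<otimes> g, ob (w' ## u')) (w' ## u') R" .
      have S''': "S - set (lv (w ## u)) \<union> set (lv (w' ## u')) = S''" by (auto simp: S''_def)
      have "finite S" "set (listing S) = S" "distinct (listing S)" using st listing[of S] by (auto simp: wf_state_Some)
      then have s: "same (listing S) (lv w @ lv u @ R)"
        using True R d st by (auto simp: same_def ok_def wf_state_Some)
      have "op w f w' (op u g u' st) = Some (S'', perm (lv w' @ lv u' @ R) (listing S'')
          oo (front w ?F w' (lv u' @ R) oo whisk (lv w) (front u ?G u' R))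
          oo perm (listing S) (lv w @ lv u @ R) oo \<xi>)"
        using op_two(1)[OF st _ _ d R S''_def] True t s st v by (simp add: Some p cmp_assoc perm_arr[OF s] wf_state_Some)
      also have "\<dots> = op (w ## u) (f \<otimes> g) (w' ## u') st"
        unfolding e Some p by (subst op_list[OF st okp R(1)]) (use R S''' in auto)
      finally show ?thesis ..
    next
      case False
      have ok2: "ok w f w' (S - set (lv u) \<union> set (lv u')) \<longleftrightarrow> ok w f w' S" if "ok u g u' S"
        using that d by (auto simp: ok_def)
      have "\<not> ok (w ## u) (f \<otimes> g) (w' ## u') S" using False f g d by (auto simp: ok_def)
      then have "op (w ## u) (f \<otimes> g) (w' ## u') st = None" by (simp add: Some p op_not_ok)
      moreover have "op w f w' (op u g u' st) = None"
        using op_wf_state[OF st, of u g u'] ok2 False by (metis Some p op_None op_not_ok)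
      ultimately show ?thesis by simp
    qed
  qed (simp add: Some p op_not_ok)
qed simp

end

section \<open>Guards and the disappearance of structural morphisms\<close>

context symmetric_monoidal_category
begin

abbreviation gd :: "'o \<times> nat \<Rightarrow> ('o, 'm) state \<Rightarrow> ('o, 'm) state" where "gd x \<equiv> guard {x}"

definition good :: "'o name word \<Rightarrow> bool"
  where "good w \<longleftrightarrow> distinct (lv w) \<and> val (set (lv w))"

lemma good_simps [simp]: "good (Leaf x) \<longleftrightarrow> fst x \<in> Obj C" "good One"
  "good (u ## v) \<longleftrightarrow> good u \<and> good v \<and> set (lv u) \<inter> set (lv v) = {}"
  by (auto simp: good_def)

lemma good_ob [simp]: "good w \<Longrightarrow> ob w \<in> Obj C"
  by (simp add: good_def)

lemma not_wf_state: "\<not> wf_state st \<Longrightarrow> op w f w' st = None" "\<not> wf_state st \<Longrightarrow> guard N st = None"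
  by (auto simp: op_def guard_def split: option.splits)

lemma wf_stateE:
  assumes "wf_state st" obtains S \<xi> where "st = Some (S, \<xi>)" "names st = S" "wf_state (Some (S, \<xi>))" "finite S"
  using assms by (cases st) (auto simp: names_def wf_state_def)

lemma op_cases:
  assumes "wf_state st"
  obtains "ok w f w' (names st)" "wf_state (op w f w' st)" "names (op w f w' st) = names st - set (lv w) \<union> set (lv w')"
  | "\<not> ok w f w' (names st)" "op w f w' st = None"
proof -
  obtain S \<xi> where st: "st = Some (S, \<xi>)" "names st = S" "wf_state (Some (S, \<xi>))" using assms by (rule wf_stateE)
  show thesis
  proof (cases "ok w f w' S")
    case True
    from op_wf_state[OF st(3) this] obtain \<xi>' where "op w f w' st = Some (S - set (lv w) \<union> set (lv w'), \<xi>')"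
      "wf_state (Some (S - set (lv w) \<union> set (lv w'), \<xi>'))" unfolding st(1) .
    then show thesis using True by (intro that(1)) (simp_all add: st(2), simp add: names_def)
  next
    case False
    then show thesis by (intro that(2)) (simp_all add: st(1) names_def op_not_ok)
  qed
qed

lemma guard_op: "guard {} (op w f w' st) = op w f w' st"
  "x \<in> set (lv w') \<Longrightarrow> gd x (op w f w' st) = op w f w' st"
proof -
  show "guard {} (op w f w' st) = op w f w' st"
    by (cases "wf_state st", rule op_cases[of st w f w']) (auto simp: not_wf_state guard_def)
  show "gd x (op w f w' st) = op w f w' st" if "x \<in> set (lv w')"
    by (cases "wf_state st", rule op_cases[of st w f w']) (use that in \<open>auto simp: guard_def not_wf_state\<close>)
qed

lemma guard_op_subset: "N \<subseteq> set (lv w') \<Longrightarrow> guard N (op w f w' st) = op w f w' st"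
  by (cases "wf_state st", rule op_cases[of st w f w']) (auto simp: not_wf_state guard_def)

lemma op_guard_subset: "N \<subseteq> set (lv w) \<Longrightarrow> op w f w' (guard N st) = op w f w' st"
  by (cases "wf_state st", rule op_cases[of st w f w']) (auto simp: not_wf_state guard_def ok_def)

lemma op_guard_disjoint:
  "N \<inter> (set (lv w) \<union> set (lv w')) = {} \<Longrightarrow> op w f w' (guard N st) = guard N (op w f w' st)"
  by (cases "wf_state st", rule op_cases[of st w f w']) (auto simp: not_wf_state guard_def)

lemma guard_Un: "guard N (guard M st) = guard (N \<union> M) st"
  by (cases "wf_state st") (auto simp: guard_def not_wf_state)

lemma guard_commute: "guard N (guard M st) = guard M (guard N st)"
  by (simp add: guard_Un Un_commute)

lemma guard_insert: "N \<noteq> {} \<Longrightarrow> guard (insert x N) st = gd x (guard N st)"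
  by (simp add: guard_Un)

lemma op_gd: "x \<in> set (lv w) \<Longrightarrow> op w f w' (gd x st) = op w f w' st"
  "x \<notin> set (lv w) \<Longrightarrow> x \<notin> set (lv w') \<Longrightarrow> op w f w' (gd x st) = gd x (op w f w' st)"
  "op w f w' (guard {} st) = op w f w' st"
  by (auto intro: op_guard_subset op_guard_disjoint)

lemma gd_gd: "gd x (gd x st) = gd x st" "gd x (guard {} st) = gd x st" "guard {} (gd x st) = gd x st"
  by (simp_all add: guard_Un)

lemma gd_gd': "gd x (gd y (gd x st)) = gd x (gd y st)"
  by (simp add: guard_Un insert_commute)

text \<open>Lets the simplifier remember that a strand is present and drop guards on it. The failed
  state \<open>None\<close> has every strand in this sense.\<close>

definition has :: "'o \<times> nat \<Rightarrow> ('o, 'm) state \<Rightarrow> bool" where "has x st \<longleftrightarrow> gd x st = st"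

lemma has_op: "x \<in> set (lv w') \<Longrightarrow> has x (op w f w' st)"
  "x \<notin> set (lv w) \<Longrightarrow> has x st \<Longrightarrow> has x (op w f w' st)"
  by (auto simp: has_def guard_op) (metis guard_op(2) op_gd(2))

lemma has_gd: "has x (gd x st)" "has x st \<Longrightarrow> has x (gd y st)"
  by (auto simp: has_def gd_gd) (metis guard_commute)

lemma gd_has: "has x st \<Longrightarrow> gd x st = st"
  by (simp add: has_def)

lemmas guard_simps = guard_op op_gd gd_gd gd_gd' guard_insert has_op has_gd gd_has

text \<open>A morphism that flattens to a mere permutation is absorbed into the arbitrary listing of
  the state, by \<open>perm_trans\<close>. Only the test that its strands are present
  remains.\<close>

lemma op_perm:
  assumes "good w" "good w'" "set (lv w) = set (lv w')" "f \<in> Hom C (ob w) (ob w')"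
    and front: "\<And>zs. val (set zs) \<Longrightarrow> distinct (lv w @ zs) \<Longrightarrow>
      front w (ob w, f, ob w') w' zs = perm (lv w @ zs) (lv w' @ zs)"
  shows "op w f w' st = guard (set (lv w)) st"
proof (cases "wf_state st")
  case True
  then obtain S \<xi> where st: "st = Some (S, \<xi>)" "names st = S" "wf_state (Some (S, \<xi>))" "finite S" by (rule wf_stateE)
  show ?thesis
  proof (cases "set (lv w) \<subseteq> S")
    case True
    with assms have ok: "ok w f w' S" by (auto simp: ok_def good_def)
    define R where "R = listing (S - set (lv w))"
    have R: "distinct R" "set R = S - set (lv w)" using listing[of "S - set (lv w)"] st by (auto simp: R_def)
    have c: "distinct (listing S)" "set (listing S) = S" "val S" "arr \<xi>" "cd \<xi> = T (listing S)"
      using listing[of S] st by (auto simp: wf_state_Some)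
    have s: "same (listing S) (lv w @ R)" "same (lv w @ R) (lv w' @ R)" "same (lv w' @ R) (listing S)"
      "same (listing S) (lv w' @ R)"
      using c R True assms by (auto simp: same_def good_def)
    note [simp] = s[THEN perm_arr(1)] s[THEN perm_arr(2)] s[THEN perm_arr(3)] c
    have "perm (lv w' @ R) (listing S) oo perm (lv w @ R) (lv w' @ R) oo perm (listing S) (lv w @ R) oo \<xi>
      = perm (lv w' @ R) (listing S) oo (perm (lv w @ R) (lv w' @ R) oo perm (listing S) (lv w @ R)) oo \<xi>"
      by (simp add: cmp_assoc)
    also have "\<dots> = \<xi>"
      unfolding perm_trans[OF s(1,2)] by (rule cancel_left) (use s in simp_all)
    finally have e: "perm (lv w' @ R) (listing S) oo perm (lv w @ R) (lv w' @ R) oo perm (listing S) (lv w @ R) oo \<xi> = \<xi>" .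
    have "val (set R)" "distinct (lv w @ R)" using R c assms by (auto simp: good_def)
    moreover have "S - set (lv w) \<union> set (lv w') = S" using True assms(3) by auto
    ultimately show ?thesis
      using op_list[OF st(3) ok R] True st e by (simp add: guard_def front)
  next
    case False
    then have "\<not> ok w f w' S" by (auto simp: ok_def)
    then show ?thesis using False st by (simp add: guard_def op_not_ok)
  qed
qed (simp add: not_wf_state)

lemma op_ident: "good w \<Longrightarrow> op w (\<one> (ob w)) w st = guard (set (lv w)) st"
  by (rule op_perm) (auto simp: good_def ident_hom perm_self front_idn[unfolded idn_def] idn_def)

lemma inverse_ident: "X \<in> Obj C \<Longrightarrow> inverse_arrows C X X (\<one> X) (\<one> X)"
  by (simp add: inverse_arrows_def ident_hom comp_ident_left)

lemma inverse_sym: "inverse_arrows C X Y f g \<Longrightarrow> inverse_arrows C Y X g f"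
  by (simp add: inverse_arrows_def)

lemma op_inverse:
  assumes "good w" "good w'" "set (lv w) = set (lv w')" "inverse_arrows C (ob w) (ob w') c c'"
    "\<And>st. op w c w' st = guard (set (lv w)) st"
  shows "op w' c' w st = guard (set (lv w)) st"
proof -
  have "op w' c' w st = op w' c' w (guard (set (lv w)) st)"
    using assms by (simp add: op_guard_subset)
  also have "\<dots> = op w' c' w (op w c w' st)" by (simp add: assms(5))
  also have "\<dots> = op w (c' \<cdot> c) w st"
    using assms by (intro op_comp) (auto simp: inverse_arrows_def good_def)
  also have "\<dots> = guard (set (lv w)) st"
    using assms by (simp add: inverse_arrows_def op_ident)
  finally show ?thesis .
qed

lemma op_alpha:
  assumes "good ((u ## v) ## w)"
  shows "op ((u ## v) ## w) (\<alpha> (ob u) (ob v) (ob w)) (u ## v ## w) st = guard (set (lv ((u ## v) ## w))) st"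
proof (rule op_perm)
  have v: "val (set (lv (u ## v ## w)))" using assms by (auto simp: good_def)
  show "front ((u ## v) ## w) (ob ((u ## v) ## w), \<alpha> (ob u) (ob v) (ob w), ob (u ## v ## w)) (u ## v ## w) zs
      = perm (lv ((u ## v) ## w) @ zs) (lv (u ## v ## w) @ zs)"
    if "val (set zs)" "distinct (lv ((u ## v) ## w) @ zs)" for zs
    using front_al[OF v that(1)] perm_self[of "lv (u ## v ## w) @ zs"] that v
    by (simp add: al_def)
  show "\<alpha> (ob u) (ob v) (ob w) \<in> Hom C (ob ((u ## v) ## w)) (ob (u ## v ## w))"
    using inverse_assoc[of "ob u" "ob v" "ob w"] assms by (auto simp: inverse_arrows_def)
qed (use assms in auto)

lemma op_lunit:
  assumes "good w"
  shows "op (One ## w) (\<lambda>\<lambda> (ob w)) w st = guard (set (lv w)) st"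
  using assms
proof (subst op_perm)
  have v: "val (set (lv w))" "distinct (lv w)" using assms by (auto simp: good_def)
  show "front (One ## w) (ob (One ## w), \<lambda>\<lambda> (ob w), ob w) w zs = perm (lv (One ## w) @ zs) (lv w @ zs)"
    if "val (set zs)" "distinct (lv (One ## w) @ zs)" for zs
    using front_la[OF v(1) that(1)] perm_self[of "lv w @ zs"] that v by (simp add: la_def)
  show "\<lambda>\<lambda> (ob w) \<in> Hom C (ob (One ## w)) (ob w)"
    using inverse_lunit[of "ob w"] assms by (auto simp: inverse_arrows_def)
qed auto

lemma op_runit:
  assumes "good w"
  shows "op (w ## One) (\<rho> (ob w)) w st = guard (set (lv w)) st"
  using assms
proof (subst op_perm)
  have v: "val (set (lv w))" "distinct (lv w)" using assms by (auto simp: good_def)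
  show "front (w ## One) (ob (w ## One), \<rho> (ob w), ob w) w zs = perm (lv (w ## One) @ zs) (lv w @ zs)"
    if "val (set zs)" "distinct (lv (w ## One) @ zs)" for zs
    using front_rh[OF v(1) that(1)] perm_self[of "lv w @ zs"] that v by (simp add: rh_def)
  show "\<rho> (ob w) \<in> Hom C (ob (w ## One)) (ob w)"
    using inverse_runit[of "ob w"] assms by (auto simp: inverse_arrows_def)
qed auto

lemma op_braid:
  assumes "good (u ## v)"
  shows "op (u ## v) (\<c> (ob u) (ob v)) (v ## u) st = guard (set (lv (u ## v))) st"
proof (rule op_perm)
  have v: "val (set (lv (u ## v)))" using assms by (auto simp: good_def)
  show "front (u ## v) (ob (u ## v), \<c> (ob u) (ob v), ob (v ## u)) (v ## u) zs
      = perm (lv (u ## v) @ zs) (lv (v ## u) @ zs)"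
    if "val (set zs)" "distinct (lv (u ## v) @ zs)" for zs
    using front_br[of u v zs] that v by (simp add: br_def)
  show "\<c> (ob u) (ob v) \<in> Hom C (ob (u ## v)) (ob (v ## u))"
    using braid_hom assms by auto
qed (use assms in auto)

lemma op_alpha_inv:
  assumes "good ((u ## v) ## w)"
  shows "op (u ## v ## w) (assoc_inv C (ob u) (ob v) (ob w)) ((u ## v) ## w) st = guard (set (lv ((u ## v) ## w))) st"
  by (rule op_inverse[OF _ _ _ _ op_alpha]) (use assms inverse_assoc in auto)

lemma op_runit_inv:
  assumes "good w"
  shows "op w (inv_arrow C (ob w \<odot> \<I>) (ob w) (\<rho> (ob w))) (w ## One) st = guard (set (lv w)) st"
proof -
  have r: "op (w ## One) (\<rho> (ob w)) w st = guard (set (lv (w ## One))) st" for st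
    using op_runit[OF assms] by simp
  have "op w (inv_arrow C (ob w \<odot> \<I>) (ob w) (\<rho> (ob w))) (w ## One) st = guard (set (lv (w ## One))) st"
    by (rule op_inverse[OF _ _ _ _ r]) (use assms inverse_runit in auto)
  then show ?thesis by simp
qed

lemma op_left:
  assumes "good (w ## u)" "good (w' ## u)" "f \<in> Hom C (ob w) (ob w')" "X = ob u"
  shows "op (w ## u) (f \<otimes> \<one> X) (w' ## u) st = op w f w' (guard (set (lv u)) st)"
  using assms by (subst op_pair) (auto simp: ident_hom op_ident, auto simp: good_def)

lemma op_right:
  assumes "good (u ## w)" "good (u ## w')" "f \<in> Hom C (ob w) (ob w')" "X = ob u"
  shows "op (u ## w) (\<one> X \<otimes> f) (u ## w') st = op w f w' (guard (set (lv u)) st)"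
proof -
  have "op (u ## w) (\<one> X \<otimes> f) (u ## w') st = guard (set (lv u)) (op w f w' st)"
    using assms by (subst op_pair) (auto simp: ident_hom op_ident, auto simp: good_def)
  also have "\<dots> = op w f w' (guard (set (lv u)) st)"
    using assms by (intro op_guard_disjoint[symmetric]) auto
  finally show ?thesis .
qed

lemma op_seq:
  assumes "f \<in> Hom C (ob w) (ob w')" "g \<in> Hom C (ob w') (ob w'')" "good w'"
    "set (lv w') \<subseteq> set (lv w) \<union> set (lv w'')"
  shows "op w (g \<cdot> f) w'' st = op w' g w'' (op w f w' st)"
  using assms by (intro op_comp[symmetric]) (auto simp: good_def)

lemma alpha_hom [simp]: "X \<in> Obj C \<Longrightarrow> Y \<in> Obj C \<Longrightarrow> Z \<in> Obj C \<Longrightarrow> \<alpha> X Y Z \<in> Hom C (X \<odot> Y \<odot> Z) (X \<odot> (Y \<odot> Z))"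
  and alpha_inv_hom [simp]: "X \<in> Obj C \<Longrightarrow> Y \<in> Obj C \<Longrightarrow> Z \<in> Obj C \<Longrightarrow> assoc_inv C X Y Z \<in> Hom C (X \<odot> (Y \<odot> Z)) (X \<odot> Y \<odot> Z)"
  using inverse_assoc by (auto simp: inverse_arrows_def)

lemma lunit_hom [simp]: "X \<in> Obj C \<Longrightarrow> \<lambda>\<lambda> X \<in> Hom C (\<I> \<odot> X) X"
  and runit_hom [simp]: "X \<in> Obj C \<Longrightarrow> \<rho> X \<in> Hom C (X \<odot> \<I>) X"
  using inverse_lunit inverse_runit by (auto simp: inverse_arrows_def)

lemma last_two_hom:
  assumes "X \<in> Obj C" "Y \<in> Obj C" "Z \<in> Obj C" "Y' \<in> Obj C" "Z' \<in> Obj C" "f \<in> Hom C (Y \<odot> Z) (Y' \<odot> Z')"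
  shows "last_two C X Y Z Y' Z' f \<in> Hom C (X \<odot> Y \<odot> Z) (X \<odot> Y' \<odot> Z')"
  unfolding last_two_def using assms
  by (intro comp_hom[of _ "X \<odot> (Y \<odot> Z)"] comp_hom[of _ "X \<odot> (Y' \<odot> Z')"] tensor_hom) (auto simp: ident_hom)

lemma op_last_two:
  assumes g: "good ((u ## v) ## w)" "good ((u ## v') ## w')" and f: "f \<in> Hom C (ob v \<odot> ob w) (ob v' \<odot> ob w')"
    and ob: "X = ob u" "Y = ob v" "Z = ob w" "Y' = ob v'" "Z' = ob w'"
  shows "op ((u ## v) ## w) (last_two C X Y Z Y' Z' f) ((u ## v') ## w') st
    = op (v ## w) f (v' ## w') (guard (set (lv u)) st)"
proof -
  have t: "\<one> (ob u) \<otimes> f \<in> Hom C (ob u \<odot> (ob v \<odot> ob w)) (ob u \<odot> (ob v' \<odot> ob w'))"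
    using g f by (intro tensor_hom) (auto simp: ident_hom)
  have t2: "(\<one> (ob u) \<otimes> f) \<cdot> \<alpha> (ob u) (ob v) (ob w) \<in> Hom C (ob u \<odot> ob v \<odot> ob w) (ob u \<odot> (ob v' \<odot> ob w'))"
    using g f t by (intro comp_hom[of _ "ob u \<odot> (ob v \<odot> ob w)"]) auto
  have "op ((u ## v) ## w) (last_two C X Y Z Y' Z' f) ((u ## v') ## w') st
     = op (u ## v' ## w') (assoc_inv C (ob u) (ob v') (ob w')) ((u ## v') ## w')
       (op (u ## v ## w) (\<one> (ob u) \<otimes> f) (u ## v' ## w')
         (op ((u ## v) ## w) (\<alpha> (ob u) (ob v) (ob w)) (u ## v ## w) st))"
    unfolding last_two_def ob
    using g f t t2
    by (subst op_seq[of _ _ "u ## v' ## w'"], simp_all, blast)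
      (subst op_seq[of _ _ "u ## v ## w"], auto)
  also have "\<dots> = guard (set (lv ((u ## v') ## w'))) (op (u ## v ## w) (\<one> (ob u) \<otimes> f) (u ## v' ## w')
      (guard (set (lv ((u ## v) ## w))) st))"
    using g by (simp only: op_alpha op_alpha_inv)
  also have "\<dots> = op (u ## v ## w) (\<one> (ob u) \<otimes> f) (u ## v' ## w') st"
    by (simp add: guard_op_subset op_guard_subset Un_assoc)
  also have "\<dots> = op (v ## w) f (v' ## w') (guard (set (lv u)) st)"
    using g f by (subst op_right) auto
  finally show ?thesis .
qed

text \<open>Operations are faithful: on the generic state, whose arrow \<open>\<xi>\<close> is the
  canonical isomorphism from \<open>ob w\<close> to the product of its strands, the result of an
  operation differs from its morphism by isomorphisms only.\<close>

lemma op_inject: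
  assumes g: "good w" "good w'" and f: "f \<in> Hom C (ob w) (ob w')" "f' \<in> Hom C (ob w) (ob w')"
    and eq: "\<And>st. wf_state st \<Longrightarrow> names st = set (lv w) \<Longrightarrow> op w f w' st = op w f' w' st"
  shows "f = f'"
proof -
  let ?S = "set (lv w)" and ?S' = "set (lv w')"
  have v [simp]: "val ?S" "val ?S'" "distinct (lv w)" "distinct (lv w')" using g by (auto simp: good_def)
  have c: "distinct (listing ?S)" "set (listing ?S) = ?S" "distinct (listing ?S')" "set (listing ?S') = ?S'"
    using listing[of ?S] listing[of ?S'] by auto
  have s: "same (lv w) (listing ?S)" "same (listing ?S) (lv w)" "same (lv w') (listing ?S')" "same (listing ?S') (lv w')"
    using c by (auto simp: same_def)
  note [simp] = s[THEN perm_arr(1)] s[THEN perm_arr(2)] s[THEN perm_arr(3)]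
  define \<xi> where "\<xi> = perm (lv w) (listing ?S) oo flat w [] oo rh' (ob w)"
  have \<xi>: "arr \<xi>" "cd \<xi> = T (listing ?S)" by (auto simp: \<xi>_def)
  have st: "wf_state (Some (?S, \<xi>))" using \<xi> by (auto simp: wf_state_Some)
  have key: "op w h w' (Some (?S, \<xi>)) = Some (?S', perm (lv w') (listing ?S') oo flat w' []
      oo ((ob w, h, ob w') ** idn \<I>) oo rh' (ob w))" if h: "h \<in> Hom C (ob w) (ob w')" for h
  proof -
    let ?h = "(ob w, h, ob w')"
    have ok: "ok w h w' ?S" using h by (auto simp: ok_def)
    have t: "typed w ?h w'" using h by (auto simp: typed_def arr_def)
    then have a: "arr ?h" by (simp add: typed_def)
    have "perm (listing ?S) (lv w) oo \<xi> = flat w [] oo rh' (ob w)"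
      unfolding \<xi>_def by (rule cancel_left) (use s in simp_all)
    then show ?thesis
      using op_list[OF st ok, of "[]"] a by (simp add: front_def cmp_assoc cancel_left)
  qed
  let ?f = "(ob w, f, ob w')" and ?f' = "(ob w, f', ob w')"
  have a: "arr ?f" "arr ?f'" using f by (auto simp: arr_def)
  have "perm (lv w') (listing ?S') oo flat w' [] oo (?f ** idn \<I>) oo rh' (ob w)
      = perm (lv w') (listing ?S') oo flat w' [] oo (?f' ** idn \<I>) oo rh' (ob w)"
    using eq[OF st] f by (simp add: key names_def)
  then have "flat w' [] oo (?f ** idn \<I>) oo rh' (ob w) = flat w' [] oo (?f' ** idn \<I>) oo rh' (ob w)"
    by (rule mono_split[of "perm (listing ?S') (lv w')" "perm (lv w') (listing ?S')", rotated -1])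
      (use s a in simp_all)
  then have "(?f ** idn \<I>) oo rh' (ob w) = (?f' ** idn \<I>) oo rh' (ob w)"
    by (rule mono_split[of "flat' w' []" "flat w' []", rotated -1]) (use a in simp_all)
  then have "?f ** idn \<I> = ?f' ** idn \<I>"
    by (rule epi_split[of "rh' (ob w)" "rh (ob w)", rotated -1]) (use a in simp_all)
  then have "?f = ?f'" by (rule rh_faithful[rotated -1]) (use a in simp_all)
  then show ?thesis by simp
qed

end

section \<open>Cancellation of the epimorphisms in \<open>Q\<close>\<close>

locale epi_symmetric_monoidal_category = symmetric_monoidal_category C + epi_class C Q
  for C :: "('o, 'm, 'z) symmoncat_scheme" (structure) and Q
begin

lemma coeq_epi:
  assumes "coequalizer C W X Y f g q" "Z \<in> Obj C" "W \<in> Obj C" "X \<in> Obj C" "Y \<in> Obj C"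
    "h \<in> Hom C Y Z" "k \<in> Hom C Y Z" "h \<cdot> q = k \<cdot> q"
  shows "h = k"
proof -
  have c: "f \<in> Hom C W X" "g \<in> Hom C W X" "q \<in> Hom C X Y" "q \<cdot> f = q \<cdot> g"
    using assms(1) by (auto simp: coequalizer_def)
  have hq: "h \<cdot> q \<in> Hom C X Z" using assms c by (intro comp_hom[of _ Y]) auto
  have "(h \<cdot> q) \<cdot> f = (h \<cdot> q) \<cdot> g"
    using assms c comp_assoc[of W X Y Z f q h] comp_assoc[of W X Y Z g q h] by simp
  with assms(1,2) hq have "\<exists>!m. m \<in> Hom C Y Z \<and> m \<cdot> q = h \<cdot> q" by (auto simp: coequalizer_def)
  with assms(6-8) show ?thesis by metis
qed

lemma Q_hom: "X \<in> Obj C \<Longrightarrow> Y \<in> Obj C \<Longrightarrow> q \<in> Q X Y \<Longrightarrow> q \<in> Hom C X Y"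
  using regular by (auto simp: regular_epi_def coequalizer_def)

lemma Q_ident: "X \<in> Obj C \<Longrightarrow> \<one> X \<in> Q X X"
  by (intro contains_isos) (auto simp: iso_arrow_def intro: inverse_ident)

lemma Q_epi:
  assumes "q \<in> Q X Y" "X \<in> Obj C" "Y \<in> Obj C" "Z \<in> Obj C"
    "h \<in> Hom C Y Z" "k \<in> Hom C Y Z" "h \<cdot> q = k \<cdot> q"
  shows "h = k"
  using regular[OF assms(2,3,1)] coeq_epi[OF _ assms(4) _ assms(2,3,5-7)] by (auto simp: regular_epi_def)

end

context symmetric_monoidal_category
begin

text \<open>\<open>rep\<close> translates composites of structural morphisms and generators, by resolution with the rules
  \<open>reps\<close>, to operations on strands in which the structural morphisms have disappeared.\<close>

definition rep :: "'o name word \<Rightarrow> 'm \<Rightarrow> 'o name word \<Rightarrow> (('o, 'm) state \<Rightarrow> ('o, 'm) state) \<Rightarrow> bool"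
  where "rep w f w' P \<longleftrightarrow> f \<in> Hom C (ob w) (ob w') \<and> good w \<and> good w' \<and> (\<forall>st. op w f w' st = P st)"

lemma rep_op: "rep w f w' P \<Longrightarrow> P st = st' \<Longrightarrow> op w f w' st = st'"
  by (simp add: rep_def)

lemma rep_hom: "rep w f w' P \<Longrightarrow> X = ob w \<Longrightarrow> Y = ob w' \<Longrightarrow> f \<in> Hom C X Y"
  by (simp add: rep_def)

lemma rep_eqD:
  "f = g \<Longrightarrow> rep w f w' P \<Longrightarrow> rep w g w' P' \<Longrightarrow> P st = x \<Longrightarrow> P' st = y \<Longrightarrow> x = y"
  by (simp add: rep_def)

text \<open>States having exactly the strands of \<open>w\<close> suffice, since faithfulness is
  decided by the generic one among them.\<close>

lemma rep_inject:
  assumes "rep w f w' P" "rep w g w' P'" "\<And>st. wf_state st \<Longrightarrow> names st = set (lv w) \<Longrightarrow> P st = P' st"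
  shows "f = g"
  using assms by (intro op_inject[of w w']) (auto simp: rep_def)

lemma rep_gen: "f \<in> Hom C (ob w) (ob w') \<Longrightarrow> good w \<Longrightarrow> good w' \<Longrightarrow> rep w f w' (op w f w')"
  by (simp add: rep_def)

lemma rep_seq:
  "rep w f w' P \<Longrightarrow> rep w' g w'' P' \<Longrightarrow> set (lv w') \<subseteq> set (lv w) \<union> set (lv w'')
    \<Longrightarrow> rep w (g \<cdot> f) w'' (\<lambda>st. P' (P st))"
  unfolding rep_def using op_seq[of f w w' g w''] comp_hom[of "ob w" "ob w'" "ob w''" f g] by auto

lemma rep_left:
  assumes "rep w f w' P" "X = ob u" "good u" "(set (lv w) \<union> set (lv w')) \<inter> set (lv u) = {}"
  shows "rep (w ## u) (f \<otimes> \<one> X) (w' ## u) (\<lambda>st. P (guard (set (lv u)) st))"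
proof -
  have "good (w ## u)" "good (w' ## u)" using assms by (auto simp: rep_def)
  then show ?thesis
    using assms op_left[of w u w' f X] by (auto simp: rep_def ident_hom intro!: tensor_hom)
qed

lemma rep_right:
  assumes "rep w f w' P" "X = ob u" "good u" "(set (lv w) \<union> set (lv w')) \<inter> set (lv u) = {}"
  shows "rep (u ## w) (\<one> X \<otimes> f) (u ## w') (\<lambda>st. P (guard (set (lv u)) st))"
proof -
  have "good (u ## w)" "good (u ## w')" using assms by (auto simp: rep_def)
  then show ?thesis
    using assms op_right[of u w w' f X] by (auto simp: rep_def ident_hom intro!: tensor_hom)
qed

lemma rep_ident: "X = ob w \<Longrightarrow> good w \<Longrightarrow> rep w (\<one> X) w (guard (set (lv w)))"
  by (simp add: rep_def ident_hom op_ident)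

lemma rep_alpha:
  assumes "X = ob u" "Y = ob v" "Z = ob w" "good ((u ## v) ## w)"
  shows "rep ((u ## v) ## w) (\<alpha> X Y Z) (u ## v ## w) (guard (set (lv u @ lv v @ lv w)))"
  using assms op_alpha[OF assms(4)] by (auto simp: rep_def Un_assoc)

lemma rep_alpha_inv:
  assumes "X = ob u" "Y = ob v" "Z = ob w" "good ((u ## v) ## w)"
  shows "rep (u ## v ## w) (assoc_inv C X Y Z) ((u ## v) ## w) (guard (set (lv u @ lv v @ lv w)))"
  using assms op_alpha_inv[OF assms(4)] by (auto simp: rep_def Un_assoc)

lemma rep_lunit: "X = ob w \<Longrightarrow> good w \<Longrightarrow> rep (One ## w) (\<lambda>\<lambda> X) w (guard (set (lv w)))"
  by (simp add: rep_def op_lunit)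

lemma rep_runit: "X = ob w \<Longrightarrow> good w \<Longrightarrow> rep (w ## One) (\<rho> X) w (guard (set (lv w)))"
  by (simp add: rep_def op_runit)

lemma rep_runit_inv:
  "X = ob w \<Longrightarrow> good w \<Longrightarrow> rep w (inv_arrow C (X \<odot> \<I>) X (\<rho> X)) (w ## One) (guard (set (lv w)))"
  using inverse_runit[of "ob w"] by (auto simp: rep_def op_runit_inv inverse_arrows_def)

lemma rep_braid:
  assumes "X = ob u" "Y = ob v" "good (u ## v)"
  shows "rep (u ## v) (\<c> X Y) (v ## u) (guard (set (lv u @ lv v)))"
  using assms op_braid[OF assms(3)] by (auto simp: rep_def braid_hom)

lemma rep_braid_inv:
  assumes "X = ob u" "Y = ob v" "good (u ## v)"
  shows "rep (u ## v) (braid_inv C X Y) (v ## u) (guard (set (lv u @ lv v)))"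
  using assms rep_braid[OF assms] by (simp add: braid_inv_eq)

lemma rep_last_two:
  assumes "rep (v ## w) f (v' ## w') P" "X = ob u" "Y = ob v" "Z = ob w" "Y' = ob v'" "Z' = ob w'"
    "good u" "set (lv u) \<inter> (set (lv v) \<union> set (lv w) \<union> set (lv v') \<union> set (lv w')) = {}"
  shows "rep ((u ## v) ## w) (last_two C X Y Z Y' Z' f) ((u ## v') ## w') (\<lambda>st. P (guard (set (lv u)) st))"
proof -
  have g: "good ((u ## v) ## w)" "good ((u ## v') ## w')" using assms by (auto simp: rep_def)
  then show ?thesis
    using assms op_last_two[OF g, of f X Y Z Y' Z'] last_two_hom[of X Y Z Y' Z' f] by (auto simp: rep_def)
qed

lemmas reps = rep_seq rep_last_two rep_left rep_right rep_ident rep_alpha rep_alpha_inv rep_lunit rep_runit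
  rep_runit_inv rep_braid rep_braid_inv

end

section \<open>Multiplier Hopf monoids\<close>

locale Hopf = epi_symmetric_monoidal_category C Q
  for C :: "('o, 'm, 'z) symmoncat_scheme" (structure) and Q +
  fixes H :: "('o, 'm) multiplier_data"
  assumes Hopf: "multiplier_Hopf_monoid C H"
    and nondeg: "nondegenerate_mult C (Carr H) (mult C H)"
    and dense: "Counit H \<in> Q (Carr H) (UnitO C)"
begin

abbreviation A where "A \<equiv> Carr H"
abbreviation a where "a i \<equiv> Leaf (A, i)"
abbreviation m where "m \<equiv> mult C H"
abbreviation tt1 where "tt1 i j \<equiv> op (a i ## a j) (T1 H) (a i ## a j)"
abbreviation tt2 where "tt2 i j \<equiv> op (a i ## a j) (T2 H) (a i ## a j)"
abbreviation ee where "ee i \<equiv> op (a i) (Counit H) One"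
abbreviation rr where "rr i j \<equiv> op (a i ## a j) (inv_arrow C (A \<odot> A) (A \<odot> A) (T1 H)) (a i ## a j)"
abbreviation uu where "uu i j \<equiv> op (a i ## a j) (inv_arrow C (A \<odot> A) (A \<odot> A) (T2 H)) (a i ## a j)"
text \<open>One product under two namings, according to the factor that passes on its name:
  \<open>mL\<close> fits the expression through \<open>t2\<close>, \<open>mR\<close> the one through
  \<open>t1\<close>.\<close>

abbreviation mL where "mL i j \<equiv> op (a i ## a j) m (a i)"
abbreviation mR where "mR i j \<equiv> op (a i ## a j) m (a j)"

lemmas bimonoid = Hopf[unfolded multiplier_Hopf_monoid_def multiplier_bimonoid_def Let_def]
lemmas laws = bimonoid[THEN conjunct1, THEN conjunct2, THEN conjunct2, THEN conjunct2, THEN conjunct2]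
lemmas t1_fusion = laws[THEN conjunct1]
  and t1_law = laws[THEN conjunct2, THEN conjunct1]
  and t2_fusion = laws[THEN conjunct2, THEN conjunct2, THEN conjunct1]
  and t2_law = laws[THEN conjunct2, THEN conjunct2, THEN conjunct2, THEN conjunct1]
  and t1_t2_law = laws[THEN conjunct2, THEN conjunct2, THEN conjunct2, THEN conjunct2, THEN conjunct1]

lemma A_obj [simp]: "A \<in> Obj C"
  and T_hom: "T1 H \<in> Hom C (A \<odot> A) (A \<odot> A)" "T2 H \<in> Hom C (A \<odot> A) (A \<odot> A)"
  and counit_hom: "Counit H \<in> Hom C A \<I>"
  using bimonoid by blast+

lemma inverse_T1: "inverse_arrows C (A \<odot> A) (A \<odot> A) (T1 H) (inv_arrow C (A \<odot> A) (A \<odot> A) (T1 H))"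
  and inverse_T2: "inverse_arrows C (A \<odot> A) (A \<odot> A) (T2 H) (inv_arrow C (A \<odot> A) (A \<odot> A) (T2 H))"
  using Hopf by (auto intro!: inv_arrow_inverse mcat simp: multiplier_Hopf_monoid_def)

lemma rep_gens:
  "i \<noteq> j \<Longrightarrow> rep (a i ## a j) (T1 H) (a i ## a j) (tt1 i j)"
  "i \<noteq> j \<Longrightarrow> rep (a i ## a j) (T2 H) (a i ## a j) (tt2 i j)"
  "rep (a i) (Counit H) One (ee i)"
  "i \<noteq> j \<Longrightarrow> rep (a i ## a j) (inv_arrow C (A \<odot> A) (A \<odot> A) (T1 H)) (a i ## a j) (rr i j)"
  "i \<noteq> j \<Longrightarrow> rep (a i ## a j) (inv_arrow C (A \<odot> A) (A \<odot> A) (T2 H)) (a i ## a j) (uu i j)"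
  using T_hom counit_hom inverse_T1 inverse_T2 by (auto intro!: rep_gen simp: inverse_arrows_def)

text \<open>On named strands the braidings in the fusion equation vanish, and it becomes a pentagon
  equation with legs 12, 13 and 23.\<close>

lemma t1_pentagon:
  assumes "distinct [i, j, k]"
  shows "tt1 i j (tt1 i k (tt1 j k st)) = tt1 j k (tt1 i j st)"
  \<comment> \<open>The pattern of all translations: once words for source and target are chosen,
    resolution builds the schematic operations of both sides, and side conditions on names are
    solved on the way. The guards left over are removed by \<open>guard_simps\<close>.\<close>
  by (insert assms, rule rep_eqD[OF t1_fusion, where w = "(a i ## a j) ## a k" and w' = "(a i ## a j) ## a k"],
      (rule reps rep_gens | (simp; fail))+) (simp_all add: guard_simps)

lemma t2_pentagon:
  assumes "distinct [i, j, k]"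
  shows "tt2 j k (tt2 i k (tt2 i j st)) = tt2 i j (tt2 j k st)"
  by (insert assms, rule rep_eqD[OF t2_fusion, where w = "(a i ## a j) ## a k" and w' = "(a i ## a j) ## a k"],
      (rule reps rep_gens | (simp; fail))+) (simp_all add: guard_simps)

lemma t1_t2:
  assumes "distinct [i, j, k]"
  shows "tt1 j k (tt2 i j st) = tt2 i j (tt1 j k st)"
  by (insert assms, rule rep_eqD[OF t1_t2_law, where w = "(a i ## a j) ## a k" and w' = "(a i ## a j) ## a k"],
      (rule reps rep_gens | (simp; fail))+) (simp_all add: guard_simps)

lemma t1_counit:
  assumes "i \<noteq> j"
  shows "ee j (tt1 i j st) = gd (A, i) (ee j st)"
  by (insert assms, rule rep_eqD[OF t1_law, where w = "a i ## a j" and w' = "a i"],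
      (rule reps rep_gens | (simp; fail))+) (simp_all add: guard_simps)

lemma t2_counit:
  assumes "i \<noteq> j"
  shows "ee i (tt2 i j st) = gd (A, j) (ee i st)"
  by (insert assms, rule rep_eqD[OF t2_law, where w = "a i ## a j" and w' = "a j"],
      (rule reps rep_gens | (simp; fail))+) (simp_all add: guard_simps)

lemma mult_alt: "m = \<rho> A \<cdot> (\<one> A \<otimes> Counit H) \<cdot> T2 H"
  using bimonoid unfolding mult_def by argo

lemma mR:
  assumes "i \<noteq> j"
  shows "mR i j st = ee i (tt1 i j st)"
  unfolding mult_def
  by (insert assms, rule rep_op, (rule reps rep_gens | (simp; fail))+) (simp_all add: guard_simps)

lemma mL:
  assumes "i \<noteq> j"
  shows "mL i j st = ee j (tt2 i j st)"
  unfolding mult_alt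
  by (insert assms, rule rep_op, (rule reps rep_gens | (simp; fail))+) (simp_all add: guard_simps)

lemma m_hom: "m \<in> Hom C (A \<odot> A) A"
  unfolding mult_def
  by (rule rep_hom[of "a 0 ## a 1" _ "a 1"], (rule reps rep_gens | (simp; fail))+)

lemma rep_mult:
  "i \<noteq> j \<Longrightarrow> rep (a i ## a j) m (a i) (mL i j)"
  "i \<noteq> j \<Longrightarrow> rep (a i ## a j) m (a j) (mR i j)"
  using m_hom by (auto intro!: rep_gen)

text \<open>The fusion equation for \<open>t1\<close> with counits on its first two strands; the
  outermost \<open>t1\<close> between these strands is killed by the counit law.\<close>

lemma m_assoc: "m \<cdot> (m \<otimes> \<one> A) = m \<cdot> (\<one> A \<otimes> m) \<cdot> \<alpha> A A A"
proof -
  have e: "mR 2 3 (mR 4 2 st) = mR 4 3 (mR 2 3 st)" for st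
  proof -
    have "mR 2 3 (mR 4 2 st) = ee 4 (ee 2 (tt1 2 3 (tt1 4 2 st)))"
      by (simp add: mR op_commute[of _ _ "a 4" One])
    also have "\<dots> = ee 4 (ee 2 (tt1 4 3 (tt1 2 3 st)))"
      by (simp add: t1_pentagon[symmetric] t1_counit guard_simps)
    also have "\<dots> = mR 4 3 (mR 2 3 st)"
      by (simp add: mR op_commute[of _ _ "a 2" One])
    finally show ?thesis .
  qed
  show ?thesis
    by (rule rep_inject[of "(a 4 ## a 2) ## a 3" _ "a 3"], (rule reps rep_mult(2) | (simp; fail))+)
      (simp add: guard_simps e)
qed

lemma mR_assoc:
  assumes "distinct [i, j, k]"
  shows "mR i k (mL i j st) = mR i k (mR j k st)"
  by (insert assms, rule rep_eqD[OF m_assoc, where w = "(a i ## a j) ## a k" and w' = "a k"],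
      (rule reps rep_mult(2)[of j k] rep_mult(2)[of i k] rep_mult(1) | (simp; fail))+) (simp_all add: guard_simps)

text \<open>Both sides send x y z to x y_1 and y_2 z. This trades \<open>t2\<close> for
  \<open>t1\<close> after a further multiplication, as needed when non-degeneracy is
  applied.\<close>

lemma mR_t2:
  assumes "distinct [i, j, k]"
  shows "mR j k (tt2 i j st) = mL i j (tt1 j k st)"
  using assms by (simp add: mR mL t1_t2)

lemma inverse_ops:
  assumes "i \<noteq> j"
  shows "uu i j (tt2 i j st) = guard {(A, i), (A, j)} st" "tt2 i j (uu i j st) = guard {(A, i), (A, j)} st"
    "rr i j (tt1 i j st) = guard {(A, i), (A, j)} st" "tt1 i j (rr i j st) = guard {(A, i), (A, j)} st"
  using assms inverse_T1 inverse_T2 op_ident[of "a i ## a j"]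
  by (simp_all add: op_comp inverse_arrows_def)

lemma u_pentagon:
  assumes "distinct [i, j, k]"
  shows "uu i j (uu i k (uu j k st)) = uu j k (uu i j st)"
proof -
  define s where "s = uu i j (uu i k (uu j k st))"
  have "uu j k (uu i j st) = uu j k (uu i j (tt2 j k (tt2 i k (tt2 i j s))))"
    using assms by (simp add: s_def inverse_ops guard_simps)
  also have "\<dots> = s"
  proof -
    have "has (A, i) s" "has (A, j) s" "has (A, k) s"
      using assms by (simp_all add: s_def guard_simps)
    then show ?thesis using assms by (simp add: t2_pentagon inverse_ops guard_simps)
  qed
  finally show ?thesis by (simp add: s_def)
qed

lemma u_counit:
  assumes "i \<noteq> j"
  shows "ee i (uu i j st) = gd (A, j) (ee i st)"
proof -
  have "gd (A, j) (ee i st) = gd (A, j) (ee i (tt2 i j (uu i j st)))"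
    using assms by (simp add: inverse_ops guard_simps)
  then show ?thesis using assms by (simp add: t2_counit guard_simps)
qed

text \<open>In Sweedler notation, x s(z_1) s(y) = x s(y z_1) with z_2 kept: the antipode reverses
  products. Inserting \<open>tt2 j k\<close> followed by its inverse makes the inverse fusion
  equation applicable, and the counit on \<open>j\<close> then kills \<open>uu j k\<close>.\<close>

lemma u_u:
  assumes "distinct [i, j, k]"
  shows "ee j (uu i j (uu i k st)) = ee j (uu i j (tt2 j k st))"
proof -
  have "ee j (uu i j (uu i k st)) = ee j (uu i j (uu i k (uu j k (tt2 j k st))))"
    using assms by (simp add: inverse_ops guard_simps)
  then show ?thesis using assms by (simp add: u_pentagon u_counit guard_simps)
qed

abbreviation ss where "ss i j \<equiv> op (a i ## a j) (antipode2 C H) (a i)"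

lemma ss:
  assumes "i \<noteq> j"
  shows "ss i j st = ee j (uu i j st)"
  unfolding antipode2_def Let_def
  by (insert assms, rule rep_op, (rule reps rep_gens | (simp; fail))+) (simp_all add: guard_simps)

lemma s2_hom: "antipode2 C H \<in> Hom C (A \<odot> A) A"
  unfolding antipode2_def Let_def
  by (rule rep_hom[of "a 0 ## a 1" _ "a 0"], (rule reps rep_gens | (simp; fail))+)

lemma rep_ss: "i \<noteq> j \<Longrightarrow> rep (a i ## a j) (antipode2 C H) (a i) (ss i j)"
  using s2_hom by (auto intro!: rep_gen)

lemma ss_ss:
  assumes "distinct [i, j, k]"
  shows "ss i j (ss i k st) = ss i j (mL j k st)"
proof -
  have "ss i j (ss i k st) = ee k (ee j (uu i j (uu i k st)))"
    using assms by (simp add: ss op_commute[of _ _ "a k" One])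
  also have "\<dots> = ss i j (mL j k st)"
    using assms by (simp add: u_u ss mL op_commute[of _ _ "a k" One])
  finally show ?thesis .
qed

lemma ss_u:
  assumes "distinct [i, j, k]"
  shows "ss i j (uu i k st) = ss i j (tt2 j k st)"
  using assms by (simp add: ss u_u)

text \<open>The law x s(y_1) y_2 = x e(y); its companion \<open>ss_t2\<close> is x y_1 s(y_2) = x
  e(y). Both express that \<open>uu\<close> is inverse to \<open>tt2\<close>.\<close>

lemma mL_u: "i \<noteq> j \<Longrightarrow> mL i j (uu i j st) = gd (A, i) (ee j st)"
  by (simp add: mL inverse_ops guard_simps)

lemma ss_t2: "i \<noteq> j \<Longrightarrow> ss i j (tt2 i j st) = gd (A, i) (ee j st)"
  by (simp add: ss inverse_ops guard_simps)

text \<open>Both sides send \<open>x y z\<close> to \<open>x s(y) z\<close>, through the second and the first component of the antipode.\<close>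

lemma mR_ss:
  assumes "distinct [i, j, k]"
  shows "mR i k (ss i j st) = mR i k (ee j (rr j k st))"
proof -
  \<comment> \<open>By invertibility, the given state comes from \<open>s\<close> by
    \<open>tt1 j k\<close> and \<open>tt2 i j\<close>, which commute. Each component of the antipode
    undoes one of them and the counit makes the other a product, so the claim becomes
    associativity.\<close>
  define s where "s = rr j k (uu i j (gd (A, k) st))"
  have 1: "guard {(A, i), (A, j), (A, k)} st = tt2 i j (tt1 j k s)"
    using assms by (simp add: s_def inverse_ops guard_simps)
      (simp add: guard_Un insert_commute)
  have "mR i k (ss i j st) = mR i k (ss i j (guard {(A, i), (A, j), (A, k)} st))"
    using assms by (simp add: guard_simps)
  also have "\<dots> = mR i k (mR j k s)"
    using assms unfolding 1 by (simp add: ss mR inverse_ops guard_simps)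
  also have "\<dots> = mR i k (ee j (tt2 i j s))"
    using assms by (simp add: mR_assoc[symmetric] mL)
  also have "\<dots> = mR i k (ee j (rr j k (tt1 j k (tt2 i j s))))"
    using assms by (simp add: inverse_ops guard_simps)
  also have "\<dots> = mR i k (ee j (rr j k (guard {(A, i), (A, j), (A, k)} st)))"
    using assms unfolding 1 by (simp add: t1_t2)
  also have "\<dots> = mR i k (ee j (rr j k st))"
    using assms by (simp add: guard_simps)
  finally show ?thesis .
qed

end

section \<open>Factorization through epimorphisms in \<open>Q\<close>\<close>

context epi_symmetric_monoidal_category
begin

lemma hom_cmp: "f \<in> Hom C X Y \<Longrightarrow> g \<in> Hom C Y Z \<Longrightarrow> X \<in> Obj C \<Longrightarrow> Y \<in> Obj C \<Longrightarrow> Z \<in> Obj C \<Longrightarrow> g \<cdot> f \<in> Hom C X Z"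
  by (rule comp_hom)

lemma hom_ten1: "f \<in> Hom C X Y \<Longrightarrow> X \<in> Obj C \<Longrightarrow> Y \<in> Obj C \<Longrightarrow> Z \<in> Obj C \<Longrightarrow> f \<otimes> \<one> Z \<in> Hom C (X \<odot> Z) (Y \<odot> Z)"
  by (intro tensor_hom ident_hom)

lemma ten1_cmp:
  "f \<in> Hom C X Y \<Longrightarrow> g \<in> Hom C Y Z \<Longrightarrow> X \<in> Obj C \<Longrightarrow> Y \<in> Obj C \<Longrightarrow> Z \<in> Obj C \<Longrightarrow> W \<in> Obj C \<Longrightarrow>
    (g \<cdot> f) \<otimes> \<one> W = (g \<otimes> \<one> W) \<cdot> (f \<otimes> \<one> W)"
  using tensor_comp[of X Y Z W W W f g "\<one> W" "\<one> W"] by (simp add: ident_hom comp_ident_left)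

lemma Q_tensor_ident: "q \<in> Q X Y \<Longrightarrow> X \<in> Obj C \<Longrightarrow> Y \<in> Obj C \<Longrightarrow> Z \<in> Obj C \<Longrightarrow> q \<otimes> \<one> Z \<in> Q (X \<odot> Z) (Y \<odot> Z)"
  "q \<in> Q X Y \<Longrightarrow> X \<in> Obj C \<Longrightarrow> Y \<in> Obj C \<Longrightarrow> Z \<in> Obj C \<Longrightarrow> \<one> Z \<otimes> q \<in> Q (Z \<odot> X) (Z \<odot> Y)"
  by (auto intro!: tensor_closed Q_ident)

text \<open>\<open>P\<close> will be a non-degenerate multiplication or action, against which equality of morphisms into \<open>B\<close>
  can be tested.\<close>

lemma factor_through:
  assumes q: "q \<in> Q X Y" and X: "X \<in> Obj C" and Y: "Y \<in> Obj C" and Z: "Z \<in> Obj C"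
    and B: "B \<in> Obj C" and D: "D \<in> Obj C" and E: "E \<in> Obj C"
    and F: "F \<in> Hom C (X \<odot> Z) B" and P: "P \<in> Hom C (B \<odot> D) E" and G: "G \<in> Hom C (Y \<odot> Z \<odot> D) E"
    and inj: "\<And>W. W \<in> Obj C \<Longrightarrow> inj_on (\<lambda>h. P \<cdot> (h \<otimes> \<one> D)) (Hom C W B)"
    and test: "P \<cdot> (F \<otimes> \<one> D) = G \<cdot> ((q \<otimes> \<one> Z) \<otimes> \<one> D)"
  shows "\<exists>!k. k \<in> Hom C (Y \<odot> Z) B \<and> k \<cdot> (q \<otimes> \<one> Z) = F"
proof -
  obtain W f g where W: "W \<in> Obj C" and c: "coequalizer C W X Y f g q"
    and cZ: "coequalizer C (W \<odot> Z) (X \<odot> Z) (Y \<odot> Z) (f \<otimes> \<one> Z) (g \<otimes> \<one> Z) (q \<otimes> \<one> Z)"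
    using preserved_coequalizer[OF X Y q] Z by blast
  have qh: "q \<in> Hom C X Y" and eq: "q \<cdot> f = q \<cdot> g" and fh: "f \<in> Hom C W X" and gh: "g \<in> Hom C W X"
    using c by (auto simp: coequalizer_def)
  note O = X Y Z B D E W
  \<comment> \<open>By \<open>test\<close>, after composition with \<open>P\<close> the effect of
    \<open>h\<close> depends on \<open>q \<cdot> h\<close> only, and \<open>q\<close> does not
    distinguish \<open>f\<close> from \<open>g\<close>.\<close>
  have *: "P \<cdot> ((F \<cdot> (h \<otimes> \<one> Z)) \<otimes> \<one> D) = G \<cdot> (((q \<cdot> h) \<otimes> \<one> Z) \<otimes> \<one> D)" if h: "h \<in> Hom C W X" for h
  proof -
    have hZ: "h \<otimes> \<one> Z \<in> Hom C (W \<odot> Z) (X \<odot> Z)" and qZ: "q \<otimes> \<one> Z \<in> Hom C (X \<odot> Z) (Y \<odot> Z)"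
      using h qh O by (auto intro: hom_ten1)
    have "(F \<cdot> (h \<otimes> \<one> Z)) \<otimes> \<one> D = (F \<otimes> \<one> D) \<cdot> ((h \<otimes> \<one> Z) \<otimes> \<one> D)"
      using ten1_cmp[OF hZ F] O by simp
    then have "P \<cdot> ((F \<cdot> (h \<otimes> \<one> Z)) \<otimes> \<one> D) = (P \<cdot> (F \<otimes> \<one> D)) \<cdot> ((h \<otimes> \<one> Z) \<otimes> \<one> D)"
      using comp_assoc[of "W \<odot> Z \<odot> D" "X \<odot> Z \<odot> D" "B \<odot> D" E] hZ F P O by (simp add: hom_ten1)
    also have "\<dots> = G \<cdot> ((q \<otimes> \<one> Z) \<otimes> \<one> D) \<cdot> ((h \<otimes> \<one> Z) \<otimes> \<one> D)"
      unfolding test using comp_assoc[of "W \<odot> Z \<odot> D" "X \<odot> Z \<odot> D" "Y \<odot> Z \<odot> D" E] hZ qZ G O by (simp add: hom_ten1)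
    also have "((q \<otimes> \<one> Z) \<otimes> \<one> D) \<cdot> ((h \<otimes> \<one> Z) \<otimes> \<one> D) = ((q \<cdot> h) \<otimes> \<one> Z) \<otimes> \<one> D"
      using ten1_cmp[OF hZ qZ] ten1_cmp[OF h qh] O by simp
    finally show ?thesis .
  qed
  have "F \<cdot> (f \<otimes> \<one> Z) = F \<cdot> (g \<otimes> \<one> Z)"
  proof (rule inj_onD[OF inj[of "W \<odot> Z"]])
    show "P \<cdot> ((F \<cdot> (f \<otimes> \<one> Z)) \<otimes> \<one> D) = P \<cdot> ((F \<cdot> (g \<otimes> \<one> Z)) \<otimes> \<one> D)"
      using *[OF fh] *[OF gh] eq by simp
    show "F \<cdot> (f \<otimes> \<one> Z) \<in> Hom C (W \<odot> Z) B" "F \<cdot> (g \<otimes> \<one> Z) \<in> Hom C (W \<odot> Z) B"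
      using fh gh F O by (auto intro!: hom_cmp[of _ _ "X \<odot> Z"] hom_ten1)
  qed (use O in simp)
  with cZ F B show ?thesis by (simp add: coequalizer_def)
qed

text \<open>Cancelling an epimorphism on strands: it suffices to compare states to which
  \<open>q\<close> has just been applied, for instance with w x in place of a general element of a
  module.\<close>

lemma rep_cancel:
  assumes q: "q \<in> Q (ob u) (ob w)" and r: "rep u q w R" "rep w f w' P" "rep w g w' P'"
    and w: "set (lv w) \<subseteq> set (lv u) \<union> set (lv w')" and eq: "\<And>st. P (R st) = P' (R st)"
  shows "f = g"
proof (rule Q_epi[OF q])
  show "f \<cdot> q = g \<cdot> q" using rep_seq[OF r(1,2) w] rep_seq[OF r(1,3) w] eq by (rule rep_inject)
qed (use r in \<open>auto simp: rep_def\<close>)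

end

section \<open>Actions and the structures belonging to them\<close>

context Hopf
begin

text \<open>Strands of \<open>N\<close> and of \<open>A\<close> are given different tags as well,
  because \<open>N\<close> may be \<open>A\<close> itself.\<close>

abbreviation act where "act N n i j \<equiv> op (Leaf (N, i) ## a j) n (Leaf (N, i))"
abbreviation act2 where "act2 N n i j \<equiv> op (Leaf (N, i) ## a j) n (Leaf (N, i) ## a j)"

lemma rep_act: "n \<in> Hom C (N \<odot> A) N \<Longrightarrow> N \<in> Obj C \<Longrightarrow> i \<noteq> j \<Longrightarrow>
    rep (Leaf (N, i) ## a j) n (Leaf (N, i)) (act N n i j)"
  by (rule rep_gen) auto

lemma rep_act2: "n \<in> Hom C (N \<odot> A) (N \<odot> A) \<Longrightarrow> N \<in> Obj C \<Longrightarrow> i \<noteq> j \<Longrightarrow>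
    rep (Leaf (N, i) ## a j) n (Leaf (N, i) ## a j) (act2 N n i j)"
  by (rule rep_gen) auto

lemma action_hom:
  assumes "n \<in> Hom C (N \<odot> A) (N \<odot> A)" "N \<in> Obj C"
  shows "action C H N n \<in> Hom C (N \<odot> A) N"
  unfolding action_def
  by (insert assms, rule rep_hom[of "Leaf (N, 2) ## a 3" _ "Leaf (N, 2)"],
      (rule reps rep_gens(3) rep_act2[of n] | (simp; fail))+)

lemma action:
  assumes "n \<in> Hom C (N \<odot> A) (N \<odot> A)" "N \<in> Obj C" "i \<noteq> j"
  shows "act N (action C H N n) i j st = ee j (act2 N n i j st)"
  unfolding action_def
  by (insert assms, rule rep_op, (rule reps rep_gens(3) rep_act2[of n] | (simp; fail))+) (simp_all add: guard_simps)

lemma moduleD: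
  assumes "multiplier_module C Q H N n"
  shows "N \<in> Obj C" "n \<in> Hom C (N \<odot> A) (N \<odot> A)" "action C H N n \<in> Q (N \<odot> A) N"
  using assms by (auto simp: multiplier_module_def Let_def)

lemma module_axiom:
  assumes n: "multiplier_module C Q H N n" and d: "distinct [i, j, k]"
  shows "tt2 j k (act2 N n i k (act2 N n i j st)) = act2 N n i j (tt2 j k st)"
  by (insert d moduleD[OF n], rule rep_eqD[OF n[unfolded multiplier_module_def Let_def, THEN conjunct2, THEN conjunct2, THEN conjunct1], where w = "(Leaf (N, i) ## a j) ## a k" and w' = "(Leaf (N, i) ## a j) ## a k"],
      (rule reps rep_gens(2) rep_act2[of n] | (simp; fail))+) (simp_all add: guard_simps)

lemma multiplier_moduleI:
  assumes "N \<in> Obj C" "n \<in> Hom C (N \<odot> A) (N \<odot> A)" "action C H N n \<in> Q (N \<odot> A) N"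
    and "(last_two C N A A A A (T2 H) \<cdot> last_two C N A A A A (braid_inv C A A) \<cdot> (n \<otimes> \<one> A)
      \<cdot> last_two C N A A A A (\<c> A A) \<cdot> (n \<otimes> \<one> A)) = (n \<otimes> \<one> A) \<cdot> last_two C N A A A A (T2 H)"
  shows "multiplier_module C Q H N n"
  using assms by (simp add: multiplier_module_def Let_def)

text \<open>Apply the counit to strand \<open>j\<close> in the module axiom: it turns
  \<open>act2\<close> on \<open>j\<close> into the action and kills the outer
  \<open>tt2 j k\<close>.\<close>

lemma act2_act:
  assumes n: "multiplier_module C Q H N n2" and v: "n = action C H N n2" and d: "distinct [i, j, k]"
  shows "act2 N n2 i k (act N n i j st) = act N n i j (tt2 j k st)"
proof -
  note D = moduleD[OF n]
  have "act2 N n2 i k (act N n i j st) = ee j (act2 N n2 i k (act2 N n2 i j st))"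
    using d D by (simp add: action v op_commute[of _ _ "a j" One])
  also have "\<dots> = ee j (tt2 j k (act2 N n2 i k (act2 N n2 i j st)))"
    using d by (simp add: t2_counit guard_simps)
  also have "\<dots> = act N n i j (tt2 j k st)"
    using d D by (simp add: action v module_axiom[OF n])
  finally show ?thesis .
qed

lemma act_act:
  assumes n: "multiplier_module C Q H N n2" and v: "n = action C H N n2" and d: "distinct [i, j, k]"
  shows "act N n i k (act N n i j st) = act N n i j (mL j k st)"
proof -
  note D = moduleD[OF n]
  have "act N n i k (act N n i j st) = ee k (act N n i j (tt2 j k st))"
    using d act2_act[OF n v, of i j k] D by (simp add: v action)
  then show ?thesis using d by (simp add: mL op_commute[of _ _ "a k" One])
qed

lemma semigroup_module_act:
  assumes n: "semigroup_module C Q A m N n" and d: "distinct [i, j, k]"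
  shows "act N n i k (act N n i j st) = act N n i j (mL j k st)"
proof -
  have D: "N \<in> Obj C" "n \<in> Hom C (N \<odot> A) N" "n \<cdot> (n \<otimes> \<one> A) = n \<cdot> (\<one> N \<otimes> m) \<cdot> \<alpha> N A A"
    using n by (auto simp: semigroup_module_def)
  show ?thesis
    by (insert d D(1,2), rule rep_eqD[OF D(3), where w = "(Leaf (N, i) ## a j) ## a k" and w' = "Leaf (N, i)"],
        (rule reps rep_act[of n] rep_mult(1) | (simp; fail))+) (simp_all add: guard_simps)
qed

lemma semigroup_moduleI:
  assumes N: "N \<in> Obj C" and n: "n \<in> Q (N \<odot> A) N"
    and ax: "\<And>st. act N n 2 4 (act N n 2 3 st) = act N n 2 3 (mL 3 4 st)"
  shows "semigroup_module C Q A m N n"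
proof -
  have h: "n \<in> Hom C (N \<odot> A) N" using N n by (intro Q_hom) auto
  let ?w = "(Leaf (N, 2) ## a 3) ## a 4"
  have "n \<cdot> (n \<otimes> \<one> A) = n \<cdot> (\<one> N \<otimes> m) \<cdot> \<alpha> N A A"
    by (insert N h, rule rep_inject[of ?w _ "Leaf (N, 2)"], (rule reps rep_act[of n] rep_mult(1) | (simp; fail))+)
      (simp add: guard_simps ax)
  then show ?thesis using N n h by (simp add: semigroup_module_def)
qed

lemma semigroup_module_of:
  assumes n: "multiplier_module C Q H N n2"
  shows "semigroup_module C Q A m N (action C H N n2)"
  using moduleD[OF n] act_act[OF n refl] by (intro semigroup_moduleI) auto

lemma act2_eq:
  assumes "multiplier_module C Q H N n2"
  shows "n2 \<cdot> (action C H N n2 \<otimes> \<one> A) = (action C H N n2 \<otimes> \<one> A) \<cdot> last_two C N A A A A (T2 H)"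
proof -
  note D = moduleD[OF assms] and h = action_hom[OF moduleD(2,1)[OF assms]]
  note r = rep_act2[OF D(2,1)] rep_act[OF h D(1)]
  show ?thesis
    by (insert D(1), rule rep_inject[of "(Leaf (N, 2) ## a 3) ## a 4" _ "Leaf (N, 2) ## a 4"], (rule reps r rep_gens(2) | (simp; fail))+)
      (simp add: guard_simps act2_act[OF assms refl])
qed

text \<open>By \<open>act2_eq\<close>, a structure is prescribed after composition with its action
  tensored with \<open>A\<close>, which is an epimorphism.\<close>

lemma structure_unique:
  assumes "multiplier_module C Q H N n2" "multiplier_module C Q H N n2'" "action C H N n2 = action C H N n2'"
  shows "n2 = n2'"
proof (rule Q_epi)
  note D = moduleD[OF assms(1)]
  show "action C H N n2 \<otimes> \<one> A \<in> Q (N \<odot> A \<odot> A) (N \<odot> A)" using D by (intro Q_tensor_ident) auto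
  show "n2 \<cdot> (action C H N n2 \<otimes> \<one> A) = n2' \<cdot> (action C H N n2 \<otimes> \<one> A)"
    using act2_eq[OF assms(1)] act2_eq[OF assms(2)] assms(3) by simp
qed (use moduleD[OF assms(1)] moduleD[OF assms(2)] in auto)

lemma structure_of:
  assumes "multiplier_module C Q H N n2" "action C H N n2 = n"
  shows "structure_of C Q H N n = n2"
  unfolding structure_of_def using assms structure_unique by (intro the_equality) auto

lemma nondeg_test:
  assumes "Y \<in> Obj C" "W \<in> Obj C"
  shows "inj_on (\<lambda>h. ((\<one> Y \<otimes> m) \<cdot> \<alpha> Y A A) \<cdot> (h \<otimes> \<one> A)) (Hom C W (Y \<odot> A))"
proof -
  have "inj_on (\<lambda>f. (\<one> Y \<otimes> m) \<cdot> \<alpha> Y A A \<cdot> (f \<otimes> \<one> A)) (Hom C W (Y \<odot> A))"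
    using nondeg assms by (simp add: nondegenerate_mult_def)
  moreover have "((\<one> Y \<otimes> m) \<cdot> \<alpha> Y A A) \<cdot> (h \<otimes> \<one> A) = (\<one> Y \<otimes> m) \<cdot> \<alpha> Y A A \<cdot> (h \<otimes> \<one> A)"
    if "h \<in> Hom C W (Y \<odot> A)" for h
    using that assms m_hom
    by (intro comp_assoc[of "W \<odot> A" "Y \<odot> A \<odot> A" "Y \<odot> (A \<odot> A)" "Y \<odot> A"]) (auto intro!: tensor_hom ident_hom)
  ultimately show ?thesis by (simp cong: inj_on_cong)
qed

text \<open>The structure has to send (w x) y to w (x y_1) and y_2, so \<open>?F\<close> must factor
  through \<open>n\<close> tensored with \<open>A\<close>. Multiplying y_2 by z gives (w x) y_1 and
  y_2 z, which depends on w x only and is computed by \<open>?G\<close>; non-degeneracy of the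
  multiplication removes z.\<close>

lemma structure_exists:
  assumes n: "semigroup_module C Q A m N n"
  obtains n2 where "multiplier_module C Q H N n2" "action C H N n2 = n"
proof -
  have N: "N \<in> Obj C" and h: "n \<in> Hom C (N \<odot> A) N" and nQ: "n \<in> Q (N \<odot> A) N"
    using n by (auto simp: semigroup_module_def)
  note r = rep_act[OF h N]
  let ?N = "Leaf (N, 2)"
  let ?F = "(n \<otimes> \<one> A) \<cdot> last_two C N A A A A (T2 H)"
  let ?G = "(n \<otimes> \<one> A) \<cdot> last_two C N A A A A (T1 H)"
  have F: "?F \<in> Hom C (N \<odot> A \<odot> A) (N \<odot> A)"
    by (insert N, rule rep_hom[of "(?N ## a 3) ## a 4" _ "?N ## a 4"], (rule reps r rep_gens(2) | (simp; fail))+)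
  have G: "?G \<in> Hom C (N \<odot> A \<odot> A) (N \<odot> A)"
    by (insert N, rule rep_hom[of "(?N ## a 3) ## a 4" _ "?N ## a 4"], (rule reps r rep_gens(1) | (simp; fail))+)
  have key: "mR 3 4 (act N n 2 5 (tt2 5 3 st)) = act N n 2 3 (tt1 3 4 (act N n 2 5 st))" for st
  proof -
    have "mR 3 4 (act N n 2 5 (tt2 5 3 st)) = act N n 2 5 (mR 3 4 (tt2 5 3 st))"
      by (simp add: op_commute[of _ _ "?N ## a 5"])
    also have "\<dots> = act N n 2 3 (act N n 2 5 (tt1 3 4 st))"
      by (simp add: mR_t2 semigroup_module_act[OF n])
    also have "\<dots> = act N n 2 3 (tt1 3 4 (act N n 2 5 st))"
      by (simp add: op_commute[of "?N ## a 5" ?N "a 3 ## a 4"])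
    finally show ?thesis .
  qed
  have test: "((\<one> N \<otimes> m) \<cdot> \<alpha> N A A) \<cdot> (?F \<otimes> \<one> A) = ?G \<cdot> ((n \<otimes> \<one> A) \<otimes> \<one> A)"
    by (insert N, rule rep_inject[of "((?N ## a 5) ## a 3) ## a 4" _ "?N ## a 4"],
      (rule reps r rep_gens(1,2) rep_mult(2) | (simp; fail))+) (simp add: guard_simps key)
  have P: "(\<one> N \<otimes> m) \<cdot> \<alpha> N A A \<in> Hom C (N \<odot> A \<odot> A) (N \<odot> A)"
    by (insert N, rule rep_hom[of "(?N ## a 3) ## a 4" _ "?N ## a 4"], (rule reps rep_mult(2) | (simp; fail))+)
  obtain k where k: "k \<in> Hom C (N \<odot> A) (N \<odot> A)" "k \<cdot> (n \<otimes> \<one> A) = ?F"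
    using factor_through[OF nQ _ N A_obj _ A_obj _ F P G nondeg_test[OF N] test] N by auto
  note rk = r rep_act2[OF k(1) N]
  have ka: "act2 N k i l (act N n i j st) = act N n i j (tt2 j l st)" if "distinct [i, j, l]" for i j l st
    by (insert that N, rule rep_eqD[OF k(2), where w = "(Leaf (N, i) ## a j) ## a l" and w' = "Leaf (N, i) ## a l"],
        (rule reps rk rep_gens(2) | (simp; fail))+) (simp_all add: guard_simps)
  have e: "ee 3 (act2 N k 2 3 (act N n 2 5 st)) = act N n 2 3 (act N n 2 5 st)" for st
    by (simp add: ka semigroup_module_act[OF n] mL op_commute[of _ _ "a 3" One])
  have act: "action C H N k = n"
    unfolding action_def
    by (insert N nQ, rule rep_cancel[of "n \<otimes> \<one> A" "(?N ## a 5) ## a 3" "?N ## a 3" _ _ ?N],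
        (rule reps rk rep_gens(3) | (simp add: Q_tensor_ident; fail))+) (simp add: guard_simps e)
  have "multiplier_module C Q H N k"
  proof (rule multiplier_moduleI)
    show "last_two C N A A A A (T2 H) \<cdot> last_two C N A A A A (braid_inv C A A) \<cdot> (k \<otimes> \<one> A)
      \<cdot> last_two C N A A A A (\<c> A A) \<cdot> (k \<otimes> \<one> A) = (k \<otimes> \<one> A) \<cdot> last_two C N A A A A (T2 H)" (is "?X = ?Y")
    proof -
      let ?w = "(?N ## a 3) ## a 4"
      \<comment> \<open>Once \<open>n\<close> has been applied with strand 5, the module axiom for
        \<open>k\<close> is the fusion equation of \<open>t2\<close>.\<close>
      have e: "tt2 3 4 (act2 N k 2 4 (act2 N k 2 3 (act N n 2 5 st))) = act2 N k 2 3 (tt2 3 4 (act N n 2 5 st))" for st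
      proof -
        have "tt2 3 4 (act2 N k 2 4 (act2 N k 2 3 (act N n 2 5 st))) = act N n 2 5 (tt2 3 4 (tt2 5 4 (tt2 5 3 st)))"
          by (simp add: ka op_commute[of "a 3 ## a 4" _ "?N ## a 5"])
        also have "\<dots> = act2 N k 2 3 (act N n 2 5 (tt2 3 4 st))"
          by (simp add: t2_pentagon ka)
        finally show ?thesis by (simp add: op_commute[of "a 3 ## a 4" _ "?N ## a 5"])
      qed
      show ?thesis
        by (insert N nQ, rule rep_cancel[of "(n \<otimes> \<one> A) \<otimes> \<one> A" "((?N ## a 5) ## a 3) ## a 4" ?w _ _ ?w],
            (rule reps rk rep_gens(2) | (simp add: Q_tensor_ident; fail))+) (simp add: guard_simps e)
    qed
  qed (use N k act nQ in auto)
  with act that show thesis by blast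
qed

end

context epi_symmetric_monoidal_category
begin

lemma rep_cong: "rep w f w' P \<Longrightarrow> (\<And>st. P st = P' st) \<Longrightarrow> rep w f w' P'"
  by (simp add: rep_def)

lemma Q_cmp: "s \<in> Q X Y \<Longrightarrow> t \<in> Q Y Z \<Longrightarrow> X \<in> Obj C \<Longrightarrow> Y \<in> Obj C \<Longrightarrow> Z \<in> Obj C \<Longrightarrow> t \<cdot> s \<in> Q X Z"
  by (rule comp_closed)

lemma Q_inverse: "inverse_arrows C X Y f g \<Longrightarrow> X \<in> Obj C \<Longrightarrow> Y \<in> Obj C \<Longrightarrow> f \<in> Q X Y"
  by (rule contains_isos) (auto simp: iso_arrow_def)

lemma inverse_braid: "X \<in> Obj C \<Longrightarrow> Y \<in> Obj C \<Longrightarrow> inverse_arrows C (X \<odot> Y) (Y \<odot> X) (\<c> X Y) (\<c> Y X)"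
  by (simp add: inverse_arrows_def braid_hom braid_symmetric)

lemma Q_structural:
  "X \<in> Obj C \<Longrightarrow> Y \<in> Obj C \<Longrightarrow> Z \<in> Obj C \<Longrightarrow> \<alpha> X Y Z \<in> Q (X \<odot> Y \<odot> Z) (X \<odot> (Y \<odot> Z))"
  "X \<in> Obj C \<Longrightarrow> Y \<in> Obj C \<Longrightarrow> Z \<in> Obj C \<Longrightarrow> assoc_inv C X Y Z \<in> Q (X \<odot> (Y \<odot> Z)) (X \<odot> Y \<odot> Z)"
  "X \<in> Obj C \<Longrightarrow> Y \<in> Obj C \<Longrightarrow> \<c> X Y \<in> Q (X \<odot> Y) (Y \<odot> X)"
  "X \<in> Obj C \<Longrightarrow> \<lambda>\<lambda> X \<in> Q (\<I> \<odot> X) X"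
  by (auto intro: Q_inverse[OF inverse_assoc] Q_inverse[OF inverse_sym[OF inverse_assoc]]
      Q_inverse[OF inverse_lunit] Q_inverse[OF inverse_braid])

end

section \<open>Unit, products and associativity of modules\<close>

context Hopf
begin

lemma unit_action: "action C H \<I> (\<one> (\<I> \<odot> A)) = Counit H \<cdot> \<lambda>\<lambda> A"
  unfolding action_def
  by (rule rep_inject[of "One ## a 3" _ One], (rule reps rep_gens(3) | (simp; fail))+) (simp add: guard_simps)

text \<open>For the trivial action the structure is an identity, so both sides of the axiom reduce
  to \<open>t2\<close>. Density of the counit puts the action in \<open>Q\<close>.\<close>

lemma unit_module: "multiplier_module C Q H \<I> (\<one> (\<I> \<odot> A))"
proof (rule multiplier_moduleI)
  let ?k = "\<one> (\<I> \<odot> A)" and ?w = "(One ## a 3) ## a 4"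
  show "action C H \<I> ?k \<in> Q (\<I> \<odot> A) \<I>"
    unfolding unit_action using dense by (intro Q_cmp[of _ _ A] Q_structural) auto
  show "last_two C \<I> A A A A (T2 H) \<cdot> last_two C \<I> A A A A (braid_inv C A A) \<cdot> (?k \<otimes> \<one> A)
      \<cdot> last_two C \<I> A A A A (\<c> A A) \<cdot> (?k \<otimes> \<one> A) = (?k \<otimes> \<one> A) \<cdot> last_two C \<I> A A A A (T2 H)"
    by (rule rep_inject[of ?w _ ?w], (rule reps rep_gens(2) | (simp; fail))+) (simp add: guard_simps)
qed (auto simp: ident_hom)

text \<open>The explicit structure behind the product action, which \<open>module_category\<close>
  specifies only through \<open>structure_of\<close>: \<open>w\<close> and then \<open>v\<close> are
  applied with the same strand of \<open>A\<close>.\<close>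

definition prodS :: "'o \<Rightarrow> 'm \<Rightarrow> 'o \<Rightarrow> 'm \<Rightarrow> 'm"
  where "prodS V v W w = last_two C V A W W A (\<c> A W) \<cdot> (v \<otimes> \<one> W)
    \<cdot> last_two C V W A A W (\<c> W A) \<cdot> last_two C V W A W A w"

lemma rep_prodS:
  assumes "V \<in> Obj C" "W \<in> Obj C" "v \<in> Hom C (V \<odot> A) (V \<odot> A)" "w \<in> Hom C (W \<odot> A) (W \<odot> A)" "distinct [i, j, k]"
  shows "rep ((Leaf (V, i) ## Leaf (W, j)) ## a k) (prodS V v W w) ((Leaf (V, i) ## Leaf (W, j)) ## a k)
    (\<lambda>st. act2 V v i k (act2 W w j k st))"
  unfolding prodS_def
  by (insert assms, rule rep_cong, (rule reps rep_act2[of v] rep_act2[of w] | (simp; fail))+) (simp add: guard_simps)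

lemma prodS_hom:
  assumes "V \<in> Obj C" "W \<in> Obj C" "v \<in> Hom C (V \<odot> A) (V \<odot> A)" "w \<in> Hom C (W \<odot> A) (W \<odot> A)"
  shows "prodS V v W w \<in> Hom C (V \<odot> W \<odot> A) (V \<odot> W \<odot> A)"
  using rep_prodS[OF assms, of 2 3 4] by (simp add: rep_def)

lemma prodS_action:
  assumes v: "V \<in> Obj C" "v \<in> Hom C (V \<odot> A) (V \<odot> A)" and w: "W \<in> Obj C" "w \<in> Hom C (W \<odot> A) (W \<odot> A)"
  shows "action C H (V \<odot> W) (prodS V v W w) = product_action C H V (action C H V v) W w"
proof -
  let ?w = "(Leaf (V, 2) ## Leaf (W, 3)) ## a 4" and ?w' = "Leaf (V, 2) ## Leaf (W, 3)"
  note r = rep_prodS[OF v(1) w(1) v(2) w(2)] rep_act2[OF w(2,1)] rep_act[OF action_hom[OF v(2,1)] v(1)]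
  show ?thesis
    unfolding action_def[of C H "V \<odot> W"] product_action_def Let_def
    by (insert v(1) w(1), rule rep_inject[of ?w _ ?w'], (rule reps r rep_gens(3) | (simp; fail))+)
      (simp add: guard_simps action v)
qed

lemma prodS_module:
  assumes v: "multiplier_module C Q H V v" and w: "multiplier_module C Q H W w"
  shows "multiplier_module C Q H (V \<odot> W) (prodS V v W w)"
proof (rule multiplier_moduleI)
  note V = moduleD[OF v] and W = moduleD[OF w]
  let ?k = "prodS V v W w" and ?va = "action C H V v" and ?wa = "action C H W w"
  note ah = action_hom[OF V(2,1)] action_hom[OF W(2,1)]
  note r = rep_prodS[OF V(1) W(1) V(2) W(2)] rep_act2[OF V(2,1)] rep_act2[OF W(2,1)]
    rep_act[OF ah(1) V(1)] rep_act[OF ah(2) W(1)]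
  note O [simp] = V(1) W(1)
  show "V \<odot> W \<in> Obj C" by simp
  show k: "?k \<in> Hom C (V \<odot> W \<odot> A) (V \<odot> W \<odot> A)" using V W by (intro prodS_hom) auto
  let ?V = "Leaf (V, 2)" and ?W = "Leaf (W, 3)"
  let ?w = "((?V ## ?W) ## a 4) ## a 5"
  have e: "tt2 4 5 (act2 V v 2 5 (act2 W w 3 5 (act2 V v 2 4 (act2 W w 3 4 st))))
      = act2 V v 2 4 (act2 W w 3 4 (tt2 4 5 st))" for st
    by (simp add: op_commute[of "?W ## a 5" _ "?V ## a 4"] module_axiom[OF v] module_axiom[OF w])
  show "last_two C (V \<odot> W) A A A A (T2 H) \<cdot> last_two C (V \<odot> W) A A A A (braid_inv C A A) \<cdot> (?k \<otimes> \<one> A)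
      \<cdot> last_two C (V \<odot> W) A A A A (\<c> A A) \<cdot> (?k \<otimes> \<one> A) = (?k \<otimes> \<one> A) \<cdot> last_two C (V \<odot> W) A A A A (T2 H)"
    by (rule rep_inject[of ?w _ ?w], (rule reps r rep_gens(2) | (simp; fail))+) (simp add: guard_simps e)
  \<comment> \<open>For membership in \<open>Q\<close>, the product action is composed with a
    further action \<open>?m\<close> on \<open>W\<close>. The result \<open>?K\<close> consists of
    \<open>t2\<close>, the two actions and structural isomorphisms, hence is in \<open>Q\<close> as
    \<open>t2\<close> is invertible; right cancellation concludes.\<close>
  let ?m = "(\<one> V \<otimes> ?wa) \<cdot> \<alpha> V W A"
  let ?K = "(?va \<otimes> \<one> W) \<cdot> assoc_inv C V A W \<cdot> (\<one> V \<otimes> \<c> W A) \<cdot> \<alpha> V W A \<cdot> (?m \<otimes> \<one> A)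
    \<cdot> assoc_inv C (V \<odot> W) A A \<cdot> (\<one> (V \<odot> W) \<otimes> T2 H) \<cdot> \<alpha> (V \<odot> W) A A"
  have m: "?m \<in> Q (V \<odot> W \<odot> A) (V \<odot> W)"
    using V W by (intro Q_cmp[of _ _ "V \<odot> (W \<odot> A)"] Q_structural Q_tensor_ident) auto
  have "act V ?va 2 5 (act2 W w 3 5 (act W ?wa 3 4 st)) = act V ?va 2 5 (act W ?wa 3 4 (tt2 4 5 st))" for st
    by (simp add: act2_act[OF w refl])
  then have e: "ee 5 (act2 V v 2 5 (act2 W w 3 5 (act W ?wa 3 4 st))) = act V ?va 2 5 (act W ?wa 3 4 (tt2 4 5 st))" for st
    using V by (simp add: action)
  have "action C H (V \<odot> W) ?k \<cdot> (?m \<otimes> \<one> A) = ?K"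
    unfolding action_def[of C H "V \<odot> W"]
    by (rule rep_inject[of ?w _ "?V ## ?W"], (rule reps r rep_gens(2,3) | (simp; fail))+) (simp add: guard_simps e)
  moreover have "?K \<in> Q (V \<odot> W \<odot> A \<odot> A) (V \<odot> W)"
  proof -
    have t: "T2 H \<in> Q (A \<odot> A) (A \<odot> A)" using inverse_T2 by (intro Q_inverse) auto
    have 1: "(\<one> (V \<odot> W) \<otimes> T2 H) \<cdot> \<alpha> (V \<odot> W) A A \<in> Q (V \<odot> W \<odot> A \<odot> A) (V \<odot> W \<odot> (A \<odot> A))"
      using t by (intro Q_cmp[of _ _ "V \<odot> W \<odot> (A \<odot> A)"] Q_structural Q_tensor_ident) auto
    have 2: "assoc_inv C (V \<odot> W) A A \<cdot> (\<one> (V \<odot> W) \<otimes> T2 H) \<cdot> \<alpha> (V \<odot> W) A A \<in> Q (V \<odot> W \<odot> A \<odot> A) (V \<odot> W \<odot> A \<odot> A)"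
      by (rule Q_cmp[OF 1 Q_structural(2)]) auto
    have 3: "(?m \<otimes> \<one> A) \<cdot> assoc_inv C (V \<odot> W) A A \<cdot> (\<one> (V \<odot> W) \<otimes> T2 H) \<cdot> \<alpha> (V \<odot> W) A A
        \<in> Q (V \<odot> W \<odot> A \<odot> A) (V \<odot> W \<odot> A)"
      by (rule Q_cmp[OF 2 Q_tensor_ident(1)[OF m]]) auto
    note 4 = Q_cmp[OF 3 Q_structural(1)[OF O A_obj]]
    note 5 = Q_cmp[OF 4 Q_tensor_ident(2)[OF Q_structural(3)[OF O(2) A_obj] _ _ O(1)]]
    note 6 = Q_cmp[OF 5 Q_structural(2)[OF O(1) A_obj O(2)]]
    note 7 = Q_cmp[OF 6 Q_tensor_ident(1)[OF V(3) _ _ O(2)]]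
    show ?thesis by (rule 7) simp_all
  qed
  moreover have "?m \<otimes> \<one> A \<in> Q (V \<odot> W \<odot> A \<odot> A) (V \<odot> W \<odot> A)"
    using m by (intro Q_tensor_ident) auto
  ultimately show "action C H (V \<odot> W) ?k \<in> Q (V \<odot> W \<odot> A) (V \<odot> W)"
    using k by (intro right_cancel[of "V \<odot> W \<odot> A \<odot> A" "V \<odot> W \<odot> A" "V \<odot> W" "?m \<otimes> \<one> A"]) (auto intro!: action_hom)
qed

lemma TensO_modules:
  assumes "multiplier_module C Q H V v" "multiplier_module C Q H W w"
  shows "TensO (module_category C Q H) (V, v) (W, w) = (V \<odot> W, prodS V v W w)"
  using structure_of[OF prodS_module[OF assms] prodS_action] moduleD[OF assms(1)] moduleD[OF assms(2)]
  by (simp add: module_category_def)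

lemma UnitO_modules: "UnitO (module_category C Q H) = (\<I>, \<one> (\<I> \<odot> A))"
  using structure_of[OF unit_module unit_action] by (simp add: module_category_def)

lemma module_homI:
  assumes "multiplier_module C Q H M v" "multiplier_module C Q H N w" "f \<in> Hom C M N"
    "f \<cdot> action C H M v = action C H N w \<cdot> (f \<otimes> \<one> A)"
  shows "f \<in> Hom (module_category C Q H) (M, v) (N, w)"
  using assms by (simp add: module_category_def module_hom_def)

text \<open>On strands both iterated product actions are the same composite, so the associator and
  its inverse commute with them. The inverse occurs in a triangle identity.\<close>

lemma assoc_modules:
  assumes u: "multiplier_module C Q H U u" and v: "multiplier_module C Q H V v" and w: "multiplier_module C Q H W w"
  shows "inverse_arrows (module_category C Q H) (U \<odot> V \<odot> W, prodS (U \<odot> V) (prodS U u V v) W w)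
    (U \<odot> (V \<odot> W), prodS U u (V \<odot> W) (prodS V v W w)) (\<alpha> U V W) (assoc_inv C U V W)"
proof -
  note M = moduleD[OF u] moduleD[OF v] moduleD[OF w]
  note O [simp] = M(1) M(4) M(7)
  note r = rep_act2[OF M(2,1)] rep_act2[OF M(5,4)] rep_act2[OF M(8,7)]
  let ?w = "(Leaf (U, 2) ## Leaf (V, 3)) ## Leaf (W, 4)" and ?w' = "Leaf (U, 2) ## Leaf (V, 3) ## Leaf (W, 4)"
  let ?l = "prodS (U \<odot> V) (prodS U u V v) W w" and ?r = "prodS U u (V \<odot> W) (prodS V v W w)"
  have m: "multiplier_module C Q H (U \<odot> V \<odot> W) ?l" "multiplier_module C Q H (U \<odot> (V \<odot> W)) ?r"
    using u v w by (auto intro!: prodS_module)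
  have 1: "\<alpha> U V W \<cdot> action C H (U \<odot> V \<odot> W) ?l = action C H (U \<odot> (V \<odot> W)) ?r \<cdot> (\<alpha> U V W \<otimes> \<one> A)"
    unfolding action_def prodS_def
    by (rule rep_inject[of "?w ## a 5" _ ?w'], (rule reps r rep_gens(3) | (simp; fail))+) (simp add: guard_simps)
  have 2: "assoc_inv C U V W \<cdot> action C H (U \<odot> (V \<odot> W)) ?r = action C H (U \<odot> V \<odot> W) ?l \<cdot> (assoc_inv C U V W \<otimes> \<one> A)"
    unfolding action_def prodS_def
    by (rule rep_inject[of "?w' ## a 5" _ ?w], (rule reps r rep_gens(3) | (simp; fail))+) (simp add: guard_simps)
  show ?thesis
    unfolding inverse_arrows_def
    using module_homI[OF m _ 1] module_homI[OF m(2,1) _ 2] inverse_assoc[OF O]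
    by (auto simp: module_category_def inverse_arrows_def)
qed

end

section \<open>Operations that create strands\<close>

context symmetric_monoidal_category
begin

text \<open>Units of dualities create strands, whose names must be fresh; \<open>rep' N\<close> is \<open>rep\<close> for states avoiding \<open>N\<close>.\<close>

definition rep' :: "'o name set \<Rightarrow> 'o name word \<Rightarrow> 'm \<Rightarrow> 'o name word \<Rightarrow> (('o, 'm) state \<Rightarrow> ('o, 'm) state) \<Rightarrow> bool"
  where "rep' N w f w' P \<longleftrightarrow> f \<in> Hom C (ob w) (ob w') \<and> good w \<and> good w'
    \<and> (\<forall>st. names st \<inter> N = {} \<longrightarrow> op w f w' st = P st)"

lemma names_op: "names (op w f w' st) \<subseteq> names st - set (lv w) \<union> set (lv w')"
  by (cases "wf_state st", rule op_cases[of st w f w']) (auto simp: not_wf_state names_def)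

lemma fresh_op: "x \<notin> names st \<Longrightarrow> x \<notin> set (lv w') \<Longrightarrow> x \<notin> names (op w f w' st)"
  using names_op[of w f w' st] by auto

lemma rep'_rep: "rep w f w' P \<Longrightarrow> rep' N w f w' P"
  by (simp add: rep_def rep'_def)

text \<open>\<open>N\<close> is a reserve of names. A step that produces some of them takes them out
  of the reserve for the next step.\<close>

lemma rep'_seq:
  assumes f: "rep' N w f w' P" and g: "rep' (N - set (lv w')) w' g w'' P'" and N: "set (lv w') \<subseteq> N \<union> set (lv w)"
  shows "rep' N w (g \<cdot> f) w'' (\<lambda>st. P' (P st))"
proof -
  have "op w (g \<cdot> f) w'' st = P' (P st)" if "names st \<inter> N = {}" for st
  proof -
    have "op w (g \<cdot> f) w'' st = op w' g w'' (op w f w' st)"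
      using f g N that by (intro op_comp_fresh[symmetric]) (auto simp: rep'_def good_def)
    moreover have "names (op w f w' st) \<inter> (N - set (lv w')) = {}" using names_op[of w f w' st] that by auto
    ultimately show ?thesis using f g that by (auto simp: rep'_def)
  qed
  then show ?thesis
    using f g comp_hom[of "ob w" "ob w'" "ob w''" f g] by (auto simp: rep'_def)
qed

lemma rep'_op: "rep' N w f w' P \<Longrightarrow> names st \<inter> N = {} \<Longrightarrow> P st = st' \<Longrightarrow> op w f w' st = st'"
  by (simp add: rep'_def)

lemma rep'_inject:
  assumes "rep' N w f w' P" "rep' N w g w' P'" "N \<inter> set (lv w) = {}"
    "\<And>st. wf_state st \<Longrightarrow> names st = set (lv w) \<Longrightarrow> P st = P' st"
  shows "f = g"
  using assms by (intro op_inject[of w w']) (auto simp: rep'_def Int_commute)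

end

section \<open>The antipode on a module\<close>

locale Hopf_module = Hopf +
  fixes V v2 v
  assumes V_module: "multiplier_module C Q H V v2" and v_def: "v = action C H V v2"
    and v_nondeg: "nondegenerate_action C A V v"
begin

lemmas V_obj [simp] = moduleD(1)[OF V_module]

lemma v2_hom: "v2 \<in> Hom C (V \<odot> A) (V \<odot> A)" and v_Q: "v \<in> Q (V \<odot> A) V" and v_hom: "v \<in> Hom C (V \<odot> A) V"
  using moduleD[OF V_module] by (auto simp: v_def action_hom)

abbreviation vv where "vv \<equiv> act V v"
abbreviation v2v where "v2v \<equiv> act2 V v2"

lemmas rep_v = rep_act[OF v_hom V_obj] and rep_v2 = rep_act2[OF v2_hom V_obj]

lemma vv_def: "i \<noteq> j \<Longrightarrow> vv i j st = ee j (v2v i j st)"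
  using v2_hom by (simp add: v_def action)

lemma vv_vv: "distinct [i, j, k] \<Longrightarrow> vv i k (vv i j st) = vv i j (mL j k st)"
  by (rule act_act[OF V_module v_def])

lemma v2_vv: "distinct [i, j, k] \<Longrightarrow> v2v i k (vv i j st) = vv i j (tt2 j k st)"
  by (rule act2_act[OF V_module v_def])

lemma vv_mR:
  assumes "distinct [i, j, k]"
  shows "vv i k (vv i j st) = vv i k (mR j k st)"
proof -
  have "semigroup_module C Q A m V v" using semigroup_module_of[OF V_module] by (simp add: v_def)
  then have eq: "v \<cdot> (v \<otimes> \<one> A) = v \<cdot> (\<one> V \<otimes> m) \<cdot> \<alpha> V A A" by (simp add: semigroup_module_def)
  show ?thesis
    by (insert assms, rule rep_eqD[OF eq, where w = "(Leaf (V, i) ## a j) ## a k" and w' = "Leaf (V, i)"],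
        (rule reps rep_v rep_mult(2) | (simp; fail))+) (simp_all add: guard_simps)
qed

text \<open>Non-degeneracy of \<open>v\<close> with the unit object as the extra factor; the unit
  constraint is removed to obtain the form required by \<open>factor_through\<close>.\<close>

lemma v_test:
  assumes W: "W \<in> Obj C"
  shows "inj_on (\<lambda>h. v \<cdot> (h \<otimes> \<one> A)) (Hom C W V)"
proof (rule inj_onI)
  fix f g assume fg: "f \<in> Hom C W V" "g \<in> Hom C W V" and eq: "v \<cdot> (f \<otimes> \<one> A) = v \<cdot> (g \<otimes> \<one> A)"
  let ?l = "inv_arrow C (\<I> \<odot> V) V (\<lambda>\<lambda> V)"
  have l: "?l \<in> Hom C V (\<I> \<odot> V)" "\<lambda>\<lambda> V \<cdot> ?l = \<one> V"
    using inverse_lunit[of V] by (auto simp: inverse_arrows_def)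
  let ?w = "Leaf (W, 2)" and ?v = "Leaf (V, 3)"
  have rl: "rep ?v ?l (One ## ?v) (guard (set (lv ?v)))"
  proof -
    have "op ?v ?l (One ## ?v) st = guard (set (lv (One ## ?v))) st" for st
      using inverse_lunit[of V] op_lunit[of ?v] by (intro op_inverse[of "One ## ?v"]) auto
    then show ?thesis using l by (simp add: rep_def)
  qed
  have rf: "rep ?w h ?v (op ?w h ?v)" if "h \<in> Hom C W V" for h using that W by (intro rep_gen) auto
  have h: "(\<one> \<I> \<otimes> v) \<cdot> \<alpha> \<I> V A \<cdot> ((?l \<cdot> h) \<otimes> \<one> A) = ?l \<cdot> v \<cdot> (h \<otimes> \<one> A)" if h: "h \<in> Hom C W V" for h
    by (insert W h, rule rep_inject[of "?w ## a 4" _ "One ## ?v"], (rule reps rl rf rep_v | (simp; fail))+)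
      (simp add: guard_simps)
  have "?l \<cdot> f = ?l \<cdot> g"
  proof (rule inj_onD)
    show "inj_on (\<lambda>f. (\<one> \<I> \<otimes> v) \<cdot> \<alpha> \<I> V A \<cdot> (f \<otimes> \<one> A)) (Hom C W (\<I> \<odot> V))"
      using v_nondeg W by (simp add: nondegenerate_action_def)
    show "(\<one> \<I> \<otimes> v) \<cdot> \<alpha> \<I> V A \<cdot> ((?l \<cdot> f) \<otimes> \<one> A) = (\<one> \<I> \<otimes> v) \<cdot> \<alpha> \<I> V A \<cdot> ((?l \<cdot> g) \<otimes> \<one> A)"
      using fg eq by (simp add: h)
  qed (use fg l W in \<open>auto intro: hom_cmp[of _ _ V]\<close>)
  moreover have "\<lambda>\<lambda> V \<cdot> ?l \<cdot> h = h" if "h \<in> Hom C W V" for h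
    using that l W comp_assoc[of W V "\<I> \<odot> V" V h ?l "\<lambda>\<lambda> V"] by (simp add: comp_ident_left)
  ultimately show "f = g" using fg by metis
qed

abbreviation sV where "sV \<equiv> antipode_pullback C H V v"
abbreviation sv where "sv \<equiv> act V sV"

text \<open>The morphism has to send (w x) y to w (x s(y)). Acting with z gives (w x) (s(y) z), by
  \<open>mR_ss\<close>, where \<open>?G\<close> computes s(y) z through the first component of the
  antipode. This depends on w x only, so non-degeneracy of \<open>v\<close> yields a unique
  factorization, and the definite description of \<open>s^*v\<close> is justified.\<close>

lemma s_hom: "sV \<in> Hom C (V \<odot> A) V"
  and s_eq: "sV \<cdot> (v \<otimes> \<one> A) = v \<cdot> (\<one> V \<otimes> antipode2 C H) \<cdot> \<alpha> V A A"
proof -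
  let ?F = "v \<cdot> (\<one> V \<otimes> antipode2 C H) \<cdot> \<alpha> V A A" and ?V = "Leaf (V, 2)"
  let ?G = "v \<cdot> (\<one> V \<otimes> (\<lambda>\<lambda> A \<cdot> (Counit H \<otimes> \<one> A) \<cdot> inv_arrow C (A \<odot> A) (A \<odot> A) (T1 H))) \<cdot> \<alpha> V A A"
  have F: "?F \<in> Hom C (V \<odot> A \<odot> A) V"
    by (rule rep_hom[of "(?V ## a 3) ## a 4" _ ?V], (rule reps rep_v rep_ss | (simp; fail))+)
  have G: "?G \<in> Hom C (V \<odot> A \<odot> A) V"
    by (rule rep_hom[of "(?V ## a 3) ## a 4" _ ?V], (rule reps rep_v rep_gens(3,4) | (simp; fail))+)
  have e: "vv 2 4 (vv 2 5 (ss 5 3 st)) = vv 2 4 (ee 3 (rr 3 4 (vv 2 5 st)))" for st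
  proof -
    have "vv 2 4 (vv 2 5 (ss 5 3 st)) = vv 2 4 (mR 5 4 (ee 3 (rr 3 4 st)))"
      by (simp add: vv_mR mR_ss)
    also have "\<dots> = vv 2 4 (vv 2 5 (ee 3 (rr 3 4 st)))"
      by (simp add: vv_mR)
    also have "\<dots> = vv 2 4 (ee 3 (rr 3 4 (vv 2 5 st)))"
      by (simp add: op_commute[of "?V ## a 5" ?V])
    finally show ?thesis .
  qed
  have test: "v \<cdot> (?F \<otimes> \<one> A) = ?G \<cdot> ((v \<otimes> \<one> A) \<otimes> \<one> A)"
    by (rule rep_inject[of "((?V ## a 5) ## a 3) ## a 4" _ ?V], (rule reps rep_v rep_ss rep_gens(3,4) | (simp; fail))+)
      (simp add: guard_simps e)
  have "\<exists>!f. f \<in> Hom C (V \<odot> A) V \<and> f \<cdot> (v \<otimes> \<one> A) = ?F"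
    by (rule factor_through[OF v_Q _ _ A_obj _ A_obj _ F v_hom G v_test test]) auto
  from theI'[OF this] show "sV \<in> Hom C (V \<odot> A) V" "sV \<cdot> (v \<otimes> \<one> A) = ?F"
    by (simp_all add: antipode_pullback_def Let_def)
qed

lemmas rep_s = rep_act[OF s_hom V_obj]

lemma sv_vv:
  assumes "distinct [i, j, k]"
  shows "sv i j (vv i k st) = vv i k (ss k j st)"
  by (insert assms, rule rep_eqD[OF s_eq, where w = "(Leaf (V, i) ## a k) ## a j" and w' = "Leaf (V, i)"],
      (rule reps rep_v rep_s rep_ss | (simp; fail))+) (simp_all add: guard_simps)

text \<open>The law w x_1 s(x_2) = w e(x). After composition with \<open>v\<close> it is the
  corresponding law \<open>ss_t2\<close> in \<open>A\<close>.\<close>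

lemma s_v2: "sV \<cdot> v2 = \<rho> V \<cdot> (\<one> V \<otimes> Counit H)"
proof -
  let ?V = "Leaf (V, 2)"
  have e: "sv 2 3 (v2v 2 3 (vv 2 5 st)) = ee 3 (vv 2 5 st)" for st
    by (simp add: v2_vv sv_vv ss_t2 guard_simps op_commute[of _ _ "a 3" One])
  show ?thesis
    by (rule rep_cancel[of "v \<otimes> \<one> A" "(?V ## a 5) ## a 3" "?V ## a 3" _ _ ?V],
        (rule reps rep_v rep_s rep_v2 rep_gens(3) | (simp add: Q_tensor_ident v_Q; fail))+) (simp add: guard_simps e)
qed

lemma sv_v2:
  assumes "i \<noteq> j"
  shows "sv i j (v2v i j st) = gd (V, i) (ee j st)"
  by (insert assms, rule rep_eqD[OF s_v2, where w = "Leaf (V, i) ## a j" and w' = "Leaf (V, i)"],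
      (rule reps rep_v2 rep_s rep_gens(3) | (simp; fail))+) (simp_all add: guard_simps)

text \<open>The law (w s(z)) s(y) = w s(y z), from \<open>ss_ss\<close> by cancelling
  \<open>v\<close>; the braiding is there because the last factor acts first.\<close>

lemma s_s: "sV \<cdot> (sV \<otimes> \<one> A) \<cdot> last_two C V A A A A (\<c> A A) = sV \<cdot> (\<one> V \<otimes> m) \<cdot> \<alpha> V A A"
proof -
  let ?V = "Leaf (V, 2)"
  have e: "sv 2 3 (sv 2 4 (vv 2 5 st)) = sv 2 3 (mL 3 4 (vv 2 5 st))" for st
    by (simp add: sv_vv ss_ss op_commute[of "a 3 ## a 4" "a 3"])
  show ?thesis
    by (rule rep_cancel[of "(v \<otimes> \<one> A) \<otimes> \<one> A" "((?V ## a 5) ## a 3) ## a 4" "(?V ## a 3) ## a 4" _ _ ?V],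
        (rule reps rep_v rep_s rep_mult(1) | (simp add: Q_tensor_ident v_Q; fail))+) (simp add: guard_simps e)
qed

lemma sv_sv:
  assumes "distinct [i, j, k]"
  shows "sv i j (sv i k st) = sv i j (mL j k st)"
  by (insert assms, rule rep_eqD[OF s_s, where w = "(Leaf (V, i) ## a j) ## a k" and w' = "Leaf (V, i)"],
      (rule reps rep_s rep_mult(1) | (simp; fail))+) (simp_all add: guard_simps)

end

section \<open>Renaming of strands\<close>

context symmetric_monoidal_category
begin

text \<open>The triangle identities will return a strand under a new name. Such a renaming is an
  identity with different names at its ends; the next operation consuming the strand absorbs it,
  provided that the new name was free.\<close>

lemma op_rename_right:
  assumes g: "g \<in> Hom C (ob u \<odot> X) (ob w)" "good w" "good (u ## Leaf (X, i))" "good (u ## Leaf (X, j))"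
    and fresh: "(X, j) \<notin> names st"
  shows "op (u ## Leaf (X, j)) g w (op (Leaf (X, i)) (\<one> X) (Leaf (X, j)) st) = op (u ## Leaf (X, i)) g w st"
proof -
  let ?r = "op (Leaf (X, i)) (\<one> X) (Leaf (X, j))"
  have X: "X \<in> Obj C" using g by simp
  have h: "g \<cdot> (\<one> (ob u) \<otimes> \<one> X) = g"
    using g X comp_ident_right[of "ob u \<odot> X" "ob w" g] by (simp add: tensor_ident)
  have "op (u ## Leaf (X, j)) g w (?r st) = op (u ## Leaf (X, j)) g w (guard (set (lv u)) (?r st))"
    by (subst op_guard_subset) auto
  also have "guard (set (lv u)) (?r st) = op (u ## Leaf (X, i)) (\<one> (ob u) \<otimes> \<one> X) (u ## Leaf (X, j)) st"
    using g X by (subst op_right) (auto simp: ident_hom op_guard_disjoint)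
  also have "op (u ## Leaf (X, j)) g w \<dots> = op (u ## Leaf (X, i)) (g \<cdot> (\<one> (ob u) \<otimes> \<one> X)) w st"
    using g X fresh by (intro op_comp_fresh) (auto simp: good_def intro!: tensor_hom ident_hom)
  finally show ?thesis by (simp add: h)
qed

lemma op_rename_left:
  assumes g: "g \<in> Hom C (X \<odot> ob u) (ob w)" "good w" "good (Leaf (X, i) ## u)" "good (Leaf (X, j) ## u)"
    and fresh: "(X, j) \<notin> names st"
  shows "op (Leaf (X, j) ## u) g w (op (Leaf (X, i)) (\<one> X) (Leaf (X, j)) st) = op (Leaf (X, i) ## u) g w st"
proof -
  let ?r = "op (Leaf (X, i)) (\<one> X) (Leaf (X, j))"
  have X: "X \<in> Obj C" using g by simp
  have h: "g \<cdot> (\<one> X \<otimes> \<one> (ob u)) = g"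
    using g X comp_ident_right[of "X \<odot> ob u" "ob w" g] by (simp add: tensor_ident)
  have "op (Leaf (X, j) ## u) g w (?r st) = op (Leaf (X, j) ## u) g w (guard (set (lv u)) (?r st))"
    by (subst op_guard_subset) auto
  also have "guard (set (lv u)) (?r st) = op (Leaf (X, i) ## u) (\<one> X \<otimes> \<one> (ob u)) (Leaf (X, j) ## u) st"
    using g X by (subst op_left) (auto simp: ident_hom op_guard_disjoint)
  also have "op (Leaf (X, j) ## u) g w \<dots> = op (Leaf (X, i) ## u) (g \<cdot> (\<one> X \<otimes> \<one> (ob u))) w st"
    using g X fresh by (intro op_comp_fresh) (auto simp: good_def intro!: tensor_hom ident_hom)
  finally show ?thesis by (simp add: h)
qed

lemma rep_rename: "X \<in> Obj C \<Longrightarrow> rep (Leaf (X, i)) (\<one> X) (Leaf (X, j)) (op (Leaf (X, i)) (\<one> X) (Leaf (X, j)))"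
  by (rule rep_gen) (auto simp: ident_hom)

end

context Hopf
begin

lemma act_rename:
  assumes "n \<in> Hom C (N \<odot> A) N" "N \<in> Obj C" "distinct [i, j, k]" "(N, j) \<notin> names st"
  shows "act N n j k (op (Leaf (N, i)) (\<one> N) (Leaf (N, j)) st) = op (Leaf (N, i)) (\<one> N) (Leaf (N, j)) (act N n i k st)"
proof -
  have "act N n j k (op (Leaf (N, i)) (\<one> N) (Leaf (N, j)) st) = op (Leaf (N, i) ## a k) n (Leaf (N, j)) st"
    using assms by (intro op_rename_left) auto
  also have "\<dots> = op (Leaf (N, i) ## a k) (\<one> N \<cdot> n) (Leaf (N, j)) st"
    using assms comp_ident_left[of "N \<odot> A" N n] by simp
  also have "\<dots> = op (Leaf (N, i)) (\<one> N) (Leaf (N, j)) (act N n i k st)"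
    using assms by (intro op_seq) (auto simp: ident_hom)
  finally show ?thesis .
qed

end

section \<open>Dual modules\<close>

locale Hopf_dual = Hopf_module +
  fixes D \<eta> \<epsilon> d
  assumes dual: "left_dual C D V \<eta> \<epsilon>" and d_def: "d = dual_action C H V v D \<eta> \<epsilon>"
    and d_Q: "d \<in> Q (D \<odot> A) D"
begin

lemma D_obj [simp]: "D \<in> Obj C" and eta_hom: "\<eta> \<in> Hom C \<I> (V \<odot> D)" and eps_hom: "\<epsilon> \<in> Hom C (D \<odot> V) \<I>"
  using dual by (simp_all add: left_dual_def)

lemma triangles:
  "\<rho> V \<cdot> (\<one> V \<otimes> \<epsilon>) \<cdot> \<alpha> V D V \<cdot> (\<eta> \<otimes> \<one> V) = \<lambda>\<lambda> V"
  "\<lambda>\<lambda> D \<cdot> (\<epsilon> \<otimes> \<one> D) \<cdot> assoc_inv C D V D \<cdot> (\<one> D \<otimes> \<eta>) = \<rho> D"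
  using dual by (simp_all add: left_dual_def assoc_inv_def)

abbreviation ev where "ev i j \<equiv> op (Leaf (D, i) ## Leaf (V, j)) \<epsilon> One"
abbreviation co where "co i j \<equiv> op One \<eta> (Leaf (V, i) ## Leaf (D, j))"
abbreviation ren where "ren X i j \<equiv> op (Leaf (X, i)) (\<one> X) (Leaf (X, j))"

lemma rep_ev: "i \<noteq> j \<Longrightarrow> rep (Leaf (D, i) ## Leaf (V, j)) \<epsilon> One (ev i j)"
  using eps_hom by (auto intro!: rep_gen)

lemma rep_co: "i \<noteq> j \<Longrightarrow> rep One \<eta> (Leaf (V, i) ## Leaf (D, j)) (co i j)"
  using eta_hom by (auto intro!: rep_gen)

text \<open>The first triangle identity. On strands it leaves a renaming, because the strand of
  \<open>V\<close> that survives is the created one.\<close>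

lemma ev_co:
  assumes "distinct [i, j, k]" "(V, j) \<notin> names st" "(D, k) \<notin> names st"
  shows "ev k i (co j k st) = ren V i j st"
proof -
  let ?w = "One ## Leaf (V, i)"
  have n: "names st \<inter> {(V, j), (D, k)} = {}" using assms by auto
  have "op ?w (\<rho> V \<cdot> (\<one> V \<otimes> \<epsilon>) \<cdot> \<alpha> V D V \<cdot> (\<eta> \<otimes> \<one> V)) (Leaf (V, j)) st = ev k i (co j k st)"
    by (insert assms(1), rule rep'_op[OF _ n], (rule rep'_seq reps rep_ev rep_co[of j k] rep'_rep | (simp; fail))+)
      (simp_all add: guard_simps)
  moreover have "op ?w (\<one> V \<cdot> \<lambda>\<lambda> V) (Leaf (V, j)) st = ren V i j st"
    by (rule rep_op, (rule rep_seq rep_lunit rep_rename | (simp; fail))+) (simp_all add: guard_simps)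
  moreover have "\<one> V \<cdot> \<lambda>\<lambda> V = \<lambda>\<lambda> V" by (simp add: comp_ident_left[of "\<I> \<odot> V"])
  ultimately show ?thesis using triangles(1) by simp
qed

lemma ev_co':
  assumes "distinct [i, j, k]" "(V, j) \<notin> names st" "(D, k) \<notin> names st"
  shows "ev i j (co j k st) = ren D i k st"
proof -
  let ?w = "Leaf (D, i) ## One"
  have n: "names st \<inter> {(V, j), (D, k)} = {}" using assms by auto
  have "op ?w (\<lambda>\<lambda> D \<cdot> (\<epsilon> \<otimes> \<one> D) \<cdot> assoc_inv C D V D \<cdot> (\<one> D \<otimes> \<eta>)) (Leaf (D, k)) st = ev i j (co j k st)"
    by (insert assms(1), rule rep'_op[OF _ n], (rule rep'_seq reps rep_ev rep_co[of j k] rep'_rep | (simp; fail))+)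
      (simp_all add: guard_simps)
  moreover have "op ?w (\<one> D \<cdot> \<rho> D) (Leaf (D, k)) st = ren D i k st"
    by (rule rep_op, (rule rep_seq rep_runit rep_rename | (simp; fail))+) (simp_all add: guard_simps)
  moreover have "\<one> D \<cdot> \<rho> D = \<rho> D" by (simp add: comp_ident_left[of "D \<odot> \<I>"])
  ultimately show ?thesis using triangles(2) by simp
qed

text \<open>A morphism into \<open>D\<close> can be recovered from its pairing with \<open>V\<close>
  by pairing with the first half of a created pair, \<open>co 7 8\<close>. All tags differ because
  \<open>X\<close>, \<open>V\<close> and \<open>D\<close> may coincide.\<close>

lemma eps_mate:
  assumes X: "X \<in> Obj C" and f: "f \<in> Hom C X D" "g \<in> Hom C X D" and eq: "\<epsilon> \<cdot> (f \<otimes> \<one> V) = \<epsilon> \<cdot> (g \<otimes> \<one> V)"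
  shows "f = g"
proof (rule op_inject[of "Leaf (X, 10)" "Leaf (D, 8)"])
  fix st assume "wf_state st" and st: "names st = set (lv (Leaf (X, 10)))"
  have key: "op (Leaf (X, 10)) h (Leaf (D, 8)) st = op (Leaf (X, 10) ## Leaf (V, 7)) (\<epsilon> \<cdot> (h \<otimes> \<one> V)) One (co 7 8 st)"
    if h: "h \<in> Hom C X D" for h
  proof -
    let ?h = "op (Leaf (X, 10)) h (Leaf (D, 9))"
    have n: "names (?h st) \<subseteq> {(D, 9)}" "names (co 7 8 st) \<inter> {(D, 9)} = {}"
      using names_op[of "Leaf (X, 10)" h "Leaf (D, 9)" st] names_op[of One \<eta> "Leaf (V, 7) ## Leaf (D, 8)" st] st by auto
    have r: "rep (Leaf (X, 10)) h (Leaf (D, 9)) ?h" using h X by (intro rep_gen) auto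
    have "op (Leaf (X, 10)) h (Leaf (D, 8)) st = op (Leaf (X, 10)) (\<one> D \<cdot> h) (Leaf (D, 8)) st"
      using h X by (simp add: comp_ident_left)
    also have "\<dots> = ren D 9 8 (?h st)"
      using h X st by (intro op_comp_fresh[symmetric]) (auto simp: ident_hom)
    also have "\<dots> = ev 9 7 (co 7 8 (?h st))"
      using n by (intro ev_co'[symmetric]) auto
    also have "\<dots> = ev 9 7 (?h (co 7 8 st))"
      by (subst op_commute) auto
    also have "\<dots> = op (Leaf (X, 10) ## Leaf (V, 7)) (\<epsilon> \<cdot> (h \<otimes> \<one> V)) One (co 7 8 st)"
      by (rule sym, insert h X, rule rep'_op[OF _ n(2)], (rule rep'_seq reps rep_ev r rep'_rep | (simp; fail))+)
        (simp_all add: guard_simps)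
    finally show ?thesis .
  qed
  show "op (Leaf (X, 10)) f (Leaf (D, 8)) st = op (Leaf (X, 10)) g (Leaf (D, 8)) st"
    using key[OF f(1)] key[OF f(2)] eq by simp
qed (use X f in auto)

text \<open>The same recovery as in \<open>eps_mate\<close>, with the output strand of
  \<open>V\<close>, tagged 6, carried along untouched.\<close>

lemma eta_mate:
  assumes X: "X \<in> Obj C" and f: "f \<in> Hom C X (V \<odot> D)" "g \<in> Hom C X (V \<odot> D)"
    and eq: "(\<one> V \<otimes> \<epsilon>) \<cdot> \<alpha> V D V \<cdot> (f \<otimes> \<one> V) = (\<one> V \<otimes> \<epsilon>) \<cdot> \<alpha> V D V \<cdot> (g \<otimes> \<one> V)"
  shows "f = g"
proof (rule op_inject[of "Leaf (X, 10)" "Leaf (V, 6) ## Leaf (D, 5)"])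
  fix st assume "wf_state st" and st: "names st = set (lv (Leaf (X, 10)))"
  have key: "op (Leaf (X, 10)) h (Leaf (V, 6) ## Leaf (D, 5)) st
     = op (Leaf (X, 10) ## Leaf (V, 4)) ((\<one> V \<otimes> \<epsilon>) \<cdot> \<alpha> V D V \<cdot> (h \<otimes> \<one> V)) (Leaf (V, 6) ## One) (co 4 5 st)"
    if h: "h \<in> Hom C X (V \<odot> D)" for h
  proof -
    let ?h = "op (Leaf (X, 10)) h (Leaf (V, 6) ## Leaf (D, 3))"
    have n: "names (?h st) \<subseteq> {(V, 6), (D, 3)}" "names (co 4 5 st) \<inter> {(V, 6), (D, 3)} = {}"
      using names_op[of "Leaf (X, 10)" h "Leaf (V, 6) ## Leaf (D, 3)" st]
        names_op[of One \<eta> "Leaf (V, 4) ## Leaf (D, 5)" st] st by auto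
    have r: "rep (Leaf (X, 10)) h (Leaf (V, 6) ## Leaf (D, 3)) ?h" using h X by (intro rep_gen) auto
    have "op (Leaf (X, 10)) h (Leaf (V, 6) ## Leaf (D, 5)) st
        = op (Leaf (X, 10)) ((\<one> V \<otimes> \<one> D) \<cdot> h) (Leaf (V, 6) ## Leaf (D, 5)) st"
      using h X by (simp add: comp_ident_left tensor_ident)
    also have "\<dots> = op (Leaf (V, 6) ## Leaf (D, 3)) (\<one> V \<otimes> \<one> D) (Leaf (V, 6) ## Leaf (D, 5)) (?h st)"
      using h X st by (intro op_comp_fresh[symmetric]) (auto simp: ident_hom tensor_ident)
    also have "\<dots> = ren D 3 5 (?h st)"
      by (subst op_right) (auto simp: ident_hom guard_simps)
    also have "\<dots> = ev 3 4 (co 4 5 (?h st))"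
      using n by (intro ev_co'[symmetric]) auto
    also have "\<dots> = ev 3 4 (?h (co 4 5 st))"
      by (subst op_commute) auto
    also have "\<dots> = op (Leaf (X, 10) ## Leaf (V, 4)) ((\<one> V \<otimes> \<epsilon>) \<cdot> \<alpha> V D V \<cdot> (h \<otimes> \<one> V)) (Leaf (V, 6) ## One) (co 4 5 st)"
      by (rule sym, insert h X, rule rep'_op[OF _ n(2)], (rule rep'_seq reps rep_ev r rep'_rep | (simp; fail))+)
        (simp_all add: guard_simps)
    finally show ?thesis .
  qed
  show "op (Leaf (X, 10)) f (Leaf (V, 6) ## Leaf (D, 5)) st = op (Leaf (X, 10)) g (Leaf (V, 6) ## Leaf (D, 5)) st"
    using key[OF f(1)] key[OF f(2)] eq by simp
qed (use X f in auto)

lemma d_hom: "d \<in> Hom C (D \<odot> A) D"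
  using d_Q by (intro Q_hom) auto

abbreviation dd where "dd \<equiv> act D d"

lemmas rep_d = rep_act[OF d_hom D_obj]

text \<open>By construction \<open>d\<close> creates a pair, acts on the created \<open>V\<close>
  through the antipode and pairs it with the given \<open>D\<close>. Pairing the created
  \<open>D\<close> with another \<open>V\<close> contracts the pair by a triangle identity, so that
  the antipode acts on this other \<open>V\<close>.\<close>

lemma eps_d: "\<epsilon> \<cdot> (d \<otimes> \<one> V) = \<epsilon> \<cdot> (\<one> D \<otimes> (sV \<cdot> \<c> A V)) \<cdot> \<alpha> D A V"
proof -
  let ?w = "(Leaf (D, 2) ## a 3) ## Leaf (V, 4)"
  \<comment> \<open>The output is tagged 7, unlike the input, because it is the strand of
    \<open>D\<close> created by the unit of the duality.\<close>
  let ?d = "op (Leaf (D, 2) ## a 3) d (Leaf (D, 7))"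
  have r: "rep (Leaf (D, 2) ## a 3) d (Leaf (D, 7)) ?d" using d_hom by (intro rep_gen) auto
  have e: "ev 7 4 (?d st) = ev 2 4 (sv 4 3 st)" if st: "names st = set (lv ?w)" for st
  proof -
    have n: "names st \<inter> {(V, 6), (D, 7)} = {}" using st by auto
    have "?d st = ev 2 6 (sv 6 3 (co 6 7 st))"
      unfolding d_def dual_action_def Let_def
      by (rule rep'_op[OF _ n], (rule rep'_seq reps rep_ev rep_s rep_co[of 6 7] rep'_rep | (simp; fail))+)
        (simp_all add: guard_simps)
    then have "ev 7 4 (?d st) = ev 2 6 (sv 6 3 (ev 7 4 (co 6 7 st)))"
      by (simp add: op_commute[of "Leaf (D, 7) ## Leaf (V, 4)" One])
    also have "\<dots> = ev 2 6 (ren V 4 6 (sv 4 3 st))"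
      using st by (simp add: ev_co act_rename[OF s_hom])
    also have "\<dots> = ev 2 4 (sv 4 3 st)"
      using eps_hom st by (intro op_rename_right) (auto simp: fresh_op)
    finally show ?thesis .
  qed
  show ?thesis
    by (rule rep'_inject[of "{(V, 6), (D, 7)}" ?w _ One],
        (rule rep'_seq reps r rep_s rep_ev rep'_rep | (simp; fail))+) (simp_all add: guard_simps e)
qed

lemma ev_dd:
  assumes "distinct [i, j, k]"
  shows "ev i k (dd i j st) = ev i k (sv k j st)"
  by (insert assms, rule rep_eqD[OF eps_d, where w = "(Leaf (D, i) ## a j) ## Leaf (V, k)" and w' = "One"],
      (rule reps rep_d rep_s rep_ev | (simp; fail))+) (simp_all add: guard_simps)

text \<open>Transposition reverses the order of two successive actions and the antipode reverses
  products. The two reversals cancel: both sides, paired with w, give f paired with w s(x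
  y).\<close>

lemma dual_semigroup_module: "semigroup_module C Q A m D d"
proof -
  let ?w = "(Leaf (D, 2) ## a 3) ## a 4"
  have e: "ev 2 5 (dd 2 4 (dd 2 3 st)) = ev 2 5 (dd 2 3 (mL 3 4 st))" for st
  proof -
    have "ev 2 5 (dd 2 4 (dd 2 3 st)) = ev 2 5 (dd 2 3 (sv 5 4 st))"
      by (simp add: ev_dd op_commute[of "Leaf (V, 5) ## a 4" "Leaf (V, 5)"])
    then show ?thesis by (simp add: ev_dd sv_sv)
  qed
  have "d \<cdot> (d \<otimes> \<one> A) = d \<cdot> (\<one> D \<otimes> m) \<cdot> \<alpha> D A A"
  proof (rule eps_mate)
    show "d \<cdot> (d \<otimes> \<one> A) \<in> Hom C (D \<odot> A \<odot> A) D"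
      by (rule rep_hom[of ?w _ "Leaf (D, 2)"], (rule reps rep_d | (simp; fail))+)
    show "d \<cdot> (\<one> D \<otimes> m) \<cdot> \<alpha> D A A \<in> Hom C (D \<odot> A \<odot> A) D"
      by (rule rep_hom[of ?w _ "Leaf (D, 2)"], (rule reps rep_d rep_mult(1) | (simp; fail))+)
    show "\<epsilon> \<cdot> ((d \<cdot> (d \<otimes> \<one> A)) \<otimes> \<one> V) = \<epsilon> \<cdot> ((d \<cdot> (\<one> D \<otimes> m) \<cdot> \<alpha> D A A) \<otimes> \<one> V)"
      by (rule rep_inject[of "?w ## Leaf (V, 5)" _ One], (rule reps rep_d rep_ev rep_mult(1) | (simp; fail))+)
        (simp add: guard_simps e)
  qed auto
  then show ?thesis using d_Q d_hom by (simp add: semigroup_module_def)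
qed

definition d2 where "d2 = structure_of C Q H D d"

lemma d2_module: "multiplier_module C Q H D d2" and d2_action: "action C H D d2 = d"
  using structure_exists[OF dual_semigroup_module] structure_of unfolding d2_def by metis+

lemma d2_hom: "d2 \<in> Hom C (D \<odot> A) (D \<odot> A)"
  using moduleD[OF d2_module] by simp

abbreviation d2d where "d2d \<equiv> act2 D d2"

lemmas rep_d2 = rep_act2[OF d2_hom D_obj]

lemma dd_eq: "i \<noteq> j \<Longrightarrow> ee j (d2d i j st) = dd i j st"
  using action[OF d2_hom, of i j st] by (simp add: d2_action)

lemma d2_dd: "distinct [i, j, k] \<Longrightarrow> d2d i k (dd i j st) = dd i j (tt2 j k st)"
  by (rule act2_act[OF d2_module d2_action[symmetric]])

text \<open>In the product, x_1 acts on \<open>V\<close> and x_2 on \<open>D\<close>; transposing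
  the second action gives f paired with w x_1 s(x_2).\<close>

lemma eps_module_hom:
  "\<epsilon> \<cdot> action C H (D \<odot> V) (prodS D d2 V v2) = action C H \<I> (\<one> (\<I> \<odot> A)) \<cdot> (\<epsilon> \<otimes> \<one> A)"
proof -
  have e: "ev 2 3 (ee 4 (d2d 2 4 (v2v 3 4 st))) = ee 4 (ev 2 3 st)" for st
    by (simp add: dd_eq ev_dd sv_v2 guard_simps op_commute[of _ _ "a 4" One])
  show ?thesis
    unfolding action_def
    by (rule rep_inject[of "(Leaf (D, 2) ## Leaf (V, 3)) ## a 4" _ One],
        (rule reps rep_gens(3) rep_ev rep_prodS[OF D_obj V_obj d2_hom v2_hom] | (simp; fail))+)
      (simp add: guard_simps e)
qed

text \<open>In Sweedler notation the structure \<open>d2\<close> sends \<open>f x\<close> to \<open>f x\<^sub>1\<close> and \<open>x\<^sub>2\<close>, and its transpose sends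
  \<open>(w b) x\<close> to \<open>w b s(x\<^sub>1)\<close> and \<open>x\<^sub>2\<close>, that is, to the inverse of \<open>t\<^sub>2\<close> applied to \<open>b x\<close>.\<close>

lemma ev_d2: "ev 6 3 (d2d 6 2 (vv 3 4 st)) = ev 6 3 (vv 3 4 (uu 4 2 st))"
proof -
  let ?D = "Leaf (D, 6)" and ?V = "Leaf (V, 3)"
  let ?w = "(?D ## a 2) ## (?V ## a 4)"
  let ?u = "inv_arrow C (A \<odot> A) (A \<odot> A) (T2 H)"
  \<comment> \<open>Both sides as morphisms on \<open>(D \<odot> A) \<odot> (V \<odot> A)\<close>,
    so that \<open>D\<close> can be replaced by \<open>D\<close> acted on by strand 5, where
    \<open>d2\<close> is known, and \<open>d\<close> be cancelled. The element of \<open>V\<close>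
    has the form w b because \<open>uu\<close> needs a factor b to act on.\<close>
  let ?L = "\<lambda>\<lambda> A \<cdot> (\<epsilon> \<otimes> \<one> A) \<cdot> last_two C D A V V A (\<c> A V) \<cdot> (\<one> (D \<odot> A) \<otimes> v) \<cdot> (d2 \<otimes> \<one> (V \<odot> A))"
  let ?R = "\<lambda>\<lambda> A \<cdot> (\<epsilon> \<otimes> \<one> A) \<cdot> assoc_inv C D V A
    \<cdot> (\<one> D \<otimes> ((v \<otimes> \<one> A) \<cdot> last_two C V A A A A ?u \<cdot> \<c> A (V \<odot> A))) \<cdot> \<alpha> D A (V \<odot> A)"
  note r = rep_ev rep_v rep_d rep_d2 rep_gens(5)
  have e: "ev 6 3 (vv 3 4 (d2d 6 2 (dd 6 5 st))) = ev 6 3 (vv 3 4 (uu 4 2 (dd 6 5 st)))" for st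
  proof -
    have "ev 6 3 (vv 3 4 (d2d 6 2 (dd 6 5 st))) = ev 6 3 (dd 6 5 (vv 3 4 (tt2 5 2 st)))"
      by (simp add: d2_dd op_commute[of "?V ## a 4" ?V])
    also have "\<dots> = ev 6 3 (dd 6 5 (vv 3 4 (uu 4 2 st)))"
      by (simp add: ev_dd sv_vv ss_u)
    also have "\<dots> = ev 6 3 (vv 3 4 (uu 4 2 (dd 6 5 st)))"
      by (simp add: op_commute[of "?D ## a 5" ?D])
    finally show ?thesis .
  qed
  have L: "?L = ?R"
    by (rule rep_cancel[of "(d \<otimes> \<one> A) \<otimes> \<one> (V \<odot> A)" "((?D ## a 5) ## a 2) ## (?V ## a 4)" ?w _ _ "a 2"],
        (rule reps r | (simp add: Q_tensor_ident d_Q; fail))+) (simp add: guard_simps e)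
  have "ev 6 3 (vv 3 4 (d2d 6 2 st)) = ev 6 3 (vv 3 4 (uu 4 2 st))"
    by (rule rep_eqD[OF L, where w = ?w and w' = "a 2"], (rule reps r | (simp; fail))+) (simp_all add: guard_simps)
  then show ?thesis by (simp add: op_commute[of "?V ## a 4" ?V])
qed

text \<open>By \<open>eta_mate\<close> the claim concerns contraction with a strand of
  \<open>V\<close>, and cancelling \<open>?q\<close> lets this strand have the form w b, so that
  \<open>ev_d2\<close> applies. Both sides become w b e(x), the right one through b s(x_1) x_2 = b
  e(x).\<close>

lemma eta_module_hom:
  "\<eta> \<cdot> action C H \<I> (\<one> (\<I> \<odot> A)) = action C H (V \<odot> D) (prodS V v2 D d2) \<cdot> (\<eta> \<otimes> \<one> A)" (is "?f = ?g")
proof (rule eta_mate)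
  let ?V = "Leaf (V, 3)" and ?w = "One ## a 2" and ?VD = "Leaf (V, 5) ## Leaf (D, 6)"
  note r = rep_gens(3) rep_co[of 5 6] rep_prodS[OF V_obj D_obj v2_hom d2_hom]
  show f: "?f \<in> Hom C (\<I> \<odot> A) (V \<odot> D)"
    unfolding action_def by (rule rep_hom[of ?w _ ?VD], (rule reps r | (simp; fail))+)
  show g: "?g \<in> Hom C (\<I> \<odot> A) (V \<odot> D)"
    unfolding action_def by (rule rep_hom[of ?w _ ?VD], (rule reps r | (simp; fail))+)
  let ?q = "\<one> (\<I> \<odot> A) \<otimes> v" and ?t = "(\<one> V \<otimes> \<epsilon>) \<cdot> \<alpha> V D V"
  have e: "ev 6 3 (co 5 6 (ee 2 (vv 3 4 st))) = ev 6 3 (ee 2 (v2v 5 2 (d2d 6 2 (co 5 6 (vv 3 4 st)))))"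
    if st: "names st = {(A, 2), (V, 3), (A, 4)}" for st
  proof -
    let ?s = "ee 2 (vv 3 4 st)" and ?u = "uu 4 2 st"
    have n: "(V, 5) \<notin> names ?s" "(D, 6) \<notin> names ?s" "(V, 5) \<notin> names (vv 3 4 ?u)" "(D, 6) \<notin> names (vv 3 4 ?u)"
      using st by (simp_all add: fresh_op)
    have "ev 6 3 (ee 2 (v2v 5 2 (d2d 6 2 (co 5 6 (vv 3 4 st)))))
        = vv 5 2 (ev 6 3 (d2d 6 2 (co 5 6 (vv 3 4 st))))"
      by (simp add: vv_def op_commute[of "Leaf (D, 6) ## ?V" One])
    also have "\<dots> = vv 5 2 (ev 6 3 (d2d 6 2 (vv 3 4 (co 5 6 st))))"
      by (simp add: op_commute[of One _ "?V ## a 4"])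
    also have "\<dots> = vv 5 2 (ev 6 3 (vv 3 4 (uu 4 2 (co 5 6 st))))"
      by (simp add: ev_d2)
    also have "\<dots> = vv 5 2 (ev 6 3 (co 5 6 (vv 3 4 ?u)))"
      by (simp add: op_commute[of _ _ One])
    also have "\<dots> = vv 5 2 (ren V 3 5 (vv 3 4 ?u))"
      using n by (simp add: ev_co)
    also have "\<dots> = ren V 3 5 (vv 3 2 (vv 3 4 ?u))"
      using n by (simp add: act_rename[OF v_hom])
    also have "\<dots> = ren V 3 5 ?s"
      by (simp add: vv_vv mL_u guard_simps op_commute[of _ _ "a 2" One])
    also have "\<dots> = ev 6 3 (co 5 6 ?s)"
      using n by (simp add: ev_co)
    finally show ?thesis ..
  qed
  let ?tf = "(\<one> V \<otimes> \<epsilon>) \<cdot> \<alpha> V D V \<cdot> (?f \<otimes> \<one> V)" and ?tg = "(\<one> V \<otimes> \<epsilon>) \<cdot> \<alpha> V D V \<cdot> (?g \<otimes> \<one> V)"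
  show "?tf = ?tg"
  proof (rule Q_epi)
    show "?q \<in> Q (\<I> \<odot> A \<odot> (V \<odot> A)) (\<I> \<odot> A \<odot> V)" using v_Q by (intro Q_tensor_ident) auto
    have t: "h \<otimes> \<one> V \<in> Hom C (\<I> \<odot> A \<odot> V) (V \<odot> D \<odot> V)" if "h \<in> Hom C (\<I> \<odot> A) (V \<odot> D)" for h
      using that by (auto intro!: hom_ten1)
    have t': "(\<one> V \<otimes> \<epsilon>) \<cdot> \<alpha> V D V \<cdot> h \<in> Hom C (\<I> \<odot> A \<odot> V) (V \<odot> \<I>)" if "h \<in> Hom C (\<I> \<odot> A \<odot> V) (V \<odot> D \<odot> V)" for h
      by (rule hom_cmp[OF hom_cmp[OF that alpha_hom] tensor_hom[OF _ _ _ _ ident_hom eps_hom]]) simp_all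
    show "?tf \<in> Hom C (\<I> \<odot> A \<odot> V) (V \<odot> \<I>)" "?tg \<in> Hom C (\<I> \<odot> A \<odot> V) (V \<odot> \<I>)"
      by (rule t'[OF t[OF f]], rule t'[OF t[OF g]])
    show "?tf \<cdot> ?q = ?tg \<cdot> ?q"
      unfolding action_def
      by (rule rep'_inject[of "{(V, 5), (D, 6)}" "?w ## (?V ## a 4)" _ "Leaf (V, 5) ## One"],
          (rule rep'_seq reps r rep_v rep_ev rep'_rep | (simp; fail))+) (simp_all add: guard_simps e insert_commute)
  qed simp_all
qed simp

text \<open>Composition and constraints of modules are those of \<open>C\<close>, so the triangle
  identities carry over once \<open>\<eta>\<close> and \<open>\<epsilon>\<close> are module
  morphisms. Only the inverse associator must be identified, since its definite description now
  ranges over module morphisms.\<close>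

lemma dual_module_category:
  "left_dual (module_category C Q H) (D, d2) (V, v2) \<eta> \<epsilon>"
proof -
  let ?M = "module_category C Q H"
  let ?X = "(D \<odot> V \<odot> D, prodS (D \<odot> V) (prodS D d2 V v2) D d2)" and ?Y = "(D \<odot> (V \<odot> D), prodS D d2 (V \<odot> D) (prodS V v2 D d2))"
  note P = prodS_module[OF V_module d2_module] prodS_module[OF d2_module V_module]
  have a: "inverse_arrows ?M ?X ?Y (\<alpha> D V D) (assoc_inv C D V D)"
    by (rule assoc_modules[OF d2_module V_module d2_module])
  have "inv_arrow ?M ?X ?Y (\<alpha> D V D) = assoc_inv C D V D"
    unfolding inv_arrow_def
  proof (rule the_equality)
    show "inverse_arrows ?M ?X ?Y (\<alpha> D V D) (assoc_inv C D V D)" by (rule a)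
  next
    \<comment> \<open>An inverse among module morphisms is also an inverse in \<open>C\<close>,
      where inverses are unique.\<close>
    fix g assume "inverse_arrows ?M ?X ?Y (\<alpha> D V D) g"
    then have "inverse_arrows C (D \<odot> V \<odot> D) (D \<odot> (V \<odot> D)) (\<alpha> D V D) g"
      by (auto simp: inverse_arrows_def module_category_def module_hom_def)
    then show "g = assoc_inv C D V D"
      unfolding assoc_inv_def by (intro inv_arrow_unique[symmetric] mcat) auto
  qed
  moreover have "\<eta> \<in> Hom ?M (\<I>, \<one> (\<I> \<odot> A)) (V \<odot> D, prodS V v2 D d2)"
    by (rule module_homI[OF unit_module P(1) eta_hom eta_module_hom])
  moreover have "\<epsilon> \<in> Hom ?M (D \<odot> V, prodS D d2 V v2) (\<I>, \<one> (\<I> \<odot> A))"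
    by (rule module_homI[OF P(2) unit_module eps_hom eps_module_hom])
  moreover have "(D, d2) \<in> Obj ?M" "(V, v2) \<in> Obj ?M"
    using d2_module V_module by (simp_all add: module_category_def)
  ultimately show ?thesis
    unfolding left_dual_def
    using triangles TensO_modules[OF V_module d2_module] TensO_modules[OF d2_module V_module]
      TensO_modules[OF P(2) d2_module] TensO_modules[OF d2_module P(1)] UnitO_modules
    by simp (simp add: module_category_def)
qed

end

theorem theorem5p12:
  fixes C :: "('o, 'm, 'z) symmoncat_scheme"
    and Q :: "'o \<Rightarrow> 'o \<Rightarrow> 'm set"
    and H :: "('o, 'm) multiplier_data"
    and V V' :: 'o and v2 v v' \<eta> \<epsilon> :: 'm
  assumes "symmetric_monoidal_category C"
    and "epi_class C Q"
    and "multiplier_Hopf_monoid C H"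
    and "nondegenerate_mult C (Carr H) (mult C H)"
    and "Counit H \<in> Q (Carr H) (UnitO C)"
    and "multiplier_module C Q H V v2"
    and "v = action C H V v2"
    and "nondegenerate_action C (Carr H) V v"
    and "left_dual C V' V \<eta> \<epsilon>"
    and "v' = dual_action C H V v V' \<eta> \<epsilon>"
    and "v' \<in> Q (TensO C V' (Carr H)) V'"
  shows "semigroup_module C Q (Carr H) (mult C H) V' v' \<and>
    (\<exists>v2'. multiplier_module C Q H V' v2' \<and> action C H V' v2' = v' \<and>
      left_dual (module_category C Q H) (V', v2') (V, v2) \<eta> \<epsilon>)"
proof -
  interpret symmetric_monoidal_category C by fact
  interpret epi_class C Q by fact
  interpret Hopf_dual C Q H V v2 v V' \<eta> \<epsilon> v'
    by unfold_locales (use assms in simp_all)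
  show ?thesis
    using dual_semigroup_module d2_module d2_action dual_module_category by blast
qed

end
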